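(* Consider the multistage stochastic program (MSP) and the algorithm DASC described in the context, and the sequences of stochastic decisions $x_n^k$ and of recourse function approximations $\mathcal{Q}_t^k$ generated by DASC. Let Assumptions (H0), (H1) and (H2) of the context hold. Then: (i) Almost surely, for $t=2,\dots,T+1$, $$\forall n\in\mathtt{Nodes}(t-1):\quad \lim_{k\to+\infty}\ \mathcal{Q}_t(x_n^k)-\mathcal{Q}_t^k(x_n^k)=0 .$$ (ii) Almost surely, the limit of the sequence $(F_1^{k-1}(x_{n_1}^k,x_0,\xi_1))_k$ of approximate first stage optimal values and of the sequence $(\underline{\mathfrak{Q}}_1^k(x_0,\xi_1))_k$ is the optimal value $\mathcal{Q}_1(x_0)$ of (MSP). Moreover, let $\Omega=(\Theta_2\times\cdots\times\Theta_T)^\infty$ be the sample space of all possible sequences of scenarios, equipped with the product $\mathbb{P}$ of the corresponding probability measures. Define on $\Omega$ the random variable $x^*=(x_1^*,\dots,x_T^* )$ as follows: for $\omega\in\Omega$, consider the corresponding sequence of decisions $((x_n^k(\omega))_{n\in\mathcal{N}})_{k\ge1}$ computed by DASC, take any accumulation point $(x_n^*(\omega))_{n\in\mathcal{N}}$ of this sequence, and for $t=1,\dots,T$ let $x_t^*(\omega)$ be the $\mathcal{F}_t$-measurable policy given by $x_t^*(\omega)(\xi_1,\dots,\xi_t)=x_m^*(\omega)$, where $m$ is the node with $\xi_{[m]}=(\xi_1,\dots,\xi_t)$. Then $$\mathbb{P}\big((x_1^*,\dots,x_T^* )\text{ is an optimal solution to (MSP)}\big)=1 .$$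
   Context: Problem (MSP). Given $x_0\in\mathbb{R}^n$, deterministic $\xi_1$ and a stochastic process $(\xi_t)_{t=2}^T$, with $\mathcal{F}_t=\sigma(\xi_j,j\le t)$: $$\inf_{x_1,\dots,x_T}\ \mathbb{E}_{\xi_2,\dots,\xi_T}\Big[\sum_{t=1}^T f_t(x_t(\xi_1,\dots,\xi_t),x_{t-1}(\xi_1,\dots,\xi_{t-1}),\xi_t)\Big]$$ subject to $x_t(\xi_1,\dots,\xi_t)\in X_t(x_{t-1}(\xi_1,\dots,\xi_{t-1}),\xi_t)$ a.s., $x_t$ $\mathcal{F}_t$-measurable, $t=1,\dots,T$. For each $t$, $X_t(x_{t-1},\xi_t)$ is of one of two types (different stages may have different types): type S1: $\{x_t\in\mathcal{X}_t: x_t\ge0,\ A_tx_t+B_tx_{t-1}=b_t\}$; type S2: $\{x_t\in\mathcal{X}_t: g_t(x_t,x_{t-1},\xi_t)\le0,\ A_tx_t+B_tx_{t-1}=b_t\}$, with $g_t$ having $p$ components $g_{ti}$. Here $\mathcal{X}_t\subset\mathbb{R}^n$, and $\xi_t$ contains in particular the random elements of $A_t,B_t,b_t$; $A_{tj},B_{tj},b_{tj}$ are their values in realization $\xi_{tj}$. Dynamic programming: $\mathcal{Q}_{T+1}\equiv0$; for $t=1,\dots,T$, $\mathfrak{Q}_t(x_{t-1},\xi_t)=\inf\{F_t(x_t,x_{t-1},\xi_t):=f_t(x_t,x_{t-1},\xi_t)+\mathcal{Q}_{t+1}(x_t)\,:\,x_t\in X_t(x_{t-1},\xi_t)\}$;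 $\mathcal{Q}_t(x_{t-1})=\mathbb{E}_{\xi_t}[\mathfrak{Q}_t(x_{t-1},\xi_t)]$ for $t\ge2$, and $\mathcal{Q}_1(x_0)=\mathfrak{Q}_1(x_0,\xi_1)$. (H0) $(\xi_t)$ is interstage independent; for $t=2,\dots,T$, $\xi_t$ is a random vector in $\mathbb{R}^K$ with finite support $\Theta_t=\{\xi_{t1},\dots,\xi_{tM}\}$ and $p_{tj}=\mathbb{P}(\xi_t=\xi_{tj})>0$; $\xi_1$ is deterministic. (H1) With $\mathcal{X}_0=\{x_0\}$ and $\mathcal{X}^\varepsilon=\mathcal{X}+\{x:\|x\|_2\le\varepsilon\}$, for $t=1,\dots,T$ (for $t=1$ the only realization is $\xi_1$): (a) for every $j$, $f_t(\cdot,\cdot,\xi_{tj})$ is strongly convex on $\mathcal{X}_t\times\mathcal{X}_{t-1}$ with constant $\alpha_{tj}>0$ with respect to $\|\cdot\|_2$ (i.e. $F(sx+(1-s)y)\le sF(x)+(1-s)F(y)-\frac{\alpha s(1-s)}{2}\|y-x\|_2^2$, $0\le s\le1$, with $F=f_t(\cdot,\cdot,\xi_{tj})$, $\alpha=\alpha_{tj}$); (b) $\mathcal{X}_t$ is nonempty, convex and compact; (c) there is $\varepsilon_t>0$ such that for every $j$ and every $x_{t-1}\in\mathcal{X}_{t-1}^{\varepsilon_t}$ the set $X_t(x_{t-1},\xi_{tj})\cap\mathrm{ri}(\mathcal{X}_t)$ is nonempty. If $X_t$ is of type S2, additionally: (d) there is $\tilde\varepsilon_t>0$ such that for every $j$ each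 component $g_{ti}(\cdot,\cdot,\xi_{tj})$, $i=1,\dots,p$, is convex on $\mathcal{X}_t\times\mathcal{X}_{t-1}^{\tilde\varepsilon_t}$; (e) for $t\ge2$ and every $j$ there is $(\bar x_{tjt-1},\bar x_{tjt})\in\mathcal{X}_{t-1}\times\mathrm{ri}(\mathcal{X}_t)$ with $A_{tj}\bar x_{tjt}+B_{tj}\bar x_{tjt-1}=b_{tj}$ and $(\bar x_{tjt-1},\bar x_{tjt})\in\mathrm{ri}(\{g_t(\cdot,\cdot,\xi_{tj})\le0\})$. Scenario tree. The realizations of $(\xi_t)$ form a tree with root $n_0$ (stage 0, decision $x_0$) having a single child $n_1$ (stage 1, $\xi_1$). $\mathcal{N}$ is the set of nodes, $\mathtt{Nodes}(t)$ the nodes of stage $t$, $C(n)$ the children of $n$, $p_n$ the transition probability from the parent of $n$ to $n$, $\xi_n$ the realization at $n$ (containing $A_n,B_n,b_n$), $\xi_{[n]}$ the history of realizations from $n_1$ to $n$. DASC. Let $\alpha_t=\sum_{j=1}^M p_{tj}\alpha_{tj}$ for $t=2,\dots,T$. Step 1: $\mathcal{Q}_t^0\equiv-\infty$ for $t=2,\dots,T$, $\mathcal{Q}_{T+1}^0\equiv0$, $k=1$. Step 2 (forward pass): with $x_{n_0}^k=x_0$, for $t=1,\dots,T$, every node $n$ of stage $t-1$ and every $m\in C(n)$, compute an optimal solution $x_m^k$ of $$\underline{\mathfrak{Q}}_t^{k-1}(x_n^k,\xi_m)=\inf\{F_t^{k-1}(x_m,x_n^k,\xi_m):=f_t(x_m,x_n^k,\xi_m)+\mathcal{Q}_{t+1}^{k-1}(x_m)\,:\,x_m\in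 X_t(x_n^k,\xi_m)\}.$$ Step 3 (backward pass): select nodes $(n_1^k,\dots,n_T^k)$, $n_1^k=n_1$, $n_t^k$ a child of $n_{t-1}^k$ for $t\ge2$, corresponding to a sample $(\tilde\xi_1^k,\dots,\tilde\xi_T^k)$ of $(\xi_1,\dots,\xi_T)$. Set $\mathcal{C}_{T+1}^k\equiv0$ (so $\mathcal{Q}_{T+1}^k\equiv0$). For $t=T,\dots,2$, with $n=n_{t-1}^k$: for every $m\in C(n)$ compute an optimal solution $x_m^{Bk}$ of $$\underline{\mathfrak{Q}}_t^k(x_n^k,\xi_m)=\inf\{F_t^k(x_m,x_n^k,\xi_m):=f_t(x_m,x_n^k,\xi_m)+\mathcal{Q}_{t+1}^k(x_m)\,:\,x_m\in X_t(x_n^k,\xi_m)\},$$ and set $\theta_t^{km}=\underline{\mathfrak{Q}}_t^k(x_n^k,\xi_m)$. For type S1, let $\lambda_m^k$ be optimal Lagrange multipliers for the Lagrangian $F_t^k(x_m,x_n^k,\xi_m)+\lambda^T(A_mx_m+B_mx_n^k-b_m)$ and set $\beta^{km}=s+B_m^T\lambda_m^k$; for type S2, let $(\lambda_m^k,\mu_m^k)$ be optimal Lagrange multipliers for the Lagrangian $F_t^k(x_m,x_n^k,\xi_m)+\lambda^T(A_mx_m+B_mx_n^k-b_m)+\mu^Tg_t(x_m,x_n^k,\xi_m)$ and set $\beta^{km}=s+B_m^T\lambda_m^k+\sum_{i=1}^p\mu_m^k(i)s_i$; here $s$ is a subgradient of $f_t(x_m^{Bk},\cdot,\xi_m)$ at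 $x_n^k$ and $s_i$ a subgradient of $g_{ti}(x_m^{Bk},\cdot,\xi_m)$ at $x_n^k$. Put $\theta_t^k=\sum_{m\in C(n)}p_m\theta_t^{km}$, $\beta_t^k=\sum_{m\in C(n)}p_m\beta^{km}$, $$\mathcal{C}_t^k(x_{t-1})=\theta_t^k+\langle\beta_t^k,x_{t-1}-x_{n_{t-1}^k}^k\rangle+\frac{\alpha_t}{2}\|x_{t-1}-x_{n_{t-1}^k}^k\|_2^2,\qquad \mathcal{Q}_t^k(x_{t-1})=\max_{1\le\ell\le k}\mathcal{C}_t^\ell(x_{t-1}).$$ Step 4: $k\leftarrow k+1$, go to Step 2. The quantity $\underline{\mathfrak{Q}}_1^k(x_0,\xi_1)$ is defined by the same formula with $t=1$. (H2) The samples in the backward passes are independent: $(\tilde\xi_2^k,\dots,\tilde\xi_T^k)$ is a realization of $\xi^k=(\xi_2^k,\dots,\xi_T^k)\sim(\xi_2,\dots,\xi_T)$, and $\xi^1,\xi^2,\dots$ are independent.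
   Formalization: Proved with f_t (and g_t for S2) continuous on X_t times a neighbourhood of X_{t-1}, subgradients taken relative to that set, and s, s_i restricted to parts of joint subgradients certifying optimality of x_m^{Bk}; with arbitrary partial subgradients the claim fails for nonsmooth f_t. *)

theory Defs
  imports "HOL-Probability.Probability"
begin

section \<open>The multistage stochastic program\<close>

datatype stage_kind = S1 | S2

text \<open>
  The decision \<open>x\<^sub>t\<close> lives in \<open>real ^ 'n\<close> and \<open>\<xi>\<^sub>t\<close> in \<open>real ^ 'k\<close>. The data \<open>A\<^sub>t\<close>, \<open>B\<^sub>t\<close>, \<open>b\<^sub>t\<close> are
  functions of the realization of \<open>\<xi>\<^sub>t\<close>, as \<open>\<xi>\<^sub>t\<close> contains their random elements. Argument order is
  \<open>f t x\<^sub>t x\<^sub>t\<^sub>-\<^sub>1 \<xi>\<^sub>t\<close>, and likewise for \<open>g\<close>. The number of rows of the equality constraints is common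
  to all stages, which is no restriction since rows \<open>0 = 0\<close> may be added. The field \<open>sconst\<close> holds
  the strong convexity constants: \<open>sconst t z\<close> is \<open>\<alpha>\<^sub>t\<^sub>j\<close> for \<open>z = \<xi>\<^sub>t\<^sub>j\<close>.
\<close>

record ('w, 'n, 'k, 'q, 'p) msp =
  horizon :: nat
  init :: "real ^ 'n::finite"
  prb :: "'w measure"
  xi :: "nat \<Rightarrow> 'w \<Rightarrow> real ^ 'k::finite"
  xi1 :: "real ^ 'k"
  domain :: "nat \<Rightarrow> (real ^ 'n) set"
  kind :: "nat \<Rightarrow> stage_kind"
  cost :: "nat \<Rightarrow> real ^ 'n \<Rightarrow> real ^ 'n \<Rightarrow> real ^ 'k \<Rightarrow> real"
  constr :: "nat \<Rightarrow> real ^ 'n \<Rightarrow> real ^ 'n \<Rightarrow> real ^ 'k \<Rightarrow> real ^ 'p::finite"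
  matA :: "nat \<Rightarrow> real ^ 'k \<Rightarrow> real ^ 'n ^ 'q::finite"
  matB :: "nat \<Rightarrow> real ^ 'k \<Rightarrow> real ^ 'n ^ 'q"
  vecb :: "nat \<Rightarrow> real ^ 'k \<Rightarrow> real ^ 'q"
  sconst :: "nat \<Rightarrow> real ^ 'k \<Rightarrow> real"

definition decset :: "('w, 'n::finite, 'k::finite, 'q::finite, 'p::finite) msp \<Rightarrow> nat \<Rightarrow> (real ^ 'n) set"
  where "decset P t = (if t = 0 then {init P} else domain P t)"

definition resid ::
  "('w, 'n::finite, 'k::finite, 'q::finite, 'p::finite) msp \<Rightarrow> nat \<Rightarrow> real ^ 'n \<Rightarrow> real ^ 'n \<Rightarrow> real ^ 'k \<Rightarrow> real ^ 'q"
  where "resid P t x y z = matA P t z *v x + matB P t z *v y - vecb P t z"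

text \<open>The order on \<open>real ^ 'n\<close> is componentwise.\<close>

definition feas ::
  "('w, 'n::finite, 'k::finite, 'q::finite, 'p::finite) msp \<Rightarrow> nat \<Rightarrow> real ^ 'n \<Rightarrow> real ^ 'k \<Rightarrow> (real ^ 'n) set"
  where "feas P t y z =
    (case kind P t of
       S1 \<Rightarrow> {x \<in> decset P t. 0 \<le> x \<and> matA P t z *v x + matB P t z *v y = vecb P t z}
     | S2 \<Rightarrow> {x \<in> decset P t. constr P t x y z \<le> 0 \<and> matA P t z *v x + matB P t z *v y = vecb P t z})"

definition pr :: "('w, 'n::finite, 'k::finite, 'q::finite, 'p::finite) msp \<Rightarrow> nat \<Rightarrow> real ^ 'k \<Rightarrow> real"
  where "pr P t z = measure (prb P) {w \<in> space (prb P). xi P t w = z}"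

definition supp :: "('w, 'n::finite, 'k::finite, 'q::finite, 'p::finite) msp \<Rightarrow> nat \<Rightarrow> (real ^ 'k) set"
  where "supp P t = {z. pr P t z > 0}"

text \<open>
  Policies are random vectors on the underlying probability space, \<open>x t\<close> being measurable with
  respect to \<open>\<F>\<^sub>t = \<sigma>(\<xi>\<^sub>j, j \<le> t)\<close>; stage 0 of a policy is ignored and replaced by \<open>x\<^sub>0\<close>.
\<close>

definition filt :: "('w, 'n::finite, 'k::finite, 'q::finite, 'p::finite) msp \<Rightarrow> nat \<Rightarrow> 'w measure"
  where "filt P t =
    sigma (space (prb P)) {xi P j -` S \<inter> space (prb P) | j S. j \<in> {1..t} \<and> S \<in> sets borel}"

definition prev ::
  "('w, 'n::finite, 'k::finite, 'q::finite, 'p::finite) msp \<Rightarrow> (nat \<Rightarrow> 'w \<Rightarrow> real ^ 'n) \<Rightarrow> nat \<Rightarrow> 'w \<Rightarrow> real ^ 'n"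
  where "prev P x t w = (if t = 1 then init P else x (t - 1) w)"

definition feasible_policy ::
  "('w, 'n::finite, 'k::finite, 'q::finite, 'p::finite) msp \<Rightarrow> (nat \<Rightarrow> 'w \<Rightarrow> real ^ 'n) \<Rightarrow> bool"
  where "feasible_policy P x \<longleftrightarrow>
    (\<forall>t\<in>{1..horizon P}. x t \<in> borel_measurable (filt P t) \<and>
       (AE w in prb P. x t w \<in> feas P t (prev P x t w) (xi P t w)))"

definition objective ::
  "('w, 'n::finite, 'k::finite, 'q::finite, 'p::finite) msp \<Rightarrow> (nat \<Rightarrow> 'w \<Rightarrow> real ^ 'n) \<Rightarrow> real"
  where "objective P x =
    (\<integral>w. (\<Sum>t = 1..horizon P. cost P t (x t w) (prev P x t w) (xi P t w)) \<partial>prb P)"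

definition msp_value :: "('w, 'n::finite, 'k::finite, 'q::finite, 'p::finite) msp \<Rightarrow> ereal"
  where "msp_value P = (INF x \<in> {x. feasible_policy P x}. ereal (objective P x))"

definition optimal_policy ::
  "('w, 'n::finite, 'k::finite, 'q::finite, 'p::finite) msp \<Rightarrow> (nat \<Rightarrow> 'w \<Rightarrow> real ^ 'n) \<Rightarrow> bool"
  where "optimal_policy P x \<longleftrightarrow>
    feasible_policy P x \<and> (\<forall>y. feasible_policy P y \<longrightarrow> objective P x \<le> objective P y)"


section \<open>Dynamic programming\<close>

text \<open>
  The continuation function \<open>Q\<close> is either the exact recourse function of the next stage or one of
  its approximations; \<open>stage_obj\<close> is then \<open>F\<^sub>t\<close> or \<open>F\<^sub>t\<^sup>k\<close>, and \<open>stage_val\<close> the corresponding value.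
  Values are extended reals because the initial approximation is \<open>-\<infinity>\<close>.
\<close>

definition stage_obj ::
  "('w, 'n::finite, 'k::finite, 'q::finite, 'p::finite) msp \<Rightarrow> nat \<Rightarrow> (real ^ 'n \<Rightarrow> ereal) \<Rightarrow>
   real ^ 'n \<Rightarrow> real ^ 'n \<Rightarrow> real ^ 'k \<Rightarrow> ereal"
  where "stage_obj P t Q x y z = ereal (cost P t x y z) + Q x"

definition stage_val ::
  "('w, 'n::finite, 'k::finite, 'q::finite, 'p::finite) msp \<Rightarrow> nat \<Rightarrow> (real ^ 'n \<Rightarrow> ereal) \<Rightarrow>
   real ^ 'n \<Rightarrow> real ^ 'k \<Rightarrow> ereal"
  where "stage_val P t Q y z = (INF x \<in> feas P t y z. stage_obj P t Q x y z)"

definition stage_opt ::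
  "('w, 'n::finite, 'k::finite, 'q::finite, 'p::finite) msp \<Rightarrow> nat \<Rightarrow> (real ^ 'n \<Rightarrow> ereal) \<Rightarrow>
   real ^ 'n \<Rightarrow> real ^ 'k \<Rightarrow> real ^ 'n \<Rightarrow> bool"
  where "stage_opt P t Q y z x \<longleftrightarrow>
    x \<in> feas P t y z \<and> (\<forall>x'\<in>feas P t y z. stage_obj P t Q x y z \<le> stage_obj P t Q x' y z)"

text \<open>
  The functions \<open>\<Q>\<^sub>t\<close>. For \<open>t = 1\<close> the sum has the single term \<open>z = \<xi>\<^sub>1\<close>, of probability 1, hence
  gives the value of the first stage problem.
\<close>

function recourse ::
  "('w, 'n::finite, 'k::finite, 'q::finite, 'p::finite) msp \<Rightarrow> nat \<Rightarrow> real ^ 'n \<Rightarrow> ereal"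
  where "recourse P t y =
    (if t > horizon P then 0
     else (\<Sum>z\<in>supp P t. ereal (pr P t z) * stage_val P t (\<lambda>x. recourse P (Suc t) x) y z))"
  by pat_completeness auto
termination
  by (relation "Wellfounded.measure (\<lambda>(P, t, y). Suc (horizon P) - t)") auto

declare recourse.simps [simp del]


section \<open>Assumptions (H0) and (H1)\<close>

text \<open>
  Finite support is understood as: \<open>\<xi>\<^sub>t\<close> takes its values in the finite set of its atoms.
\<close>

definition H0 :: "('w, 'n::finite, 'k::finite, 'q::finite, 'p::finite) msp \<Rightarrow> bool"
  where "H0 P \<longleftrightarrow>
    prob_space (prb P) \<and>
    prob_space.indep_vars (prb P) (\<lambda>_. borel) (xi P) {1..horizon P} \<and>
    (\<forall>w\<in>space (prb P). xi P 1 w = xi1 P) \<and>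
    (\<exists>M. \<forall>t\<in>{2..horizon P}. finite (supp P t) \<and> card (supp P t) = M \<and>
       (\<forall>w\<in>space (prb P). xi P t w \<in> supp P t))"

definition strongly_convex_on :: "'a::real_normed_vector set \<Rightarrow> ('a \<Rightarrow> real) \<Rightarrow> real \<Rightarrow> bool"
  where "strongly_convex_on S F a \<longleftrightarrow>
    (\<forall>x\<in>S. \<forall>y\<in>S. \<forall>s\<in>{0..1}.
       F (s *\<^sub>R x + (1 - s) *\<^sub>R y) \<le> s * F x + (1 - s) * F y - a * s * (1 - s) / 2 * (norm (y - x))\<^sup>2)"

definition enlarge :: "'a::real_normed_vector set \<Rightarrow> real \<Rightarrow> 'a set"
  where "enlarge S e = {x + d | x d. x \<in> S \<and> norm d \<le> e}"

text \<open>
  For \<open>t = 1\<close>, \<open>supp P 1\<close> is \<open>{\<xi>\<^sub>1}\<close> under \<open>H0\<close>. Pairs are ordered as \<open>(x\<^sub>t, x\<^sub>t\<^sub>-\<^sub>1)\<close>; the norm of the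
  product type is the Euclidean one.
\<close>

definition H1 :: "('w, 'n::finite, 'k::finite, 'q::finite, 'p::finite) msp \<Rightarrow> bool"
  where "H1 P \<longleftrightarrow> (\<forall>t\<in>{1..horizon P}.
    (\<forall>z\<in>supp P t. sconst P t z > 0 \<and>
       strongly_convex_on (decset P t \<times> decset P (t - 1)) (\<lambda>(x, y). cost P t x y z) (sconst P t z)) \<and>
    decset P t \<noteq> {} \<and> convex (decset P t) \<and> compact (decset P t) \<and>
    (\<exists>e>0. \<forall>z\<in>supp P t. \<forall>y\<in>enlarge (decset P (t - 1)) e.
       feas P t y z \<inter> rel_interior (decset P t) \<noteq> {}) \<and>
    (kind P t = S2 \<longrightarrow>
       (\<exists>e>0. \<forall>z\<in>supp P t. \<forall>i.
          convex_on (decset P t \<times> enlarge (decset P (t - 1)) e) (\<lambda>(x, y). constr P t x y z $ i)) \<and>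
       (t \<ge> 2 \<longrightarrow> (\<forall>z\<in>supp P t.
          \<exists>y\<in>decset P (t - 1). \<exists>x\<in>rel_interior (decset P t).
            matA P t z *v x + matB P t z *v y = vecb P t z \<and>
            (x, y) \<in> rel_interior {(x, y). constr P t x y z \<le> 0}))))"

text \<open>
  Standing regularity of the data: \<open>f\<^sub>t\<close>, and \<open>g\<^sub>t\<close> for type S2, are continuous in the decisions, up to
  distance \<open>r\<close> from \<open>\<X>\<^sub>t\<^sub>-\<^sub>1\<close>. Convexity on a compact convex set alone does not give closed feasible
  sets or bounded cut slopes.
\<close>

definition continuous_data :: "('w, 'n::finite, 'k::finite, 'q::finite, 'p::finite) msp \<Rightarrow> real \<Rightarrow> bool"
  where "continuous_data P r \<longleftrightarrow> (\<forall>t\<in>{1..horizon P}. \<forall>z\<in>supp P t.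
    continuous_on (decset P t \<times> enlarge (decset P (t - 1)) r) (\<lambda>(x, y). cost P t x y z) \<and>
    (kind P t = S2 \<longrightarrow>
       continuous_on (decset P t \<times> enlarge (decset P (t - 1)) r) (\<lambda>(x, y). constr P t x y z)))"


section \<open>Scenario tree\<close>

text \<open>
  A node is identified with its history: the root \<open>n\<^sub>0\<close> is \<open>[]\<close>, its only child \<open>n\<^sub>1\<close> is \<open>[\<xi>\<^sub>1]\<close>, and
  a node \<open>n\<close> of stage \<open>t\<close> is the list \<open>\<xi>\<^bsub>[n]\<^esub>\<close> of length \<open>t\<close>. Thus the realization at \<open>n\<close> is \<open>last n\<close>.
\<close>

definition nodes ::
  "('w, 'n::finite, 'k::finite, 'q::finite, 'p::finite) msp \<Rightarrow> nat \<Rightarrow> (real ^ 'k) list set"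
  where "nodes P t = {n. length n = t \<and> (\<forall>i<t. n ! i \<in> supp P (Suc i))}"

definition children ::
  "('w, 'n::finite, 'k::finite, 'q::finite, 'p::finite) msp \<Rightarrow> (real ^ 'k) list \<Rightarrow> (real ^ 'k) list set"
  where "children P n = {n @ [z] | z. z \<in> supp P (Suc (length n))}"

definition node_pr ::
  "('w, 'n::finite, 'k::finite, 'q::finite, 'p::finite) msp \<Rightarrow> (real ^ 'k) list \<Rightarrow> real"
  where "node_pr P m = pr P (length m) (last m)"


section \<open>Samples of the backward passes (H2)\<close>

text \<open>
  \<open>scenario_law\<close> is the law of \<open>(\<xi>\<^sub>2, \<dots>, \<xi>\<^sub>T)\<close> on \<open>\<Theta>\<^sub>2 \<times> \<dots> \<times> \<Theta>\<^sub>T\<close>, and \<open>sample_space\<close> its infinite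
  product over the iterations \<open>k \<ge> 1\<close>: under it the samples \<open>\<omega> 1, \<omega> 2, \<dots>\<close> are independent copies of
  \<open>(\<xi>\<^sub>2, \<dots>, \<xi>\<^sub>T)\<close>.
\<close>

definition scenario_law ::
  "('w, 'n::finite, 'k::finite, 'q::finite, 'p::finite) msp \<Rightarrow> (nat \<Rightarrow> real ^ 'k) measure"
  where "scenario_law P =
    distr (prb P) (\<Pi>\<^sub>M t\<in>{2..horizon P}. count_space (supp P t)) (\<lambda>w. \<lambda>t\<in>{2..horizon P}. xi P t w)"

definition sample_space ::
  "('w, 'n::finite, 'k::finite, 'q::finite, 'p::finite) msp \<Rightarrow> (nat \<Rightarrow> nat \<Rightarrow> real ^ 'k) measure"
  where "sample_space P = (\<Pi>\<^sub>M k\<in>{1..}. scenario_law P)"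

text \<open>The node \<open>n\<^sub>t\<^sup>k\<close> of the backward pass.\<close>

definition sampled_node ::
  "('w, 'n::finite, 'k::finite, 'q::finite, 'p::finite) msp \<Rightarrow> (nat \<Rightarrow> nat \<Rightarrow> real ^ 'k) \<Rightarrow> nat \<Rightarrow> nat \<Rightarrow>
   (real ^ 'k) list"
  where "sampled_node P \<omega> k t = map (\<lambda>s. if s = 1 then xi1 P else \<omega> k s) [1..<Suc t]"


section \<open>DASC\<close>

text \<open>
  The quantities DASC chooses: forward decisions \<open>x\<^sub>n\<^sup>k\<close>, backward decisions \<open>x\<^sub>m\<^bsup>Bk\<^esup>\<close>, multipliers
  \<open>\<lambda>\<^sub>m\<^sup>k\<close>, \<open>\<mu>\<^sub>m\<^sup>k\<close> (the latter only for type S2) and slopes \<open>\<beta>\<^bsup>km\<^esup>\<close>.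
\<close>

record ('n, 'k, 'q, 'p) dasc_run =
  fwd :: "nat \<Rightarrow> (real ^ 'k::finite) list \<Rightarrow> real ^ 'n::finite"
  bwd :: "nat \<Rightarrow> (real ^ 'k) list \<Rightarrow> real ^ 'n"
  lam :: "nat \<Rightarrow> (real ^ 'k) list \<Rightarrow> real ^ 'q::finite"
  mu :: "nat \<Rightarrow> (real ^ 'k) list \<Rightarrow> real ^ 'p::finite"
  slope :: "nat \<Rightarrow> (real ^ 'k) list \<Rightarrow> real ^ 'n"

definition alpha :: "('w, 'n::finite, 'k::finite, 'q::finite, 'p::finite) msp \<Rightarrow> nat \<Rightarrow> real"
  where "alpha P t = (\<Sum>z\<in>supp P t. pr P t z * sconst P t z)"

text \<open>
  \<open>approx P \<omega> R k t\<close> is \<open>\<Q>\<^sub>t\<^sup>k\<close>, the maximum of the cuts \<open>\<C>\<^sub>t\<^sup>1, \<dots>, \<C>\<^sub>t\<^sup>k\<close>. For \<open>k = 0\<close> and \<open>t \<le> T\<close> it is the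
  supremum of the empty set of extended reals, that is \<open>-\<infinity>\<close>.
\<close>

definition cut ::
  "('w, 'n::finite, 'k::finite, 'q::finite, 'p::finite) msp \<Rightarrow> (nat \<Rightarrow> nat \<Rightarrow> real ^ 'k) \<Rightarrow>
   ('n, 'k, 'q, 'p) dasc_run \<Rightarrow> nat \<Rightarrow> nat \<Rightarrow> (real ^ 'n \<Rightarrow> ereal) \<Rightarrow> real ^ 'n \<Rightarrow> ereal"
  where "cut P \<omega> R k t Q y =
    (let n = sampled_node P \<omega> k (t - 1); xn = fwd R k n;
         \<theta> = (\<Sum>m\<in>children P n. ereal (node_pr P m) * stage_val P t Q xn (last m));
         \<beta> = (\<Sum>m\<in>children P n. node_pr P m *\<^sub>R slope R k m)
     in \<theta> + ereal (\<beta> \<bullet> (y - xn) + alpha P t / 2 * (norm (y - xn))\<^sup>2))"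

function approx ::
  "('w, 'n::finite, 'k::finite, 'q::finite, 'p::finite) msp \<Rightarrow> (nat \<Rightarrow> nat \<Rightarrow> real ^ 'k) \<Rightarrow>
   ('n, 'k, 'q, 'p) dasc_run \<Rightarrow> nat \<Rightarrow> nat \<Rightarrow> real ^ 'n \<Rightarrow> ereal"
  where "approx P \<omega> R k t y =
    (if t > horizon P then 0
     else (SUP l\<in>{1..k}. cut P \<omega> R l t (\<lambda>x. approx P \<omega> R l (Suc t) x) y))"
  by pat_completeness auto
termination
  by (relation "Wellfounded.measure (\<lambda>(P, \<omega>, R, k, t, y). Suc (horizon P) - t)") auto

declare approx.simps [simp del]

text \<open>
  Optimal Lagrange multipliers: the dual function, in which the constraints other than
  \<open>x \<in> \<X>\<^sub>t\<close> and, for type S1, \<open>x \<ge> 0\<close> are dualized, attains the primal optimal value.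
\<close>

definition opt_mult_S1 ::
  "('w, 'n::finite, 'k::finite, 'q::finite, 'p::finite) msp \<Rightarrow> nat \<Rightarrow> (real ^ 'n \<Rightarrow> ereal) \<Rightarrow>
   real ^ 'n \<Rightarrow> real ^ 'k \<Rightarrow> real ^ 'q \<Rightarrow> bool"
  where "opt_mult_S1 P t Q y z l \<longleftrightarrow>
    (INF x\<in>{x \<in> decset P t. 0 \<le> x}. stage_obj P t Q x y z + ereal (l \<bullet> resid P t x y z))
      = stage_val P t Q y z"

definition opt_mult_S2 ::
  "('w, 'n::finite, 'k::finite, 'q::finite, 'p::finite) msp \<Rightarrow> nat \<Rightarrow> (real ^ 'n \<Rightarrow> ereal) \<Rightarrow>
   real ^ 'n \<Rightarrow> real ^ 'k \<Rightarrow> real ^ 'q \<Rightarrow> real ^ 'p \<Rightarrow> bool"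
  where "opt_mult_S2 P t Q y z l u \<longleftrightarrow> 0 \<le> u \<and>
    (INF x\<in>decset P t. stage_obj P t Q x y z + ereal (l \<bullet> resid P t x y z + u \<bullet> constr P t x y z))
      = stage_val P t Q y z"

definition subgradient_on :: "'a::real_inner set \<Rightarrow> ('a \<Rightarrow> real) \<Rightarrow> 'a \<Rightarrow> 'a \<Rightarrow> bool"
  where "subgradient_on S F x v \<longleftrightarrow> (\<forall>y\<in>S. F x + v \<bullet> (y - x) \<le> F y)"

text \<open>
  Slopes \<open>\<beta> = s + B\<^sup>T\<lambda> (+ \<Sum>\<^sub>i \<mu>(i) s\<^sub>i)\<close>, where \<open>s\<close> and \<open>s\<^sub>i\<close> are subgradients of \<open>f\<^sub>t(x, \<cdot>, z)\<close> and
  \<open>g\<^sub>t\<^sub>i(x, \<cdot>, z)\<close> at \<open>y\<close>. For nonsmooth data an arbitrary choice of these partial subgradients does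
  not give a subgradient of the value function: for \<open>f(x, y) = 2\<bar>x - y\<bar> + x\<^sup>2 + y\<^sup>2\<close> without effective
  constraints the value is \<open>2y\<^sup>2\<close> near 0, while every \<open>s \<in> [-2, 2]\<close> is a partial subgradient at
  \<open>x = y = 0\<close>. They are therefore the second components of joint subgradients \<open>(d, s)\<close>, \<open>(d\<^sub>i, s\<^sub>i)\<close>
  whose first components certify, with the multipliers, the optimality of \<open>x\<close>: \<open>x\<close> minimizes the
  Lagrangian in which \<open>f\<^sub>t\<close> and \<open>g\<^sub>t\<^sub>i\<close> are linearized. For differentiable convex data this holds
  automatically, with \<open>s\<close>, \<open>s\<^sub>i\<close> the partial gradients.
\<close>

definition slope_S1 ::
  "('w, 'n::finite, 'k::finite, 'q::finite, 'p::finite) msp \<Rightarrow> real \<Rightarrow> nat \<Rightarrow> (real ^ 'n \<Rightarrow> ereal) \<Rightarrow>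
   real ^ 'n \<Rightarrow> real ^ 'k \<Rightarrow> real ^ 'n \<Rightarrow> real ^ 'q \<Rightarrow> real ^ 'n \<Rightarrow> bool"
  where "slope_S1 P r t Q y z x l \<beta> \<longleftrightarrow> (\<exists>d s.
    subgradient_on (decset P t \<times> enlarge (decset P (t - 1)) r) (\<lambda>(x, y). cost P t x y z) (x, y) (d, s) \<and>
    (\<forall>x'\<in>{x \<in> decset P t. 0 \<le> x}.
       Q x \<le> ereal ((d + transpose (matA P t z) *v l) \<bullet> (x' - x)) + Q x') \<and>
    \<beta> = s + transpose (matB P t z) *v l)"

definition slope_S2 ::
  "('w, 'n::finite, 'k::finite, 'q::finite, 'p::finite) msp \<Rightarrow> real \<Rightarrow> nat \<Rightarrow> (real ^ 'n \<Rightarrow> ereal) \<Rightarrow>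
   real ^ 'n \<Rightarrow> real ^ 'k \<Rightarrow> real ^ 'n \<Rightarrow> real ^ 'q \<Rightarrow> real ^ 'p \<Rightarrow> real ^ 'n \<Rightarrow> bool"
  where "slope_S2 P r t Q y z x l u \<beta> \<longleftrightarrow> (\<exists>d s d' s'.
    subgradient_on (decset P t \<times> enlarge (decset P (t - 1)) r) (\<lambda>(x, y). cost P t x y z) (x, y) (d, s) \<and>
    (\<forall>i. subgradient_on (decset P t \<times> enlarge (decset P (t - 1)) r)
           (\<lambda>(x, y). constr P t x y z $ i) (x, y) (d' i, s' i)) \<and>
    (\<forall>x'\<in>decset P t.
       Q x \<le> ereal ((d + transpose (matA P t z) *v l + (\<Sum>i\<in>UNIV. u $ i *\<^sub>R d' i)) \<bullet> (x' - x)) + Q x') \<and>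
    \<beta> = s + transpose (matB P t z) *v l + (\<Sum>i\<in>UNIV. u $ i *\<^sub>R s' i))"

text \<open>\<open>R\<close> is an execution of DASC with backward samples \<open>\<omega>\<close>: forward passes, then backward passes.\<close>

definition dasc ::
  "('w, 'n::finite, 'k::finite, 'q::finite, 'p::finite) msp \<Rightarrow> real \<Rightarrow> (nat \<Rightarrow> nat \<Rightarrow> real ^ 'k) \<Rightarrow>
   ('n, 'k, 'q, 'p) dasc_run \<Rightarrow> bool"
  where "dasc P r \<omega> R \<longleftrightarrow> (\<forall>k\<ge>1.
    fwd R k [] = init P \<and>
    (\<forall>t\<in>{1..horizon P}. \<forall>n\<in>nodes P (t - 1). \<forall>m\<in>children P n.
       stage_opt P t (approx P \<omega> R (k - 1) (Suc t)) (fwd R k n) (last m) (fwd R k m)) \<and>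
    (\<forall>t\<in>{2..horizon P}. \<forall>m\<in>children P (sampled_node P \<omega> k (t - 1)).
       let xn = fwd R k (sampled_node P \<omega> k (t - 1)); Q = approx P \<omega> R k (Suc t); z = last m in
         stage_opt P t Q xn z (bwd R k m) \<and>
         (case kind P t of
            S1 \<Rightarrow> opt_mult_S1 P t Q xn z (lam R k m) \<and>
                  slope_S1 P r t Q xn z (bwd R k m) (lam R k m) (slope R k m)
          | S2 \<Rightarrow> opt_mult_S2 P t Q xn z (lam R k m) (mu R k m) \<and>
                  slope_S2 P r t Q xn z (bwd R k m) (lam R k m) (mu R k m) (slope R k m))))"

text \<open>
  Accumulation points of \<open>((x\<^sub>n\<^sup>k)\<^sub>n)\<^sub>k\<close> over the finite tree, as limits of subsequences common to all nodes,
  and the policy attached to a family of decisions indexed by the nodes.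
\<close>

definition accumulation_point ::
  "('w, 'n::finite, 'k::finite, 'q::finite, 'p::finite) msp \<Rightarrow> ('n, 'k, 'q, 'p) dasc_run \<Rightarrow>
   ((real ^ 'k) list \<Rightarrow> real ^ 'n) \<Rightarrow> bool"
  where "accumulation_point P R xs \<longleftrightarrow>
    (\<exists>\<sigma>::nat \<Rightarrow> nat. strict_mono \<sigma> \<and>
       (\<forall>t\<le>horizon P. \<forall>n\<in>nodes P t. (\<lambda>j. fwd R (\<sigma> j) n) \<longlonglongrightarrow> xs n))"

definition tree_policy ::
  "('w, 'n::finite, 'k::finite, 'q::finite, 'p::finite) msp \<Rightarrow> ((real ^ 'k) list \<Rightarrow> real ^ 'n) \<Rightarrow>
   nat \<Rightarrow> 'w \<Rightarrow> real ^ 'n"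
  where "tree_policy P xs t w = xs (map (\<lambda>s. xi P s w) [1..<Suc t])"

end

theory Submission
  imports Defs
begin

text \<open>
  In any execution whose samples lie in the supports, the approximations \<open>\<Q>\<^sub>t\<^sup>k\<close> increase with \<open>k\<close> and stay below \<open>\<Q>\<^sub>t\<close>
  (\<open>qk_le_rec\<close>): a subgradient of a strongly convex cost gives a quadratic lower bound, and the
  optimality certificates behind the slopes turn it into a quadratic lower bound for the value of
  the stage problem. The affine parts of the cuts are valid beyond \<open>\<X>\<^sub>t\<^sub>-\<^sub>1\<close>, on a neighbourhood of
  fixed radius, because relatively complete recourse holds there; so their slopes are bounded and
  the \<open>\<Q>\<^sub>t\<^sup>k\<close> are equi-Lipschitz (\<open>qk_lipschitz\<close>). They converge to some convex \<open>\<Q>\<^sub>t\<^sup>\<infinity> \<le> \<Q>\<^sub>t\<close>, also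
  along converging arguments.

  The limit of the forward problems, with \<open>\<Q>\<^sup>\<infinity>\<close> as continuation, has a strongly convex objective and
  hence a unique solution. Starting from the root, where the decision is \<open>x\<^sub>0\<close>, the
  decisions \<open>x\<^sub>n\<^sup>k\<close> therefore converge for every node \<open>n\<close> of the tree, to some \<open>x\<^sub>n\<^sup>\<infinity>\<close>
  (\<open>fwd_tendsto\<close>). This is what makes the argument robust: the usual proof compares iterations in
  which \<open>n\<close> is sampled with the other ones by means of the independence of the samples from the
  past, whereas the choices of an execution are here arbitrary functions of the whole sequence of
  samples. As the decisions converge, it suffices that \<open>n\<close> is sampled infinitely often, which holds
  almost surely for all nodes at once (\<open>AE_samples\<close>).

  In an iteration that samples \<open>n\<close>, at stage \<open>t - 1\<close>, the new cut is exact at \<open>x\<^sub>n\<^sup>k\<close>: its value there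
  is the expected value of the stage problems with continuation \<open>\<Q>\<^sub>t\<^sub>+\<^sub>1\<^sup>k\<close>. Passing to the limit along
  these iterations and going backwards in \<open>t\<close> gives \<open>\<Q>\<^sub>t\<^sup>\<infinity>(x\<^sub>n\<^sup>\<infinity>) = \<Q>\<^sub>t(x\<^sub>n\<^sup>\<infinity>)\<close> for all nodes
  (\<open>qlim_exact\<close>). With the continuity of \<open>\<Q>\<^sub>t\<close>, the gaps
  \<open>\<Q>\<^sub>t(x\<^sub>n\<^sup>k) - \<Q>\<^sub>t\<^sup>k(x\<^sub>n\<^sup>k)\<close> tend to \<open>0\<close>. Moreover \<open>x\<^sub>n\<^sup>\<infinity>\<close> minimizes the limit problem, whose
  objective is below the exact one and agrees with it at \<open>x\<^sub>n\<^sup>\<infinity>\<close>; so \<open>x\<^sup>\<infinity>\<close> solves the exact dynamic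
  programming problems (\<open>xlim_stage_opt\<close>), which gives the limit of the first stage values. It is
  the only accumulation point. A policy is a function on the tree, since \<open>\<F>\<^sub>t\<close>-measurable functions
  are constant on the atoms of \<open>\<F>\<^sub>t\<close> and these have positive probability
  (\<open>feasible_policy_represented\<close>); the verification argument of dynamic programming then shows that
  \<open>\<Q>\<^sub>1(x\<^sub>0)\<close> is the value of the program and that \<open>x\<^sup>\<infinity>\<close> is an optimal policy.
\<close>

section \<open>Convex analysis and parametric minimization\<close>

text \<open>
  Strong convexity improves every subgradient inequality by a quadratic term: apply the inequality at
  \<open>p + s (q - p)\<close>, divide by \<open>s\<close> and let \<open>s\<close> tend to \<open>0\<close>. The larger set \<open>S'\<close> is the one on which
  subgradients are taken, while strong convexity is known on \<open>S\<close>.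
\<close>

lemma subgradient_quadratic_bound:
  fixes F :: "'a::real_inner \<Rightarrow> real"
  assumes sc: "strongly_convex_on S F a" and sub: "subgradient_on S' F p v"
    and S: "S \<subseteq> S'" "convex S" and pq: "p \<in> S" "q \<in> S"
  shows "F p + v \<bullet> (q - p) + a / 2 * (norm (q - p))\<^sup>2 \<le> F q"
proof -
  define N where "N = (norm (q - p))\<^sup>2"
  have bound: "F p + v \<bullet> (q - p) + a / 2 * (1 - s) * N \<le> F q" if s: "0 < s" "s < 1" for s
  proof -
    have mem: "s *\<^sub>R q + (1 - s) *\<^sub>R p \<in> S"
      using S(2) pq s by (auto simp: convex_alt algebra_simps)
    have "s *\<^sub>R q + (1 - s) *\<^sub>R p - p = s *\<^sub>R (q - p)"
      by (simp add: algebra_simps)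
    then have "F p + s * (v \<bullet> (q - p)) \<le> F (s *\<^sub>R q + (1 - s) *\<^sub>R p)"
      using sub mem S(1) unfolding subgradient_on_def by (metis inner_scaleR_right subsetD)
    also have "\<dots> \<le> s * F q + (1 - s) * F p - a * s * (1 - s) / 2 * N"
      using sc pq s unfolding strongly_convex_on_def N_def
      by (metis atLeastAtMost_iff less_eq_real_def norm_minus_commute)
    finally have "s * (F p + v \<bullet> (q - p) + a / 2 * (1 - s) * N) \<le> s * F q"
      by (simp add: algebra_simps)
    then show ?thesis using s by simp
  qed
  have "((\<lambda>s. F p + v \<bullet> (q - p) + a / 2 * (1 - s) * N) \<longlongrightarrow> F p + v \<bullet> (q - p) + a / 2 * (1 - 0) * N)
      (at_right 0)"
    by (intro tendsto_intros)
  moreover have "eventually (\<lambda>s. F p + v \<bullet> (q - p) + a / 2 * (1 - s) * N \<le> F q) (at_right (0::real))"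
    by (rule eventually_at_rightI[of 0 1]) (use bound in auto)
  ultimately have "F p + v \<bullet> (q - p) + a / 2 * (1 - 0) * N \<le> F q"
    by (rule tendsto_upperbound) auto
  then show ?thesis by (simp add: N_def)
qed

lemma compact_tendsto_if_unique_cluster_point:
  fixes u :: "nat \<Rightarrow> 'a::metric_space"
  assumes S: "compact S" and u: "\<And>k. u k \<in> S"
    and cl: "\<And>\<sigma> l. strict_mono \<sigma> \<Longrightarrow> (\<lambda>j. u (\<sigma> j)) \<longlonglongrightarrow> l \<Longrightarrow> l = a"
  shows "u \<longlonglongrightarrow> a"
proof (rule ccontr)
  assume "\<not> u \<longlonglongrightarrow> a"
  then obtain e where e: "e > 0" and inf: "\<forall>N. \<exists>k\<ge>N. dist (u k) a \<ge> e"
    by (meson lim_sequentially not_le)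
  then have "infinite {k. dist (u k) a \<ge> e}"
    by (simp add: infinite_nat_iff_unbounded_le)
  from infinite_enumerate[OF this]
  obtain \<sigma> :: "nat \<Rightarrow> nat" where \<sigma>: "strict_mono \<sigma>" "\<And>j. dist (u (\<sigma> j)) a \<ge> e"
    by blast
  obtain l \<rho> where \<rho>: "strict_mono \<rho>" "(\<lambda>j. u (\<sigma> (\<rho> j))) \<longlonglongrightarrow> l"
    using S[unfolded compact_def o_def, rule_format, of "\<lambda>j. u (\<sigma> j)"] u by blast
  have "l = a"
    using cl[of "\<lambda>j. \<sigma> (\<rho> j)"] \<rho> \<sigma>(1) by (simp add: strict_mono_def)
  then have "eventually (\<lambda>j. dist (u (\<sigma> (\<rho> j))) a < e) sequentially"
    using \<rho>(2) e by (simp add: tendsto_iff)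
  then show False
    using \<sigma>(2) by (auto simp: eventually_sequentially not_less[symmetric])
qed

text \<open>
  Stability of minimizers: the feasible sets \<open>\<Phi> k\<close> converge to \<open>\<Phi>'\<close> in the sense that limits of
  feasible points are feasible and feasible points are limits, and the objectives converge along
  converging arguments. Then every cluster point of the minimizers minimizes the limit problem, and
  uniqueness makes the whole sequence converge. Subsequences have to be allowed in the hypotheses
  because cluster points are reached along subsequences.
\<close>

lemma argmin_tendsto:
  fixes u :: "nat \<Rightarrow> 'a::metric_space" and F :: "nat \<Rightarrow> 'a \<Rightarrow> real"
  assumes X: "compact X" "\<And>k. \<Phi> k \<subseteq> X"
    and u: "\<And>k. u k \<in> \<Phi> k" "\<And>k x. x \<in> \<Phi> k \<Longrightarrow> F k (u k) \<le> F k x"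
    and closed: "\<And>\<sigma> w l. strict_mono \<sigma> \<Longrightarrow> (\<And>j. w j \<in> \<Phi> (\<sigma> j)) \<Longrightarrow> w \<longlonglongrightarrow> l \<Longrightarrow> l \<in> \<Phi>'"
    and lsc: "\<And>x. x \<in> \<Phi>' \<Longrightarrow> \<exists>w. (\<forall>k. w k \<in> \<Phi> k) \<and> w \<longlonglongrightarrow> x"
    and conv: "\<And>\<sigma> w l. strict_mono \<sigma> \<Longrightarrow> (\<And>j. w j \<in> X) \<Longrightarrow> w \<longlonglongrightarrow> l \<Longrightarrow> l \<in> X \<Longrightarrow>
        (\<lambda>j. F (\<sigma> j) (w j)) \<longlonglongrightarrow> F' l"
    and uniq: "\<And>x x'. x \<in> \<Phi>' \<Longrightarrow> x' \<in> \<Phi>' \<Longrightarrow> (\<And>z. z \<in> \<Phi>' \<Longrightarrow> F' x \<le> F' z) \<Longrightarrow>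
        (\<And>z. z \<in> \<Phi>' \<Longrightarrow> F' x' \<le> F' z) \<Longrightarrow> x = x'"
  obtains a where "u \<longlonglongrightarrow> a" "a \<in> \<Phi>'" "\<And>x. x \<in> \<Phi>' \<Longrightarrow> F' a \<le> F' x"
proof -
  have uX: "u k \<in> X" for k using u(1) X(2) by blast
  have cluster: "l \<in> \<Phi>' \<and> (\<forall>x\<in>\<Phi>'. F' l \<le> F' x)"
    if \<sigma>: "strict_mono \<sigma>" and l: "(\<lambda>j. u (\<sigma> j)) \<longlonglongrightarrow> l" for \<sigma> l
  proof (intro conjI ballI)
    show "l \<in> \<Phi>'" by (rule closed[OF \<sigma> u(1) l])
    have XI: "b \<in> X" if "w \<longlonglongrightarrow> b" "\<And>j. w j \<in> X" for w b
      using closed_sequentially[OF compact_imp_closed[OF X(1)]] that by blast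
    fix x assume x: "x \<in> \<Phi>'"
    then obtain w where w: "\<And>k. w k \<in> \<Phi> k" "w \<longlonglongrightarrow> x" using lsc by blast
    have wX: "w (\<sigma> j) \<in> X" for j using w(1) X(2) by blast
    have w': "(\<lambda>j. w (\<sigma> j)) \<longlonglongrightarrow> x"
      using LIMSEQ_subseq_LIMSEQ[OF w(2) \<sigma>] by (simp add: o_def)
    show "F' l \<le> F' x"
    proof (rule LIMSEQ_le)
      show "(\<lambda>j. F (\<sigma> j) (u (\<sigma> j))) \<longlonglongrightarrow> F' l"
        by (rule conv[OF \<sigma> uX l XI[OF l uX]])
      show "(\<lambda>j. F (\<sigma> j) (w (\<sigma> j))) \<longlonglongrightarrow> F' x"
        by (rule conv[OF \<sigma> wX w' XI[OF w' wX]])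
      show "\<exists>N. \<forall>j\<ge>N. F (\<sigma> j) (u (\<sigma> j)) \<le> F (\<sigma> j) (w (\<sigma> j))"
        using u(2) w(1) by blast
    qed
  qed
  obtain a \<rho> where \<rho>: "strict_mono \<rho>" "(\<lambda>j. u (\<rho> j)) \<longlonglongrightarrow> a"
    using X(1)[unfolded compact_def o_def, rule_format, of u] uX by blast
  note a = cluster[OF \<rho>]
  have "u \<longlonglongrightarrow> a"
  proof (rule compact_tendsto_if_unique_cluster_point[OF X(1) uX])
    fix \<sigma> l assume "strict_mono \<sigma>" "(\<lambda>j. u (\<sigma> j)) \<longlonglongrightarrow> l"
    from cluster[OF this] show "l = a"
      using a by (intro uniq) blast+
  qed
  then show ?thesis using a that by blast
qed

text \<open>
  The midpoint of two distinct minimizers would be strictly better than both.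
\<close>

lemma minimizer_unique_if_strongly_convex:
  fixes F :: "'a::real_normed_vector \<Rightarrow> real"
  assumes "strongly_convex_on S F a" "a > 0" "convex_on S q" "convex C" "C \<subseteq> S"
    and x: "x \<in> C" "\<And>w. w \<in> C \<Longrightarrow> F x + q x \<le> F w + q w"
    and y: "y \<in> C" "\<And>w. w \<in> C \<Longrightarrow> F y + q y \<le> F w + q w"
  shows "x = y"
proof (rule ccontr)
  assume "x \<noteq> y"
  let ?m = "(1/2) *\<^sub>R x + (1 - 1/2) *\<^sub>R y"
  have m: "?m \<in> C" using assms(4) x(1) y(1) by (intro convexD) auto
  have "F ?m \<le> (1/2) * F x + (1 - 1/2) * F y - a * (1/2) * (1 - 1/2) / 2 * (norm (y - x))\<^sup>2"
    using assms(1,5) x(1) y(1) unfolding strongly_convex_on_def by (meson atLeastAtMost_iff subsetD zero_le_divide_1_iff zero_le_numeral half_bounded_equal divide_le_eq_1_pos zero_less_numeral one_le_numeral)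
  moreover have "q ?m \<le> (1/2) * q x + (1 - 1/2) * q y"
    using convex_onD[OF assms(3), of "1 / 2" y x] assms(5) x(1) y(1) by (auto simp: add.commute)
  moreover have "a * (1/2) * (1 - 1/2) / 2 * (norm (y - x))\<^sup>2 > 0"
    using \<open>x \<noteq> y\<close> assms(2) by simp
  moreover have "F x + q x = F y + q y"
    using x y by (simp add: order_antisym)
  ultimately show False using x(2)[OF m] by simp
qed

section \<open>Feasible sets and recourse functions\<close>

lemma enlarge_mono: "a \<le> b \<Longrightarrow> enlarge S a \<subseteq> enlarge S b"
  unfolding enlarge_def using order_trans by blast

lemma in_enlarge:
  assumes "x \<in> S" "norm (y - x) \<le> a" shows "y \<in> enlarge S a"
  unfolding enlarge_def mem_Collect_eq using assms by (intro exI[of _ x] exI[of _ "y - x"]) simp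

lemma subset_enlarge: "0 \<le> a \<Longrightarrow> S \<subseteq> enlarge S a"
  by (auto intro: in_enlarge)

lemma compact_enlarge:
  fixes S :: "'a::euclidean_space set"
  assumes "compact S" shows "compact (enlarge S a)"
proof -
  have "enlarge S a = {x + y | x y. x \<in> S \<and> y \<in> cball 0 a}"
    by (auto simp: enlarge_def)
  then show ?thesis using compact_sums[OF assms compact_cball[of 0 a]] by simp
qed

lemma stage_val_eq:
  assumes "stage_opt P t Q y z x"
  shows "stage_val P t Q y z = stage_obj P t Q x y z"
  unfolding stage_val_def
  using assms by (intro antisym INF_lower INF_greatest) (auto simp: stage_opt_def)

lemma stage_val_le: "x \<in> feas P t y z \<Longrightarrow> stage_val P t Q y z \<le> stage_obj P t Q x y z"
  unfolding stage_val_def by (rule INF_lower)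

lemma feas_subset: "feas P t y z \<subseteq> decset P t"
  by (auto simp: feas_def split: stage_kind.splits)

lemma feas_in_decset: "x \<in> feas P t y z \<Longrightarrow> x \<in> decset P t"
  using feas_subset by blast

lemma stage_opt_in_decset: "stage_opt P t Q y z x \<Longrightarrow> x \<in> decset P t"
  unfolding stage_opt_def using feas_in_decset by blast

lemma feas_eq_constraint:
  "x \<in> feas P t y z \<Longrightarrow> matA P t z *v x + matB P t z *v y = vecb P t z"
  by (auto simp: feas_def split: stage_kind.splits)

locale regular_msp =
  fixes P :: "('w, 'n::finite, 'k::finite, 'q::finite, 'p::finite) msp" and r :: real
  assumes horizon_pos: "horizon P \<ge> 1" and H0: "H0 P" and H1: "H1 P"
    and r_pos: "r > 0" and continuous_data: "continuous_data P r"
begin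

sublocale prob_space "prb P"
  using H0 by (simp add: H0_def)

lemma rv_xi: "t \<in> {1..horizon P} \<Longrightarrow> random_variable borel (xi P t)"
  using H0 by (auto simp: H0_def indep_vars_def2)

lemma xi_1: "w \<in> space (prb P) \<Longrightarrow> xi P 1 w = xi1 P"
  using H0 by (simp add: H0_def)

lemma pr_1: "pr P 1 z = (if z = xi1 P then 1 else 0)"
proof -
  have "{w \<in> space (prb P). xi P 1 w = z} = (if z = xi1 P then space (prb P) else {})"
    using xi_1 by auto
  then show ?thesis by (simp add: pr_def prob_space)
qed

lemma supp_1: "supp P 1 = {xi1 P}"
  using pr_1 by (auto simp: supp_def split: if_splits)

lemma finite_supp: "t \<in> {1..horizon P} \<Longrightarrow> finite (supp P t)"
  using H0 supp_1 by (cases "t = 1") (auto simp: H0_def)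

lemma xi_in_supp: "t \<in> {1..horizon P} \<Longrightarrow> w \<in> space (prb P) \<Longrightarrow> xi P t w \<in> supp P t"
  using H0 supp_1 xi_1 by (cases "t = 1") (auto simp: H0_def)

lemma pr_pos: "z \<in> supp P t \<Longrightarrow> pr P t z > 0"
  by (simp add: supp_def)

lemma decset_props:
  assumes "t \<in> {0..horizon P}"
  shows "convex (decset P t)" "compact (decset P t)" "decset P t \<noteq> {}"
  using assms H1 by (cases "t = 0"; auto simp: H1_def decset_def[of P 0])+

lemma strongly_convex_cost:
  assumes "t \<in> {1..horizon P}" "z \<in> supp P t"
  shows "sconst P t z > 0"
    "strongly_convex_on (decset P t \<times> decset P (t - 1)) (\<lambda>(x, y). cost P t x y z) (sconst P t z)"
  using assms H1 by (auto simp: H1_def)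

text \<open>
  One radius serves for complete recourse, for convexity of the constraints and for continuity of
  the data.
\<close>

lemma recourse_radius:
  assumes t: "t \<in> {1..horizon P}"
  obtains e where "0 < e" "e \<le> r"
    "\<And>z y. z \<in> supp P t \<Longrightarrow> y \<in> enlarge (decset P (t - 1)) e \<Longrightarrow> feas P t y z \<noteq> {}"
    "\<And>z y y' x x' a b. z \<in> supp P t \<Longrightarrow> y \<in> enlarge (decset P (t - 1)) e \<Longrightarrow>
       y' \<in> enlarge (decset P (t - 1)) e \<Longrightarrow> x \<in> feas P t y z \<Longrightarrow> x' \<in> feas P t y' z \<Longrightarrow>
       0 \<le> a \<Longrightarrow> 0 \<le> b \<Longrightarrow> a + b = 1 \<Longrightarrow>
       a *\<^sub>R x + b *\<^sub>R x' \<in> feas P t (a *\<^sub>R y + b *\<^sub>R y') z"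
proof -
  obtain e1 where e1: "e1 > 0"
    "\<And>z y. z \<in> supp P t \<Longrightarrow> y \<in> enlarge (decset P (t - 1)) e1 \<Longrightarrow>
       feas P t y z \<inter> rel_interior (decset P t) \<noteq> {}"
    using H1 t unfolding H1_def by metis
  obtain e2 where e2: "e2 > 0" "\<And>z i. kind P t = S2 \<Longrightarrow> z \<in> supp P t \<Longrightarrow>
      convex_on (decset P t \<times> enlarge (decset P (t - 1)) e2) (\<lambda>(x, y). constr P t x y z $ i)"
  proof (cases "kind P t = S2")
    case True
    then have "\<exists>e>0. \<forall>z\<in>supp P t. \<forall>i.
        convex_on (decset P t \<times> enlarge (decset P (t - 1)) e) (\<lambda>(x, y). constr P t x y z $ i)"
      using H1 t unfolding H1_def by blast
    then show ?thesis using that by blast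
  qed (use that[of 1] in auto)
  define e where "e = min r (min e1 e2)"
  have e: "0 < e" "e \<le> r" "e \<le> e1" "e \<le> e2"
    using e1(1) e2(1) r_pos by (auto simp: e_def)
  have X: "convex (decset P t)" using t decset_props(1) by simp
  show ?thesis
  proof (rule that[OF e(1,2)])
    show "feas P t y z \<noteq> {}" if "z \<in> supp P t" "y \<in> enlarge (decset P (t - 1)) e" for z y
      using e1(2)[OF that(1)] that(2) enlarge_mono[OF e(3)] by blast
    fix z y y' x x' and a b :: real
    assume z: "z \<in> supp P t"
      and y: "y \<in> enlarge (decset P (t - 1)) e" "y' \<in> enlarge (decset P (t - 1)) e"
      and x: "x \<in> feas P t y z" "x' \<in> feas P t y' z"
      and ab: "0 \<le> a" "0 \<le> b" "a + b = 1"
    have mem: "a *\<^sub>R x + b *\<^sub>R x' \<in> decset P t"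
      using X x feas_subset ab by (intro convexD) blast+
    have "matA P t z *v (a *\<^sub>R x + b *\<^sub>R x') + matB P t z *v (a *\<^sub>R y + b *\<^sub>R y')
       = a *\<^sub>R (matA P t z *v x + matB P t z *v y) + b *\<^sub>R (matA P t z *v x' + matB P t z *v y')"
      by (simp add: matrix_vector_right_distrib matrix_vector_mult_scaleR scaleR_add_right)
    also have "\<dots> = vecb P t z"
      using x[THEN feas_eq_constraint] ab(3) by (simp flip: scaleR_add_left)
    finally have lin: "matA P t z *v (a *\<^sub>R x + b *\<^sub>R x') + matB P t z *v (a *\<^sub>R y + b *\<^sub>R y') = vecb P t z" .
    show "a *\<^sub>R x + b *\<^sub>R x' \<in> feas P t (a *\<^sub>R y + b *\<^sub>R y') z"
    proof (cases "kind P t")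
      case S1
      have "0 \<le> x" "0 \<le> x'" using x S1 by (auto simp: feas_def)
      then have "0 \<le> a *\<^sub>R x + b *\<^sub>R x'" using ab by (simp add: less_eq_vec_def)
      then show ?thesis using S1 mem lin by (simp add: feas_def)
    next
      case S2
      have "constr P t (a *\<^sub>R x + b *\<^sub>R x') (a *\<^sub>R y + b *\<^sub>R y') z $ i \<le> 0" for i
      proof -
        have "(\<lambda>(x, y). constr P t x y z $ i) (a *\<^sub>R (x, y) + b *\<^sub>R (x', y'))
            \<le> a * (\<lambda>(x, y). constr P t x y z $ i) (x, y) + b * (\<lambda>(x, y). constr P t x y z $ i) (x', y')"
          using e2(2)[OF S2 z, of i] y enlarge_mono[OF e(4)] x feas_subset ab
          unfolding convex_on_def by blast
        moreover have "constr P t x y z $ i \<le> 0" "constr P t x' y' z $ i \<le> 0"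
          using x S2 by (auto simp: feas_def less_eq_vec_def)
        ultimately show ?thesis
          using ab by (simp add: mult_nonneg_nonpos add_nonpos_nonpos order_trans)
      qed
      then show ?thesis using S2 mem lin by (simp add: feas_def less_eq_vec_def)
    qed
  qed
qed

lemma feas_nonempty:
  assumes "t \<in> {1..horizon P}" "z \<in> supp P t" "y \<in> decset P (t - 1)"
  shows "feas P t y z \<noteq> {}"
proof -
  obtain e where e: "0 < e"
    "\<And>z y. z \<in> supp P t \<Longrightarrow> y \<in> enlarge (decset P (t - 1)) e \<Longrightarrow> feas P t y z \<noteq> {}"
    by (rule recourse_radius[OF assms(1)]) (rule that; assumption)
  show ?thesis by (rule e(2)[OF assms(2) in_enlarge[OF assms(3)]]) (use e(1) in simp)
qed

lemma convex_feas:
  assumes t: "t \<in> {1..horizon P}" "z \<in> supp P t" "y \<in> decset P (t - 1)"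
  shows "convex (feas P t y z)"
proof (rule convexI)
  fix x x' and a b :: real
  assume x: "x \<in> feas P t y z" "x' \<in> feas P t y z" and ab: "0 \<le> a" "0 \<le> b" "a + b = 1"
  obtain e where e: "0 < e" and
    comb: "\<And>z y y' x x' a b. z \<in> supp P t \<Longrightarrow> y \<in> enlarge (decset P (t - 1)) e \<Longrightarrow>
       y' \<in> enlarge (decset P (t - 1)) e \<Longrightarrow> x \<in> feas P t y z \<Longrightarrow> x' \<in> feas P t y' z \<Longrightarrow>
       0 \<le> a \<Longrightarrow> 0 \<le> b \<Longrightarrow> a + b = 1 \<Longrightarrow>
       a *\<^sub>R x + b *\<^sub>R x' \<in> feas P t (a *\<^sub>R y + b *\<^sub>R y') z"
    by (rule recourse_radius[OF t(1)]) (rule that; assumption)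
  have "y \<in> enlarge (decset P (t - 1)) e" by (rule in_enlarge[OF t(3)]) (use e in simp)
  from comb[OF t(2) this this x ab] show "a *\<^sub>R x + b *\<^sub>R x' \<in> feas P t y z"
    using ab(3) by (simp flip: scaleR_add_left)
qed

text \<open>
  Moving the state from \<open>y\<close> towards \<open>y'\<close> and beyond, up to a fixed distance \<open>e\<close>, one reaches a state
  that still has a feasible decision; the convex combination of this decision with \<open>x\<close> is feasible
  for \<open>y'\<close> and differs from \<open>x\<close> by at most \<open>diam(\<X>\<^sub>t) \<parallel>y' - y\<parallel> / e\<close>.
\<close>

lemma feas_lipschitz:
  assumes t: "t \<in> {1..horizon P}"
  obtains L where "L \<ge> 0" "\<And>z y y' x. z \<in> supp P t \<Longrightarrow> y \<in> decset P (t - 1) \<Longrightarrow>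
    y' \<in> decset P (t - 1) \<Longrightarrow> x \<in> feas P t y z \<Longrightarrow>
    \<exists>x'\<in>feas P t y' z. norm (x' - x) \<le> L * norm (y' - y)"
proof -
  obtain e where e: "0 < e" and
    ne: "\<And>z y. z \<in> supp P t \<Longrightarrow> y \<in> enlarge (decset P (t - 1)) e \<Longrightarrow> feas P t y z \<noteq> {}" and
    comb: "\<And>z y y' x x' a b. z \<in> supp P t \<Longrightarrow> y \<in> enlarge (decset P (t - 1)) e \<Longrightarrow>
       y' \<in> enlarge (decset P (t - 1)) e \<Longrightarrow> x \<in> feas P t y z \<Longrightarrow> x' \<in> feas P t y' z \<Longrightarrow>
       0 \<le> a \<Longrightarrow> 0 \<le> b \<Longrightarrow> a + b = 1 \<Longrightarrow>
       a *\<^sub>R x + b *\<^sub>R x' \<in> feas P t (a *\<^sub>R y + b *\<^sub>R y') z"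
    by (rule recourse_radius[OF t]) (rule that; assumption)
  define D where "D = diameter (decset P t)"
  have bX: "bounded (decset P t)" using t by (auto intro!: compact_imp_bounded decset_props(2))
  have D: "norm (x' - x) \<le> D" if "x \<in> decset P t" "x' \<in> decset P t" for x x'
    using diameter_bounded_bound[OF bX that(2,1)] by (simp add: D_def dist_norm)
  have D0: "D \<ge> 0" unfolding D_def by (rule diameter_ge_0[OF bX])
  show ?thesis
  proof (rule that[of "D / e"])
    show "D / e \<ge> 0" using D0 e by simp
    fix z y y' x
    assume z: "z \<in> supp P t" and y: "y \<in> decset P (t - 1)" "y' \<in> decset P (t - 1)"
      and x: "x \<in> feas P t y z"
    define d where "d = norm (y' - y)"
    have yE: "y \<in> enlarge (decset P (t - 1)) e" "y' \<in> enlarge (decset P (t - 1)) e"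
      using y e by (auto intro: in_enlarge)
    have xX: "x \<in> decset P t" using x feas_in_decset by blast
    consider "d = 0" | "d \<ge> e" | "0 < d" "d < e" using d_def e by fastforce
    then show "\<exists>x'\<in>feas P t y' z. norm (x' - x) \<le> D / e * norm (y' - y)"
    proof cases
      case 1
      then have "y' = y" by (simp add: d_def)
      then show ?thesis using x by (intro bexI[of _ x]) auto
    next
      case 2
      obtain x' where x': "x' \<in> feas P t y' z" using ne[OF z yE(2)] by blast
      then have "norm (x' - x) \<le> D" using D xX feas_in_decset by blast
      also have "\<dots> \<le> D / e * d" using 2 e D0 by (simp add: field_simps mult_left_mono)
      finally show ?thesis using x' d_def by blast
    next
      case 3
      define s where "s = d / e"
      have s: "0 < s" "s < 1" using 3 e by (auto simp: s_def)
      \<comment> \<open>The point at distance \<open>e\<close> from \<open>y\<close> on the ray through \<open>y'\<close>.\<close>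
      define yy where "yy = y + (1 / s) *\<^sub>R (y' - y)"
      have "norm (yy - y) = e" using s 3 e by (simp add: yy_def s_def d_def[symmetric])
      then have yyE: "yy \<in> enlarge (decset P (t - 1)) e" using y(1) by (intro in_enlarge[of y]) auto
      obtain xx where xx: "xx \<in> feas P t yy z" using ne[OF z yyE] by blast
      have "(1 - s) *\<^sub>R y + s *\<^sub>R yy = y'" using s by (simp add: yy_def algebra_simps)
      then have "(1 - s) *\<^sub>R x + s *\<^sub>R xx \<in> feas P t y' z"
        using comb[OF z yE(1) yyE x xx, of "1 - s" s] s by simp
      moreover have "norm ((1 - s) *\<^sub>R x + s *\<^sub>R xx - x) \<le> D / e * d"
      proof -
        have "(1 - s) *\<^sub>R x + s *\<^sub>R xx - x = s *\<^sub>R (xx - x)" by (simp add: algebra_simps)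
        then have "norm ((1 - s) *\<^sub>R x + s *\<^sub>R xx - x) = s * norm (xx - x)" using s by simp
        also have "\<dots> \<le> s * D" using s D[OF xX feas_in_decset[OF xx]] by (intro mult_left_mono) simp_all
        finally show ?thesis by (simp add: s_def field_simps)
      qed
      ultimately show ?thesis using d_def by blast
    qed
  qed
qed

lemma continuous_cost:
  "t \<in> {1..horizon P} \<Longrightarrow> z \<in> supp P t \<Longrightarrow>
    continuous_on (decset P t \<times> enlarge (decset P (t - 1)) r) (\<lambda>(x, y). cost P t x y z)"
  using continuous_data by (simp add: continuous_data_def)

lemma continuous_cost':
  assumes "t \<in> {1..horizon P}" "z \<in> supp P t"
  shows "continuous_on (decset P t \<times> decset P (t - 1)) (\<lambda>(x, y). cost P t x y z)"
  by (rule continuous_on_subset[OF continuous_cost[OF assms]])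
     (use r_pos in \<open>auto intro: in_enlarge\<close>)

lemma tendsto_on_pair:
  assumes "continuous_on (A \<times> B) (\<lambda>(x, y). h x y)" "\<And>j. u j \<in> A" "\<And>j. v j \<in> B"
    "u \<longlonglongrightarrow> a" "v \<longlonglongrightarrow> b" "a \<in> A" "b \<in> B"
  shows "(\<lambda>j::nat. h (u j) (v j)) \<longlonglongrightarrow> h a b"
proof -
  have "(\<lambda>j. (u j, v j)) \<longlonglongrightarrow> (a, b)" using assms by (intro tendsto_intros)
  from continuous_on_tendsto_compose[OF assms(1) this] assms show ?thesis by simp
qed

lemma tendsto_cost:
  assumes "t \<in> {1..horizon P}" "z \<in> supp P t" "\<And>j. u j \<in> decset P t" "\<And>j. v j \<in> decset P (t - 1)"
    "u \<longlonglongrightarrow> a" "v \<longlonglongrightarrow> b" "a \<in> decset P t" "b \<in> decset P (t - 1)"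
  shows "(\<lambda>j. cost P t (u j) (v j) z) \<longlonglongrightarrow> cost P t a b z"
  using tendsto_on_pair[OF continuous_cost'[OF assms(1,2)] assms(3-)] .

lemma feas_closed:
  assumes t: "t \<in> {1..horizon P}" "z \<in> supp P t"
    and x: "\<And>j. x j \<in> feas P t (y j) z" and y: "\<And>j. y j \<in> decset P (t - 1)"
    and lim: "x \<longlonglongrightarrow> x'" "y \<longlonglongrightarrow> y'"
  shows "x' \<in> feas P t y' z"
proof -
  have xX: "x j \<in> decset P t" for j using x feas_in_decset by blast
  have cl: "closed (decset P t)" "closed (decset P (t - 1))"
    using t(1) by (auto intro!: compact_imp_closed decset_props(2))
  have x': "x' \<in> decset P t" and y': "y' \<in> decset P (t - 1)"
    using closed_sequentially[OF cl(1) xX lim(1)] closed_sequentially[OF cl(2) y lim(2)] .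
  have "(\<lambda>j. matA P t z *v x j + matB P t z *v y j) \<longlonglongrightarrow> matA P t z *v x' + matB P t z *v y'"
    by (intro tendsto_add bounded_linear.tendsto[OF matrix_vector_mul_bounded_linear] lim)
  then have lin: "matA P t z *v x' + matB P t z *v y' = vecb P t z"
    unfolding x[THEN feas_eq_constraint] by (metis LIMSEQ_unique tendsto_const)
  show ?thesis
  proof (cases "kind P t")
    case S1
    have "0 \<le> x' $ i" for i
    proof (rule LIMSEQ_le_const)
      show "(\<lambda>j. x j $ i) \<longlonglongrightarrow> x' $ i" using lim(1) by (intro tendsto_intros)
      show "\<exists>N. \<forall>j\<ge>N. 0 \<le> x j $ i" using x S1 by (auto simp: feas_def less_eq_vec_def)
    qed
    then show ?thesis using S1 x' lin by (simp add: feas_def less_eq_vec_def)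
  next
    case S2
    have sub: "decset P (t - 1) \<subseteq> enlarge (decset P (t - 1)) r" using r_pos by (simp add: subset_enlarge)
    have "(\<lambda>j. constr P t (x j) (y j) z) \<longlonglongrightarrow> constr P t x' y' z"
      by (rule tendsto_on_pair[where A = "decset P t" and B = "enlarge (decset P (t - 1)) r"])
         (use continuous_data t S2 xX y sub lim x' y' in \<open>auto simp: continuous_data_def\<close>)
    then have "constr P t x' y' z $ i \<le> 0" for i
    proof (rule LIMSEQ_le_const2[OF tendsto_vec_nth])
      show "\<exists>N. \<forall>j\<ge>N. constr P t (x j) (y j) z $ i \<le> 0"
        using x S2 by (auto simp: feas_def less_eq_vec_def)
    qed
    then show ?thesis using S2 x' lin by (simp add: feas_def less_eq_vec_def)
  qed
qed

lemma compact_feas: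
  assumes "t \<in> {1..horizon P}" "z \<in> supp P t" "y \<in> decset P (t - 1)"
  shows "compact (feas P t y z)"
proof -
  have "closed (feas P t y z)"
    unfolding closed_sequential_limits
    using feas_closed[OF assms(1,2), where y = "\<lambda>_. y"] assms(3) by auto
  moreover have "compact (decset P t)" using assms(1) decset_props(2) by simp
  ultimately show ?thesis
    using compact_Int_closed inf_absorb2[OF feas_subset] by metis
qed

lemma stage_opt_exists:
  assumes t: "t \<in> {1..horizon P}" "z \<in> supp P t" "y \<in> decset P (t - 1)"
    and q: "continuous_on (decset P t) q" "\<And>x. x \<in> decset P t \<Longrightarrow> Q x = ereal (q x)"
  obtains x where "stage_opt P t Q y z x"
proof -
  have "continuous_on (feas P t y z) (\<lambda>x. (\<lambda>(x, y). cost P t x y z) (x, y))"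
    by (rule continuous_on_compose2[OF continuous_cost'[OF t(1,2)]])
       (use feas_subset[of P t y z] t(3) in \<open>auto intro!: continuous_on_Pair\<close>)
  then have "continuous_on (feas P t y z) (\<lambda>x. cost P t x y z)" by simp
  from continuous_on_add[OF this continuous_on_subset[OF q(1) feas_subset]]
  have "continuous_on (feas P t y z) (\<lambda>x. cost P t x y z + q x)" .
  from continuous_attains_inf[OF compact_feas[OF t] feas_nonempty[OF t] this]
  obtain x where "x \<in> feas P t y z"
    "\<And>w. w \<in> feas P t y z \<Longrightarrow> cost P t x y z + q x \<le> cost P t w y z + q w" by blast
  then have "stage_opt P t Q y z x"
    using q(2) feas_in_decset[of _ P t y z] by (simp add: stage_opt_def stage_obj_def)
  then show ?thesis using that by blast
qed

text \<open>
  A decision that is optimal for \<open>a\<close> has a feasible neighbour for any nearby \<open>b\<close>, and the cost is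
  uniformly continuous, so the value at \<open>b\<close> cannot exceed the value at \<open>a\<close> by much. Exchanging
  \<open>a\<close> and \<open>b\<close> gives the reverse bound.
\<close>

lemma continuous_stage_val:
  assumes t: "t \<in> {1..horizon P}" "z \<in> supp P t"
    and q: "continuous_on (decset P t) q" "\<And>x. x \<in> decset P t \<Longrightarrow> Q x = ereal (q x)"
    and v: "\<And>y. y \<in> decset P (t - 1) \<Longrightarrow> stage_val P t Q y z = ereal (v y)"
  shows "continuous_on (decset P (t - 1)) v"
proof -
  let ?X = "decset P t" and ?Y = "decset P (t - 1)"
  let ?F = "\<lambda>(x, y). cost P t x y z + q x"
  obtain L where L: "L \<ge> 0" "\<And>z y y' x. z \<in> supp P t \<Longrightarrow> y \<in> ?Y \<Longrightarrow>
    y' \<in> ?Y \<Longrightarrow> x \<in> feas P t y z \<Longrightarrow> \<exists>x'\<in>feas P t y' z. norm (x' - x) \<le> L * norm (y' - y)"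
    by (rule feas_lipschitz[OF t(1)]) (rule that; assumption)
  have "continuous_on (?X \<times> ?Y) (\<lambda>p. q (fst p))"
    by (rule continuous_on_compose2[OF q(1)]) (auto intro!: continuous_on_fst continuous_on_id)
  then have "continuous_on (?X \<times> ?Y) (\<lambda>p. (\<lambda>(x, y). cost P t x y z) p + q (fst p))"
    by (intro continuous_on_add continuous_cost' t)
  moreover have "(\<lambda>p. (\<lambda>(x, y). cost P t x y z) p + q (fst p)) = ?F" by auto
  ultimately have cF: "continuous_on (?X \<times> ?Y) ?F" by (simp only:)
  have uc: "uniformly_continuous_on (?X \<times> ?Y) ?F"
    by (intro compact_uniformly_continuous cF compact_Times decset_props(2)) (use t in auto)
  show ?thesis
  proof (rule continuous_onI)
    fix y and e :: real assume y: "y \<in> ?Y" and e: "e > 0"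
    obtain d where d: "d > 0" "\<And>p p'. p \<in> ?X \<times> ?Y \<Longrightarrow> p' \<in> ?X \<times> ?Y \<Longrightarrow>
        dist p' p < d \<Longrightarrow> dist (?F p') (?F p) < e"
      by (rule uniformly_continuous_onE[OF uc e]) (rule that; assumption)
    have one_sided: "v b \<le> v a + e" if ab: "a \<in> ?Y" "b \<in> ?Y" and near: "dist b a < d / (L + 1)" for a b
    proof -
      obtain x where x: "stage_opt P t Q a z x"
        using stage_opt_exists[OF t ab(1) q] by blast
      then have xf: "x \<in> feas P t a z" by (simp add: stage_opt_def)
      have va: "v a = cost P t x a z + q x"
        using stage_val_eq[OF x] v[OF ab(1)] q(2)[of x] feas_in_decset[OF xf]
        by (simp add: stage_obj_def)
      obtain x' where x': "x' \<in> feas P t b z" "norm (x' - x) \<le> L * norm (b - a)"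
        using L(2)[OF t(2) ab xf] by blast
      have "dist (x', b) (x, a) \<le> dist x' x + dist b a"
        by (simp add: dist_Pair_Pair) (rule sqrt_sum_squares_le_sum, auto)
      also have "\<dots> \<le> (L + 1) * dist b a" using x'(2) by (simp add: dist_norm algebra_simps)
      also have "\<dots> < d" using near L(1) by (simp add: field_simps)
      finally have "dist (?F (x', b)) (?F (x, a)) < e"
        using d(2) x'(1) xf feas_in_decset ab by blast
      moreover have "v b \<le> cost P t x' b z + q x'"
        using stage_val_le[OF x'(1), of Q] v[OF ab(2)] q(2)[of x'] feas_in_decset[OF x'(1)]
        by (simp add: stage_obj_def)
      ultimately show ?thesis using va by (simp add: dist_real_def)
    qed
    show "\<exists>d>0. \<forall>x'\<in>?Y. dist x' y < d \<longrightarrow> dist (v x') (v y) \<le> e"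
    proof (intro exI[of _ "d / (L + 1)"] conjI ballI impI)
      show "d / (L + 1) > 0" using d(1) L(1) by simp
      fix y' assume "y' \<in> ?Y" "dist y' y < d / (L + 1)"
      then show "dist (v y') (v y) \<le> e"
        using one_sided[OF y, of y'] one_sided[of y' y] y by (auto simp: dist_commute dist_real_def)
    qed
  qed
qed

text \<open>
  The conversion is faithful on \<open>\<X>\<^sub>t\<^sub>-\<^sub>1\<close>, where the recourse function is finite by relatively complete
  recourse and compactness.
\<close>

definition rec :: "nat \<Rightarrow> real ^ 'n \<Rightarrow> real"
  where "rec t y = real_of_ereal (recourse P t y)"

lemma recourse_regular:
  assumes "t \<in> {1..horizon P + 1}"
  shows "continuous_on (decset P (t - 1)) (rec t) \<and>
    (\<forall>y\<in>decset P (t - 1). recourse P t y = ereal (rec t y))"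
proof -
  have "1 \<le> t \<Longrightarrow> t \<le> horizon P + 1 \<Longrightarrow> continuous_on (decset P (t - 1)) (rec t) \<and>
    (\<forall>y\<in>decset P (t - 1). recourse P t y = ereal (rec t y))"
  proof (induction "horizon P + 1 - t" arbitrary: t)
    case 0
    then have "t = horizon P + 1" by simp
    then show ?case by (simp add: recourse.simps rec_def[abs_def] zero_ereal_def)
  next
    case (Suc d)
    then have t: "t \<in> {1..horizon P}" by simp
    have IH: "continuous_on (decset P t) (rec (Suc t))"
      "\<And>y. y \<in> decset P t \<Longrightarrow> recourse P (Suc t) y = ereal (rec (Suc t) y)"
      using Suc.hyps(1)[of "Suc t"] Suc.hyps(2) t by auto
    define v where "v z y = real_of_ereal (stage_val P t (recourse P (Suc t)) y z)" for z y
    have v: "stage_val P t (recourse P (Suc t)) y z = ereal (v z y)"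
      if z: "z \<in> supp P t" and y: "y \<in> decset P (t - 1)" for z y
    proof -
      obtain x where x: "stage_opt P t (recourse P (Suc t)) y z x"
        using stage_opt_exists[OF t z y IH] .
      then have "x \<in> decset P t" by (rule stage_opt_in_decset)
      then show ?thesis using stage_val_eq[OF x] IH(2) by (simp add: v_def stage_obj_def)
    qed
    have eq: "recourse P t y = ereal (\<Sum>z\<in>supp P t. pr P t z * v z y)" if "y \<in> decset P (t - 1)" for y
      using t that v by (simp add: recourse.simps[of P t])
    then have "rec t y = (\<Sum>z\<in>supp P t. pr P t z * v z y)" if "y \<in> decset P (t - 1)" for y
      using that by (simp add: rec_def)
    moreover have "continuous_on (decset P (t - 1)) (\<lambda>y. \<Sum>z\<in>supp P t. pr P t z * v z y)"
      by (intro continuous_intros continuous_stage_val[OF t _ IH v])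
    ultimately show ?case using eq by (simp cong: continuous_on_cong)
  qed
  then show ?thesis using assms by simp
qed

lemmas continuous_rec = recourse_regular[THEN conjunct1]
lemmas recourse_eq = recourse_regular[THEN conjunct2, rule_format]

lemma rec_final: "rec (Suc (horizon P)) y = 0"
  by (simp add: rec_def recourse.simps)

lemma recourse_Suc_eq: "t \<le> horizon P \<Longrightarrow> y \<in> decset P t \<Longrightarrow> recourse P (Suc t) y = ereal (rec (Suc t) y)"
  using recourse_eq[of "Suc t" y] by simp

definition val :: "nat \<Rightarrow> real ^ 'n \<Rightarrow> real ^ 'k \<Rightarrow> real"
  where "val t y z = real_of_ereal (stage_val P t (recourse P (Suc t)) y z)"

lemma stage_opt_recourse_exists:
  assumes "t \<in> {1..horizon P}" "z \<in> supp P t" "y \<in> decset P (t - 1)"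
  obtains x where "stage_opt P t (recourse P (Suc t)) y z x"
proof (rule stage_opt_exists[OF assms])
  show "continuous_on (decset P t) (rec (Suc t))"
    using continuous_rec[of "Suc t"] assms(1) by simp
  show "recourse P (Suc t) x = ereal (rec (Suc t) x)" if "x \<in> decset P t" for x
    using recourse_Suc_eq that assms(1) by simp
qed (rule that)

lemma val_eq:
  assumes "t \<in> {1..horizon P}" "stage_opt P t (recourse P (Suc t)) y z x"
  shows "stage_val P t (recourse P (Suc t)) y z = ereal (cost P t x y z + rec (Suc t) x)"
    "val t y z = cost P t x y z + rec (Suc t) x"
proof -
  have "x \<in> decset P t" using assms(2) by (rule stage_opt_in_decset)
  then show *: "stage_val P t (recourse P (Suc t)) y z = ereal (cost P t x y z + rec (Suc t) x)"
    using stage_val_eq[OF assms(2)] recourse_Suc_eq assms(1) by (simp add: stage_obj_def)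
  then show "val t y z = cost P t x y z + rec (Suc t) x" by (simp add: val_def)
qed

lemma stage_val_recourse:
  assumes "t \<in> {1..horizon P}" "z \<in> supp P t" "y \<in> decset P (t - 1)"
  shows "stage_val P t (recourse P (Suc t)) y z = ereal (val t y z)"
  using stage_opt_recourse_exists[OF assms] val_eq[OF assms(1)] by metis

lemma val_le:
  assumes "t \<in> {1..horizon P}" "z \<in> supp P t" "y \<in> decset P (t - 1)" "x \<in> feas P t y z"
  shows "val t y z \<le> cost P t x y z + rec (Suc t) x"
proof -
  have "x \<in> decset P t" using assms(4) feas_subset by blast
  then show ?thesis
    using stage_val_le[OF assms(4), of "recourse P (Suc t)"] stage_val_recourse[OF assms(1-3)]
      recourse_Suc_eq assms(1) by (simp add: stage_obj_def)
qed

lemma rec_eq_sum_val: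
  assumes "t \<in> {1..horizon P}" "y \<in> decset P (t - 1)"
  shows "rec t y = (\<Sum>z\<in>supp P t. pr P t z * val t y z)"
  using assms stage_val_recourse by (simp add: rec_def recourse.simps[of P t])

end

section \<open>Validity of the cuts\<close>

lemma subgradient_onD: "subgradient_on S F x v \<Longrightarrow> y \<in> S \<Longrightarrow> F x + v \<bullet> (y - x) \<le> F y"
  by (simp add: subgradient_on_def)

context regular_msp
begin

text \<open>
  The first-order certificate contained in the slope condition turns a lower bound for the cost by
  its linearization, with an extra term \<open>c\<close>, into the same lower bound for cost plus continuation:
  along feasible pairs the equality constraints exchange \<open>A\<^sup>T\<lambda>\<close> for \<open>B\<^sup>T\<lambda>\<close>, and for type S2
  complementary slackness, which follows from optimality of the multipliers, absorbs \<open>g\<close>.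
\<close>

lemma slope_bound:
  assumes x: "stage_opt P t Q y z x"
    and Q: "\<And>w. w \<in> decset P t \<Longrightarrow> Q w = ereal (q w)"
    and S1: "kind P t = S1 \<Longrightarrow> slope_S1 P r t Q y z x l b"
    and S2: "kind P t = S2 \<Longrightarrow> opt_mult_S2 P t Q y z l u \<and> slope_S2 P r t Q y z x l u b"
    and x': "x' \<in> feas P t y' z" and y': "y' \<in> enlarge (decset P (t - 1)) r"
    and cost: "\<And>d s. subgradient_on (decset P t \<times> enlarge (decset P (t - 1)) r)
        (\<lambda>(x, y). cost P t x y z) (x, y) (d, s) \<Longrightarrow>
        cost P t x y z + d \<bullet> (x' - x) + s \<bullet> (y' - y) + c \<le> cost P t x' y' z"
  shows "cost P t x y z + q x + b \<bullet> (y' - y) + c \<le> cost P t x' y' z + q x'"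
proof -
  have xf: "x \<in> feas P t y z" using x by (simp add: stage_opt_def)
  note xX = feas_in_decset[OF xf] and xX' = feas_in_decset[OF x']
  have "matA P t z *v (x' - x) + matB P t z *v (y' - y) = 0"
    using feas_eq_constraint[OF xf] feas_eq_constraint[OF x']
    by (simp add: matrix_vector_mult_diff_distrib algebra_simps)
  then have "l \<bullet> (matA P t z *v (x' - x)) + l \<bullet> (matB P t z *v (y' - y)) = 0"
    by (simp flip: inner_add_right)
  then have dual: "(transpose (matA P t z) *v l) \<bullet> (x' - x) + (transpose (matB P t z) *v l) \<bullet> (y' - y) = 0"
    by (simp add: transpose_matrix_vector dot_lmul_matrix)
  show ?thesis
  proof (cases "kind P t")
    case kind: S1
    obtain d s where ds: "subgradient_on (decset P t \<times> enlarge (decset P (t - 1)) r)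
        (\<lambda>(x, y). cost P t x y z) (x, y) (d, s)"
      and opt: "\<And>w. w \<in> decset P t \<Longrightarrow> 0 \<le> w \<Longrightarrow>
        Q x \<le> ereal ((d + transpose (matA P t z) *v l) \<bullet> (w - x)) + Q w"
      and b: "b = s + transpose (matB P t z) *v l"
      using S1[OF kind] unfolding slope_S1_def by blast
    have "0 \<le> x'" using x' kind by (simp add: feas_def)
    from opt[OF xX' this] have "q x \<le> (d + transpose (matA P t z) *v l) \<bullet> (x' - x) + q x'"
      using Q xX xX' by simp
    then show ?thesis using cost[OF ds] dual by (simp add: b inner_add_left)
  next
    case kind: S2
    obtain d s d' s' where ds: "subgradient_on (decset P t \<times> enlarge (decset P (t - 1)) r)
        (\<lambda>(x, y). cost P t x y z) (x, y) (d, s)"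
      and ds': "\<And>i. subgradient_on (decset P t \<times> enlarge (decset P (t - 1)) r)
        (\<lambda>(x, y). constr P t x y z $ i) (x, y) (d' i, s' i)"
      and opt: "\<And>w. w \<in> decset P t \<Longrightarrow> Q x \<le>
        ereal ((d + transpose (matA P t z) *v l + (\<Sum>i\<in>UNIV. u $ i *\<^sub>R d' i)) \<bullet> (w - x)) + Q w"
      and b: "b = s + transpose (matB P t z) *v l + (\<Sum>i\<in>UNIV. u $ i *\<^sub>R s' i)"
      using S2[OF kind] unfolding slope_S2_def by blast
    have u: "u $ i \<ge> 0" for i
      using S2[OF kind] by (simp add: opt_mult_S2_def less_eq_vec_def)
    have "stage_obj P t Q x y z = stage_val P t Q y z" using stage_val_eq[OF x] by simp
    also have "\<dots> = (INF x\<in>decset P t. stage_obj P t Q x y z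
        + ereal (l \<bullet> resid P t x y z + u \<bullet> constr P t x y z))"
      using S2[OF kind] unfolding opt_mult_S2_def by metis
    also have "\<dots> \<le> stage_obj P t Q x y z + ereal (l \<bullet> resid P t x y z + u \<bullet> constr P t x y z)"
      by (rule INF_lower[OF xX])
    also have "resid P t x y z = 0"
      using feas_eq_constraint[OF xf] by (simp add: resid_def)
    finally have slack: "0 \<le> u \<bullet> constr P t x y z"
      using Q[OF xX] by (simp add: stage_obj_def)
    have "u $ i * (constr P t x y z $ i) + u $ i * (d' i \<bullet> (x' - x) + s' i \<bullet> (y' - y)) \<le> 0" for i
    proof -
      have "constr P t x y z $ i + (d' i \<bullet> (x' - x) + s' i \<bullet> (y' - y)) \<le> constr P t x' y' z $ i"
        using subgradient_onD[OF ds'[of i], of "(x', y')"] xX' y' by simp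
      also have "\<dots> \<le> 0" using x' kind by (simp add: feas_def less_eq_vec_def)
      finally show ?thesis using u[of i] by (simp add: mult_nonneg_nonpos flip: distrib_left)
    qed
    then have "(\<Sum>i\<in>UNIV. u $ i * (constr P t x y z $ i) +
        u $ i * (d' i \<bullet> (x' - x) + s' i \<bullet> (y' - y))) \<le> 0"
      by (intro sum_nonpos) simp
    then have "u \<bullet> constr P t x y z + ((\<Sum>i\<in>UNIV. u $ i *\<^sub>R d' i) \<bullet> (x' - x) +
        (\<Sum>i\<in>UNIV. u $ i *\<^sub>R s' i) \<bullet> (y' - y)) \<le> 0"
      by (simp add: inner_vec_def[of u] inner_sum_left sum.distrib distrib_left)
    moreover have "q x \<le> (d + transpose (matA P t z) *v l + (\<Sum>i\<in>UNIV. u $ i *\<^sub>R d' i)) \<bullet> (x' - x) + q x'"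
      using opt[OF xX'] Q xX xX' by simp
    ultimately show ?thesis using cost[OF ds] dual slack by (simp add: b inner_add_left)
  qed
qed

end

lemma children_eq_image: "children P n = (\<lambda>z. n @ [z]) ` supp P (Suc (length n))"
  by (auto simp: children_def)

lemma sum_children: "(\<Sum>m\<in>children P n. f m) = (\<Sum>z\<in>supp P (Suc (length n)). f (n @ [z]))"
  unfolding children_eq_image by (subst sum.reindex) (auto simp: inj_on_def)

lemma nodes_0 [simp]: "nodes P 0 = {[]}"
  by (auto simp: nodes_def)

lemma length_node: "n \<in> nodes P t \<Longrightarrow> length n = t"
  by (simp add: nodes_def)

lemma node_snoc: "n @ [z] \<in> nodes P (Suc t) \<longleftrightarrow> n \<in> nodes P t \<and> z \<in> supp P (Suc t)"
  by (auto simp: nodes_def nth_append less_Suc_eq)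

lemma node_cases:
  assumes "n \<in> nodes P (Suc t)"
  obtains m z where "n = m @ [z]" "m \<in> nodes P t" "z \<in> supp P (Suc t)"
proof (cases n rule: rev_cases)
  case Nil
  then show ?thesis using assms by (simp add: nodes_def)
next
  case (snoc m z)
  then show ?thesis using that node_snoc assms by blast
qed

lemma length_sampled_node [simp]: "length (sampled_node P \<omega> k t) = t"
  by (simp add: sampled_node_def)

lemma norm_square_convex:
  fixes u v :: "'a::real_inner"
  assumes "0 \<le> a" "0 \<le> b" "a + b = 1"
  shows "(norm (a *\<^sub>R u + b *\<^sub>R v))\<^sup>2 \<le> a * (norm u)\<^sup>2 + b * (norm v)\<^sup>2"
proof -
  have b: "b = 1 - a" using assms(3) by simp
  have "a * (norm u)\<^sup>2 + b * (norm v)\<^sup>2 - (norm (a *\<^sub>R u + b *\<^sub>R v))\<^sup>2 = a * b * (norm (u - v))\<^sup>2"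
    unfolding power2_norm_eq_inner b
    by (simp add: inner_add_left inner_add_right inner_diff_left inner_diff_right inner_commute algebra_simps)
  also have "\<dots> \<ge> 0" using assms by simp
  finally show ?thesis by simp
qed

text \<open>
  The analysis of a single execution is deterministic. The samples enter only through the two
  properties assumed in this locale and the next: they lie in the supports, and every node is sampled
  infinitely often.
\<close>

locale dasc_execution = regular_msp P r
  for P :: "('w, 'n::finite, 'k::finite, 'q::finite, 'p::finite) msp" and r :: real +
  fixes \<omega> :: "nat \<Rightarrow> nat \<Rightarrow> real ^ 'k" and R :: "('n, 'k, 'q, 'p) dasc_run"
  assumes samples: "\<And>k s. 1 \<le> k \<Longrightarrow> s \<in> {2..horizon P} \<Longrightarrow> \<omega> k s \<in> supp P s"
    and run: "dasc P r \<omega> R"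
begin

lemma sampled_node_in_nodes:
  assumes "1 \<le> k" "t \<le> horizon P"
  shows "sampled_node P \<omega> k t \<in> nodes P t"
proof -
  have "sampled_node P \<omega> k t ! i \<in> supp P (Suc i)" if "i < t" for i
    using assms samples[of k "Suc i"] supp_1 that by (auto simp: sampled_node_def simp del: upt_Suc)
  then show ?thesis by (simp add: nodes_def)
qed

lemma fwd_root: "1 \<le> k \<Longrightarrow> fwd R k [] = init P"
  using run by (simp add: dasc_def)

lemma fwd_opt:
  assumes "1 \<le> k" "t \<in> {1..horizon P}" "n \<in> nodes P (t - 1)" "z \<in> supp P t"
  shows "stage_opt P t (approx P \<omega> R (k - 1) (Suc t)) (fwd R k n) z (fwd R k (n @ [z]))"
proof -
  have "n @ [z] \<in> children P n"
    using assms length_node[OF assms(3)] by (simp add: children_def)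
  then have "stage_opt P t (approx P \<omega> R (k - 1) (Suc t)) (fwd R k n) (last (n @ [z])) (fwd R k (n @ [z]))"
    using run assms unfolding dasc_def by blast
  then show ?thesis by simp
qed

lemma fwd_in_decset:
  assumes "1 \<le> k" "t \<le> horizon P" "n \<in> nodes P t"
  shows "fwd R k n \<in> decset P t"
proof (cases t)
  case 0
  then show ?thesis using assms fwd_root by (simp add: decset_def)
next
  case (Suc s)
  then obtain m z where "n = m @ [z]" "m \<in> nodes P s" "z \<in> supp P (Suc s)"
    using assms(3) node_cases by blast
  then show ?thesis using stage_opt_in_decset[OF fwd_opt[of k t m z]] assms Suc by simp
qed

definition trial :: "nat \<Rightarrow> nat \<Rightarrow> real ^ 'n"
  where "trial k t = fwd R k (sampled_node P \<omega> k (t - 1))"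

definition bdec :: "nat \<Rightarrow> nat \<Rightarrow> real ^ 'k \<Rightarrow> real ^ 'n"
  where "bdec k t z = bwd R k (sampled_node P \<omega> k (t - 1) @ [z])"

definition bslope :: "nat \<Rightarrow> nat \<Rightarrow> real ^ 'k \<Rightarrow> real ^ 'n"
  where "bslope k t z = slope R k (sampled_node P \<omega> k (t - 1) @ [z])"

lemma trial_in_decset: "1 \<le> k \<Longrightarrow> t \<in> {1..horizon P} \<Longrightarrow> trial k t \<in> decset P (t - 1)"
  unfolding trial_def by (intro fwd_in_decset sampled_node_in_nodes) auto

lemma backward_step:
  assumes k: "1 \<le> k" and t: "t \<in> {2..horizon P}" and z: "z \<in> supp P t"
  obtains l u where "stage_opt P t (approx P \<omega> R k (Suc t)) (trial k t) z (bdec k t z)"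
    "kind P t = S1 \<Longrightarrow>
      slope_S1 P r t (approx P \<omega> R k (Suc t)) (trial k t) z (bdec k t z) l (bslope k t z)"
    "kind P t = S2 \<Longrightarrow> opt_mult_S2 P t (approx P \<omega> R k (Suc t)) (trial k t) z l u \<and>
      slope_S2 P r t (approx P \<omega> R k (Suc t)) (trial k t) z (bdec k t z) l u (bslope k t z)"
proof -
  define m where "m = sampled_node P \<omega> k (t - 1) @ [z]"
  have "Suc (length (sampled_node P \<omega> k (t - 1))) = t" using t by simp
  then have "m \<in> children P (sampled_node P \<omega> k (t - 1))"
    using z by (auto simp: m_def children_def)
  then have *: "let xn = fwd R k (sampled_node P \<omega> k (t - 1)); Q = approx P \<omega> R k (Suc t); z = last m in
         stage_opt P t Q xn z (bwd R k m) \<and>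
         (case kind P t of
            S1 \<Rightarrow> opt_mult_S1 P t Q xn z (lam R k m) \<and>
                  slope_S1 P r t Q xn z (bwd R k m) (lam R k m) (slope R k m)
          | S2 \<Rightarrow> opt_mult_S2 P t Q xn z (lam R k m) (mu R k m) \<and>
                  slope_S2 P r t Q xn z (bwd R k m) (lam R k m) (mu R k m) (slope R k m))"
    using run k t unfolding dasc_def by blast
  have defs: "last m = z" "trial k t = fwd R k (sampled_node P \<omega> k (t - 1))"
    "bdec k t z = bwd R k m" "bslope k t z = slope R k m"
    by (simp_all add: trial_def bdec_def bslope_def m_def)
  show ?thesis
    by (rule that[of "lam R k m" "mu R k m"]) (use * in \<open>simp_all add: Let_def defs\<close>)
qed

text \<open>
  \<open>qk k t\<close> and \<open>cutr k t\<close> are \<open>\<Q>\<^sub>t\<^sup>k\<close> and \<open>\<C>\<^sub>t\<^sup>k\<close> as real functions. The cut is written as the mean of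
  one quadratic per realization, because validity is proved realization by realization.
\<close>

definition qk :: "nat \<Rightarrow> nat \<Rightarrow> real ^ 'n \<Rightarrow> real"
  where "qk k t y = real_of_ereal (approx P \<omega> R k t y)"

definition cutr :: "nat \<Rightarrow> nat \<Rightarrow> real ^ 'n \<Rightarrow> real"
  where "cutr k t y =
    (\<Sum>z\<in>supp P t. pr P t z * (cost P t (bdec k t z) (trial k t) z + qk k (Suc t) (bdec k t z)
       + bslope k t z \<bullet> (y - trial k t) + sconst P t z / 2 * (norm (y - trial k t))\<^sup>2))"

lemma approx_final: "approx P \<omega> R k (Suc (horizon P)) y = 0" "qk k (Suc (horizon P)) y = 0"
  by (simp_all add: approx.simps qk_def)

lemma cut_eq:
  assumes k: "1 \<le> k" and t: "t \<in> {2..horizon P}"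
    and Q: "\<And>y. approx P \<omega> R k (Suc t) y = ereal (qk k (Suc t) y)"
  shows "cut P \<omega> R k t (approx P \<omega> R k (Suc t)) y = ereal (cutr k t y)"
proof -
  have len: "Suc (length (sampled_node P \<omega> k (t - 1))) = t" using t by simp
  have val: "stage_val P t (approx P \<omega> R k (Suc t)) (trial k t) z
      = ereal (cost P t (bdec k t z) (trial k t) z + qk k (Suc t) (bdec k t z))"
    if z: "z \<in> supp P t" for z
  proof -
    obtain l u where "stage_opt P t (approx P \<omega> R k (Suc t)) (trial k t) z (bdec k t z)"
      using backward_step[OF k t z] by blast
    from stage_val_eq[OF this] show ?thesis by (simp add: stage_obj_def Q)
  qed
  have "cut P \<omega> R k t (approx P \<omega> R k (Suc t)) y =
    (\<Sum>z\<in>supp P t. ereal (pr P t z) * stage_val P t (approx P \<omega> R k (Suc t)) (trial k t) z) +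
    ereal ((\<Sum>z\<in>supp P t. pr P t z *\<^sub>R bslope k t z) \<bullet> (y - trial k t) +
      alpha P t / 2 * (norm (y - trial k t))\<^sup>2)"
    unfolding cut_def Let_def sum_children len
    using len by (simp add: node_pr_def trial_def bslope_def)
  also have "\<dots> = ereal ((\<Sum>z\<in>supp P t. pr P t z *
        (cost P t (bdec k t z) (trial k t) z + qk k (Suc t) (bdec k t z))) +
    ((\<Sum>z\<in>supp P t. pr P t z *\<^sub>R bslope k t z) \<bullet> (y - trial k t) +
      alpha P t / 2 * (norm (y - trial k t))\<^sup>2))"
    by (simp add: val)
  also have "\<dots> = ereal (cutr k t y)"
    unfolding cutr_def alpha_def inner_sum_left sum_divide_distrib sum_distrib_right sum.distrib[symmetric]
    by (intro arg_cong[where f = ereal] sum.cong refl) (simp add: algebra_simps)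
  finally show ?thesis .
qed

lemma approx_real:
  assumes "1 \<le> k" "2 \<le> t" "t \<le> horizon P + 1"
  shows "approx P \<omega> R k t y = ereal (qk k t y) \<and>
    (t \<le> horizon P \<longrightarrow> qk k t y = Max ((\<lambda>l. cutr l t y) ` {1..k}))"
  using assms
proof (induction "horizon P + 1 - t" arbitrary: t k y)
  case 0
  then have "t = Suc (horizon P)" by simp
  then show ?case by (simp add: approx_final)
next
  case (Suc d)
  then have t: "t \<in> {2..horizon P}" by simp
  have Q: "approx P \<omega> R l (Suc t) x = ereal (qk l (Suc t) x)" if "1 \<le> l" for l x
    using Suc.hyps(1)[of "Suc t" l x] Suc.hyps(2) that t by simp
  have ne: "{1..k} \<noteq> {}" using Suc.prems(1) by simp
  have "approx P \<omega> R k t y = (SUP l\<in>{1..k}. cut P \<omega> R l t (approx P \<omega> R l (Suc t)) y)"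
    using t by (simp add: approx.simps[of P \<omega> R k t])
  also have "\<dots> = (SUP l\<in>{1..k}. ereal (cutr l t y))"
    using cut_eq[OF _ t Q] by (intro SUP_cong) auto
  also have "\<dots> = Max ((\<lambda>l. ereal (cutr l t y)) ` {1..k})"
    using ne by (intro cSup_eq_Max) auto
  also have "\<dots> = ereal (Max ((\<lambda>l. cutr l t y) ` {1..k}))"
    using ne mono_Max_commute[of ereal "(\<lambda>l. cutr l t y) ` {1..k}"] by (simp add: mono_def image_image)
  finally show ?case by (simp add: qk_def)
qed

lemma approx_eq:
  "1 \<le> k \<Longrightarrow> t \<in> {2..horizon P + 1} \<Longrightarrow> approx P \<omega> R k t y = ereal (qk k t y)"
  using approx_real by simp

lemma qk_eq_Max:
  "1 \<le> k \<Longrightarrow> t \<in> {2..horizon P} \<Longrightarrow> qk k t y = Max ((\<lambda>l. cutr l t y) ` {1..k})"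
  using approx_real by simp

lemma approx_Suc_eq:
  "1 \<le> k \<Longrightarrow> t \<in> {1..horizon P} \<Longrightarrow> approx P \<omega> R k (Suc t) y = ereal (qk k (Suc t) y)"
  using approx_eq[of k "Suc t"] by simp

lemma cutr_le_qk: "1 \<le> l \<Longrightarrow> l \<le> k \<Longrightarrow> t \<in> {2..horizon P} \<Longrightarrow> cutr l t y \<le> qk k t y"
  by (auto simp: qk_eq_Max intro: Max_ge)

lemma qk_attained:
  assumes "1 \<le> k" "t \<in> {2..horizon P}"
  obtains l where "1 \<le> l" "l \<le> k" "qk k t y = cutr l t y"
proof -
  have "Max ((\<lambda>l. cutr l t y) ` {1..k}) \<in> (\<lambda>l. cutr l t y) ` {1..k}"
    using assms by (intro Max_in) auto
  then show ?thesis using qk_eq_Max[OF assms] that by auto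
qed

lemma qk_mono:
  assumes "1 \<le> k" "k \<le> k'" "t \<in> {2..horizon P + 1}"
  shows "qk k t y \<le> qk k' t y"
proof (cases "t = Suc (horizon P)")
  case False
  then have t: "t \<in> {2..horizon P}" using assms(3) by auto
  obtain l where "1 \<le> l" "l \<le> k" "qk k t y = cutr l t y" by (rule qk_attained[OF assms(1) t])
  then show ?thesis using cutr_le_qk[of l k' t y] assms t by simp
qed (simp add: approx_final)

lemma cutr_continuous: "continuous_on S (cutr k t)"
  unfolding cutr_def[abs_def] by (intro continuous_intros)

lemma cutr_convex:
  assumes t: "t \<in> {1..horizon P}" and ab: "0 \<le> a" "0 \<le> b" "a + b = 1"
  shows "cutr k t (a *\<^sub>R y + b *\<^sub>R y') \<le> a * cutr k t y + b * cutr k t y'"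
proof -
  define h where "h z y = cost P t (bdec k t z) (trial k t) z + qk k (Suc t) (bdec k t z)
       + bslope k t z \<bullet> (y - trial k t) + sconst P t z / 2 * (norm (y - trial k t))\<^sup>2" for z y
  have shift: "a *\<^sub>R y + b *\<^sub>R y' - v = a *\<^sub>R (y - v) + b *\<^sub>R (y' - v)" for v
  proof -
    have "a *\<^sub>R v + b *\<^sub>R v = v" using ab(3) by (simp flip: scaleR_add_left)
    then show ?thesis by (simp add: algebra_simps)
  qed
  have b: "b = 1 - a" using ab(3) by simp
  have "h z (a *\<^sub>R y + b *\<^sub>R y') \<le> a * h z y + b * h z y'" if z: "z \<in> supp P t" for z
  proof -
    have "sconst P t z / 2 * (norm (a *\<^sub>R (y - trial k t) + b *\<^sub>R (y' - trial k t)))\<^sup>2 \<le>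
      sconst P t z / 2 * (a * (norm (y - trial k t))\<^sup>2 + b * (norm (y' - trial k t))\<^sup>2)"
      using norm_square_convex[OF ab] strongly_convex_cost(1)[OF t z] by (intro mult_left_mono) auto
    then have "h z (a *\<^sub>R y + b *\<^sub>R y') \<le> cost P t (bdec k t z) (trial k t) z + qk k (Suc t) (bdec k t z)
        + (a * (bslope k t z \<bullet> (y - trial k t)) + b * (bslope k t z \<bullet> (y' - trial k t)))
        + sconst P t z / 2 * (a * (norm (y - trial k t))\<^sup>2 + b * (norm (y' - trial k t))\<^sup>2)"
      unfolding h_def shift inner_add_right inner_scaleR_right by simp
    also have "\<dots> = a * h z y + b * h z y'"
      unfolding h_def b by (simp add: field_simps)
    finally show ?thesis .
  qed
  then have "(\<Sum>z\<in>supp P t. pr P t z * h z (a *\<^sub>R y + b *\<^sub>R y')) \<le>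
      (\<Sum>z\<in>supp P t. pr P t z * (a * h z y + b * h z y'))"
    by (intro sum_mono mult_left_mono) (auto simp: supp_def)
  also have "\<dots> = a * (\<Sum>z\<in>supp P t. pr P t z * h z y) + b * (\<Sum>z\<in>supp P t. pr P t z * h z y')"
    by (simp add: sum_distrib_left sum.distrib algebra_simps)
  finally show ?thesis unfolding cutr_def h_def .
qed

lemma qk_convex:
  assumes k: "1 \<le> k" and t: "t \<in> {2..horizon P + 1}" and ab: "0 \<le> a" "0 \<le> b" "a + b = 1"
  shows "qk k t (a *\<^sub>R y + b *\<^sub>R y') \<le> a * qk k t y + b * qk k t y'"
proof (cases "t = Suc (horizon P)")
  case False
  then have t: "t \<in> {2..horizon P}" using assms(2) by auto
  obtain l where l: "1 \<le> l" "l \<le> k" "qk k t (a *\<^sub>R y + b *\<^sub>R y') = cutr l t (a *\<^sub>R y + b *\<^sub>R y')"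
    by (rule qk_attained[OF k t])
  have "\<dots> \<le> a * cutr l t y + b * cutr l t y'" using t by (intro cutr_convex ab) auto
  also have "\<dots> \<le> a * qk k t y + b * qk k t y'"
    using cutr_le_qk[OF l(1,2) t] ab by (intro add_mono mult_left_mono) auto
  finally show ?thesis using l(3) by simp
qed (simp add: approx_final)

text \<open>
  Outside \<open>\<X>\<^sub>t\<^sub>-\<^sub>1\<close> the cost is only known to lie above its linearizations, so there only the affine
  part of the cut is obtained; it is used to bound the slopes. On \<open>\<X>\<^sub>t\<^sub>-\<^sub>1\<close> strong convexity adds the
  quadratic term.
\<close>

lemma backward_bound:
  assumes k: "1 \<le> k" and t: "t \<in> {2..horizon P}" and z: "z \<in> supp P t"
    and x': "x' \<in> feas P t y' z" and y': "y' \<in> enlarge (decset P (t - 1)) r"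
  shows "cost P t (bdec k t z) (trial k t) z + qk k (Suc t) (bdec k t z) + bslope k t z \<bullet> (y' - trial k t)
      \<le> cost P t x' y' z + qk k (Suc t) x'" (is ?lin)
    and "y' \<in> decset P (t - 1) \<Longrightarrow>
      cost P t (bdec k t z) (trial k t) z + qk k (Suc t) (bdec k t z) + bslope k t z \<bullet> (y' - trial k t)
      + sconst P t z / 2 * (norm (y' - trial k t))\<^sup>2 \<le> cost P t x' y' z + qk k (Suc t) x'" (is "_ \<Longrightarrow> ?quad")
proof -
  let ?y = "trial k t" and ?x = "bdec k t z" and ?S = "decset P t \<times> enlarge (decset P (t - 1)) r"
  have t1: "t \<in> {1..horizon P}" using t by simp
  obtain l u where opt: "stage_opt P t (approx P \<omega> R k (Suc t)) ?y z ?x"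
    and S1: "kind P t = S1 \<Longrightarrow> slope_S1 P r t (approx P \<omega> R k (Suc t)) ?y z ?x l (bslope k t z)"
    and S2: "kind P t = S2 \<Longrightarrow> opt_mult_S2 P t (approx P \<omega> R k (Suc t)) ?y z l u \<and>
      slope_S2 P r t (approx P \<omega> R k (Suc t)) ?y z ?x l u (bslope k t z)"
    by (rule backward_step[OF k t z]) (rule that; assumption)
  note bound = slope_bound[OF opt approx_Suc_eq[OF k t1] S1 S2 x' y']
  have x: "?x \<in> decset P t" by (rule stage_opt_in_decset[OF opt])
  have xX': "x' \<in> decset P t" by (rule feas_in_decset[OF x'])
  have "cost P t ?x ?y z + qk k (Suc t) ?x + bslope k t z \<bullet> (y' - ?y) + 0 \<le> cost P t x' y' z + qk k (Suc t) x'"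
  proof (rule bound)
    fix d s assume "subgradient_on ?S (\<lambda>(x, y). cost P t x y z) (?x, ?y) (d, s)"
    then show "cost P t ?x ?y z + d \<bullet> (x' - ?x) + s \<bullet> (y' - ?y) + 0 \<le> cost P t x' y' z"
      using subgradient_onD[of _ _ _ _ "(x', y')"] xX' y' by fastforce
  qed
  then show ?lin by simp
  assume yX': "y' \<in> decset P (t - 1)"
  show ?quad
  proof (rule bound)
    fix d s assume sub: "subgradient_on ?S (\<lambda>(x, y). cost P t x y z) (?x, ?y) (d, s)"
    have "(\<lambda>(x, y). cost P t x y z) (?x, ?y) + (d, s) \<bullet> ((x', y') - (?x, ?y)) +
        sconst P t z / 2 * (norm ((x', y') - (?x, ?y)))\<^sup>2 \<le> (\<lambda>(x, y). cost P t x y z) (x', y')"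
    proof (rule subgradient_quadratic_bound[OF strongly_convex_cost(2)[OF t1 z] sub])
      show "decset P t \<times> decset P (t - 1) \<subseteq> ?S"
        using subset_enlarge[of r "decset P (t - 1)"] r_pos by auto
      show "convex (decset P t \<times> decset P (t - 1))"
        using t1 by (intro convex_Times decset_props(1)) auto
    qed (use x xX' yX' trial_in_decset[OF k t1] in auto)
    moreover have "sconst P t z / 2 * (norm (y' - ?y))\<^sup>2 \<le> sconst P t z / 2 * (norm ((x', y') - (?x, ?y)))\<^sup>2"
      using strongly_convex_cost(1)[OF t1 z]
      by (intro mult_left_mono power_mono) (auto simp: norm_Pair intro: real_le_rsqrt)
    ultimately show "cost P t ?x ?y z + d \<bullet> (x' - ?x) + s \<bullet> (y' - ?y) + sconst P t z / 2 * (norm (y' - ?y))\<^sup>2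
        \<le> cost P t x' y' z"
      by simp
  qed
qed

lemma qk_le_rec:
  assumes "1 \<le> k" "2 \<le> t" "t \<le> horizon P + 1" "y \<in> decset P (t - 1)"
  shows "qk k t y \<le> rec t y"
  using assms
proof (induction "horizon P + 1 - t" arbitrary: t k y)
  case 0
  then have "t = Suc (horizon P)" by simp
  then show ?case by (simp add: approx_final rec_final)
next
  case (Suc d)
  then have t: "t \<in> {2..horizon P}" and t1: "t \<in> {1..horizon P}" by simp_all
  obtain l where l: "1 \<le> l" "qk k t y = cutr l t y"
    by (rule qk_attained[OF Suc.prems(1) t])
  have "cutr l t y \<le> (\<Sum>z\<in>supp P t. pr P t z * val t y z)"
    unfolding cutr_def
  proof (intro sum_mono mult_left_mono)
    fix z assume z: "z \<in> supp P t"
    obtain x' where x': "stage_opt P t (recourse P (Suc t)) y z x'"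
      by (rule stage_opt_recourse_exists[OF t1 z Suc.prems(4)])
    have "y \<in> enlarge (decset P (t - 1)) r" using Suc.prems(4) r_pos by (intro in_enlarge) auto
    from backward_bound(2)[OF l(1) t z _ this Suc.prems(4)]
    have "cost P t (bdec l t z) (trial l t) z + qk l (Suc t) (bdec l t z) + bslope l t z \<bullet> (y - trial l t)
      + sconst P t z / 2 * (norm (y - trial l t))\<^sup>2 \<le> cost P t x' y z + qk l (Suc t) x'"
      using x' by (simp add: stage_opt_def)
    also have "\<dots> \<le> cost P t x' y z + rec (Suc t) x'"
      using Suc.hyps(1)[of "Suc t" l x'] Suc.hyps(2) l(1) t stage_opt_in_decset[OF x'] by simp
    also have "\<dots> = val t y z" using val_eq(2)[OF t1 x'] by simp
    finally show "cost P t (bdec l t z) (trial l t) z + qk l (Suc t) (bdec l t z) + bslope l t z \<bullet> (y - trial l t)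
      + sconst P t z / 2 * (norm (y - trial l t))\<^sup>2 \<le> val t y z" .
  qed (auto simp: supp_def)
  then show ?case using l(2) rec_eq_sum_val[OF t1 Suc.prems(4)] by simp
qed

end

section \<open>Convergence of the approximations and of the forward decisions\<close>

lemma compact_continuous_bound:
  fixes f :: "'a::metric_space \<Rightarrow> real"
  assumes "compact S" "continuous_on S f"
  obtains M where "\<And>x. x \<in> S \<Longrightarrow> \<bar>f x\<bar> \<le> M"
proof -
  have "bounded (f ` S)" using assms compact_continuous_image compact_imp_bounded by blast
  then show ?thesis using that unfolding bounded_real by (metis image_eqI)
qed

context dasc_execution
begin

text \<open>
  The affine part of a cut minorizes the stage problem on a neighbourhood of \<open>\<X>\<^sub>t\<^sub>-\<^sub>1\<close> of fixed radius,
  where it is bounded above; since its value at the trial point is bounded below, its slope is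
  bounded.
\<close>

lemma bslope_bounded:
  assumes t: "t \<in> {2..horizon P}" and z: "z \<in> supp P t"
  obtains C where "\<And>k. 1 \<le> k \<Longrightarrow> norm (bslope k t z) \<le> C"
proof -
  have t1: "t \<in> {1..horizon P}" using t by simp
  let ?X = "decset P t" and ?Y = "decset P (t - 1)"
  obtain e where e: "0 < e" "e \<le> r"
    and ne: "\<And>z y. z \<in> supp P t \<Longrightarrow> y \<in> enlarge ?Y e \<Longrightarrow> feas P t y z \<noteq> {}"
    by (rule recourse_radius[OF t1]) (rule that; assumption)
  have cX: "compact ?X" "compact ?Y" using t by (auto intro!: decset_props(2))
  obtain M where M: "\<And>p. p \<in> ?X \<times> enlarge ?Y r \<Longrightarrow> \<bar>(\<lambda>(x, y). cost P t x y z) p\<bar> \<le> M"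
    by (rule compact_continuous_bound[OF compact_Times[OF cX(1) compact_enlarge[OF cX(2)]]
        continuous_cost[OF t1 z]]) (rule that; assumption)
  have cost_le: "\<bar>cost P t x y z\<bar> \<le> M" if "x \<in> ?X" "y \<in> enlarge ?Y r" for x y
    using M[of "(x, y)"] that by simp
  have "continuous_on ?X (rec (Suc t))" using continuous_rec[of "Suc t"] t by simp
  then obtain M2 where M2: "\<And>x. x \<in> ?X \<Longrightarrow> \<bar>rec (Suc t) x\<bar> \<le> M2"
    using compact_continuous_bound[OF cX(1)] by blast
  obtain M3 where M3: "\<And>x. x \<in> ?X \<Longrightarrow> \<bar>qk 1 (Suc t) x\<bar> \<le> M3"
  proof (cases "t = horizon P")
    case True
    then show ?thesis using that[of 0] by (simp add: approx_final)
  next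
    case False
    then have "qk 1 (Suc t) = cutr 1 (Suc t)" using t by (intro ext) (simp add: qk_eq_Max)
    then show ?thesis
      using compact_continuous_bound[OF cX(1) cutr_continuous[of ?X 1 "Suc t"]] that by metis
  qed
  have St: "Suc t \<in> {2..horizon P + 1}" using t by simp
  show ?thesis
  proof (rule that[of "(2 * M + M2 + M3) / e"])
    fix k :: nat assume k: "1 \<le> k"
    let ?b = "bslope k t z" and ?y = "trial k t" and ?x = "bdec k t z"
    have y: "?y \<in> ?Y" by (rule trial_in_decset[OF k t1])
    have yr: "?y \<in> enlarge ?Y r" using y r_pos by (auto intro: in_enlarge)
    have x: "?x \<in> ?X"
      by (rule backward_step[OF k t z]) (rule stage_opt_in_decset)
    \<comment> \<open>Move from the trial point by the distance \<open>e\<close> in the direction of the slope, where the cut grows fastest.\<close>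
    define y' where "y' = ?y + (e / norm ?b) *\<^sub>R ?b"
    have "norm (y' - ?y) \<le> e" using e by (simp add: y'_def)
    then have y': "y' \<in> enlarge ?Y e" using y by (rule in_enlarge[rotated])
    then have y'r: "y' \<in> enlarge ?Y r" using enlarge_mono[OF e(2)] by blast
    obtain x' where x': "x' \<in> feas P t y' z" using ne[OF z y'] by blast
    note x'X = feas_in_decset[OF x']
    have "e * norm ?b = ?b \<bullet> (y' - ?y)"
      by (simp add: y'_def dot_square_norm power2_eq_square)
    also have "\<dots> \<le> cost P t x' y' z + qk k (Suc t) x' - cost P t ?x ?y z - qk k (Suc t) ?x"
      using backward_bound(1)[OF k t z x' y'r] by simp
    also have "\<dots> \<le> M + M2 + M + M3"
      using cost_le[OF x'X y'r] cost_le[OF x yr] M2[OF x'X] M3[OF x] qk_mono[OF order_refl k St, of ?x]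
        qk_le_rec[OF k _ _ , of "Suc t" x'] x'X t by simp
    finally show "norm ?b \<le> (2 * M + M2 + M3) / e" using e by (simp add: field_simps)
  qed
qed

lemma qk_lipschitz:
  assumes t: "t \<in> {2..horizon P + 1}"
  obtains L where "L \<ge> 0" "\<And>k y y'. 1 \<le> k \<Longrightarrow> y \<in> decset P (t - 1) \<Longrightarrow> y' \<in> decset P (t - 1) \<Longrightarrow>
    \<bar>qk k t y - qk k t y'\<bar> \<le> L * norm (y - y')"
proof (cases "t = Suc (horizon P)")
  case True
  then show ?thesis using that[of 0] by (simp add: approx_final)
next
  case False
  then have t: "t \<in> {2..horizon P}" and t1: "t \<in> {1..horizon P}" using t by auto
  let ?Y = "decset P (t - 1)"
  have "\<exists>C. \<forall>z\<in>supp P t. \<forall>k\<ge>1. norm (bslope k t z) \<le> C z"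
    using bslope_bounded[OF t] by (intro bchoice) metis
  then obtain C where C: "\<And>z k. z \<in> supp P t \<Longrightarrow> 1 \<le> k \<Longrightarrow> norm (bslope k t z) \<le> C z"
    by blast
  have C0: "C z \<ge> 0" if "z \<in> supp P t" for z using C[OF that order_refl] norm_ge_zero order_trans by blast
  define D where "D = diameter ?Y"
  have bY: "bounded ?Y" using t by (auto intro!: compact_imp_bounded decset_props(2))
  have D: "norm (y' - y) \<le> D" if "y \<in> ?Y" "y' \<in> ?Y" for y y'
    using diameter_bounded_bound[OF bY that(2,1)] by (simp add: D_def dist_norm)
  have D0: "D \<ge> 0" unfolding D_def by (rule diameter_ge_0[OF bY])
  define L where "L = (\<Sum>z\<in>supp P t. pr P t z * (C z + sconst P t z * D))"
  have L0: "L \<ge> 0"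
    unfolding L_def using C0 D0 strongly_convex_cost(1)[OF t1] pr_pos
    by (intro sum_nonneg mult_nonneg_nonneg add_nonneg_nonneg) (auto simp: less_imp_le)
  have cut_lip: "cutr k t y \<le> cutr k t y' + L * norm (y - y')"
    if k: "1 \<le> k" and y: "y \<in> ?Y" "y' \<in> ?Y" for k y y'
  proof -
    let ?h = "\<lambda>z y. cost P t (bdec k t z) (trial k t) z + qk k (Suc t) (bdec k t z)
       + bslope k t z \<bullet> (y - trial k t) + sconst P t z / 2 * (norm (y - trial k t))\<^sup>2"
    let ?v = "trial k t"
    have v: "?v \<in> ?Y" by (rule trial_in_decset[OF k t1])
    have "(norm (y - ?v))\<^sup>2 - (norm (y' - ?v))\<^sup>2
        = (norm (y - ?v) - norm (y' - ?v)) * (norm (y - ?v) + norm (y' - ?v))"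
      by (simp add: power2_eq_square algebra_simps)
    also have "\<dots> \<le> norm (y - y') * (norm (y - ?v) + norm (y' - ?v))"
      using norm_triangle_ineq2[of "y - ?v" "y' - ?v"] by (intro mult_right_mono) auto
    also have "\<dots> \<le> norm (y - y') * (2 * D)"
      using D[OF v y(1)] D[OF v y(2)] by (intro mult_left_mono) auto
    finally have sq: "(norm (y - ?v))\<^sup>2 - (norm (y' - ?v))\<^sup>2 \<le> norm (y - y') * (2 * D)" .
    have "?h z y \<le> ?h z y' + (C z + sconst P t z * D) * norm (y - y')" if z: "z \<in> supp P t" for z
    proof -
      have "bslope k t z \<bullet> (y - y') \<le> norm (bslope k t z) * norm (y - y')"
        by (rule norm_cauchy_schwarz)
      also have "\<dots> \<le> C z * norm (y - y')" using C[OF z k] by (intro mult_right_mono) auto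
      finally have 1: "bslope k t z \<bullet> (y - y') \<le> C z * norm (y - y')" .
      have 2: "sconst P t z / 2 * ((norm (y - ?v))\<^sup>2 - (norm (y' - ?v))\<^sup>2)
          \<le> sconst P t z / 2 * (norm (y - y') * (2 * D))"
        using sq strongly_convex_cost(1)[OF t1 z] by (intro mult_left_mono) auto
      show ?thesis using 1 2 by (simp add: inner_diff_right right_diff_distrib distrib_left algebra_simps)
    qed
    then have "(\<Sum>z\<in>supp P t. pr P t z * ?h z y) \<le>
        (\<Sum>z\<in>supp P t. pr P t z * (?h z y' + (C z + sconst P t z * D) * norm (y - y')))"
      by (intro sum_mono mult_left_mono) (auto simp: supp_def)
    also have "\<dots> = cutr k t y' + L * norm (y - y')"
      unfolding cutr_def L_def sum_distrib_right sum.distrib[symmetric]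
      by (intro sum.cong refl) (simp add: algebra_simps)
    finally show ?thesis unfolding cutr_def .
  qed
  have q_lip: "qk k t y \<le> qk k t y' + L * norm (y - y')"
    if k: "1 \<le> k" and y: "y \<in> ?Y" "y' \<in> ?Y" for k y y'
  proof -
    obtain l where l: "1 \<le> l" "l \<le> k" "qk k t y = cutr l t y" by (rule qk_attained[OF k t])
    then show ?thesis using cut_lip[OF l(1) y] cutr_le_qk[OF l(1,2) t, of y'] by simp
  qed
  show ?thesis
  proof (rule that[OF L0])
    fix k :: nat and y y' assume "1 \<le> k" "y \<in> ?Y" "y' \<in> ?Y"
    then show "\<bar>qk k t y - qk k t y'\<bar> \<le> L * norm (y - y')"
      using q_lip[of k y y'] q_lip[of k y' y] by (simp add: norm_minus_commute abs_le_iff)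
  qed
qed

definition qlim :: "nat \<Rightarrow> real ^ 'n \<Rightarrow> real"
  where "qlim t y = (SUP k. qk (Suc k) t y)"

lemma qlim_tendsto:
  assumes t: "t \<in> {2..horizon P + 1}" and y: "y \<in> decset P (t - 1)"
  shows "(\<lambda>k. qk (Suc k) t y) \<longlonglongrightarrow> qlim t y"
  unfolding qlim_def
proof (rule LIMSEQ_incseq_SUP)
  show "bdd_above (range (\<lambda>k. qk (Suc k) t y))"
    using qk_le_rec[of _ t y] t y by (intro bdd_aboveI[of _ "rec t y"]) auto
  show "incseq (\<lambda>k. qk (Suc k) t y)"
    using t by (intro incseq_SucI qk_mono) auto
qed

lemma qlim_le_rec:
  assumes t: "t \<in> {2..horizon P + 1}" and y: "y \<in> decset P (t - 1)"
  shows "qlim t y \<le> rec t y"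
  by (rule LIMSEQ_le_const2[OF qlim_tendsto[OF assms]]) (use qk_le_rec t y in auto)

text \<open>By equicontinuity, the monotone limit is attained along moving arguments as well.\<close>

lemma qk_tendsto_moving:
  assumes t: "t \<in> {2..horizon P + 1}" and \<sigma>: "strict_mono \<sigma>"
    and w: "\<And>j. w j \<in> decset P (t - 1)" "w \<longlonglongrightarrow> y" and y: "y \<in> decset P (t - 1)"
  shows "(\<lambda>j. qk (Suc (\<sigma> j)) t (w j)) \<longlonglongrightarrow> qlim t y"
proof -
  obtain L where L: "L \<ge> 0" "\<And>k y y'. 1 \<le> k \<Longrightarrow> y \<in> decset P (t - 1) \<Longrightarrow> y' \<in> decset P (t - 1) \<Longrightarrow>
    \<bar>qk k t y - qk k t y'\<bar> \<le> L * norm (y - y')"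
    by (rule qk_lipschitz[OF t]) (rule that; assumption)
  have "(\<lambda>j. L * norm (w j - y)) \<longlonglongrightarrow> L * norm (y - y)"
    by (intro tendsto_intros w(2))
  then have lim: "(\<lambda>j. L * norm (w j - y)) \<longlonglongrightarrow> 0" by simp
  have "\<forall>j. norm (qk (Suc (\<sigma> j)) t (w j) - qk (Suc (\<sigma> j)) t y) \<le> L * norm (w j - y)"
    using L(2)[OF _ w(1) y] by simp
  from Lim_null_comparison[OF always_eventually[OF this] lim]
  have "(\<lambda>j. qk (Suc (\<sigma> j)) t (w j) - qk (Suc (\<sigma> j)) t y) \<longlonglongrightarrow> 0" .
  moreover have "(\<lambda>j. qk (Suc (\<sigma> j)) t y) \<longlonglongrightarrow> qlim t y"
    using LIMSEQ_subseq_LIMSEQ[OF qlim_tendsto[OF t y] \<sigma>] by (simp add: o_def)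
  ultimately have "(\<lambda>j. qk (Suc (\<sigma> j)) t (w j) - qk (Suc (\<sigma> j)) t y + qk (Suc (\<sigma> j)) t y)
      \<longlonglongrightarrow> 0 + qlim t y"
    by (rule tendsto_add)
  then show ?thesis by simp
qed

lemma qlim_convex:
  assumes t: "t \<in> {2..horizon P + 1}"
  shows "convex_on (decset P (t - 1)) (qlim t)"
proof -
  have conv: "convex (decset P (t - 1))" using t by (intro decset_props(1)) auto
  show ?thesis
    unfolding convex_on_def
  proof (intro conjI conv ballI allI impI)
    fix y y' and a b :: real
    assume y: "y \<in> decset P (t - 1)" "y' \<in> decset P (t - 1)" and ab: "0 \<le> a" "0 \<le> b" "a + b = 1"
    show "qlim t (a *\<^sub>R y + b *\<^sub>R y') \<le> a * qlim t y + b * qlim t y'"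
    proof (rule LIMSEQ_le)
      show "(\<lambda>k. qk (Suc k) t (a *\<^sub>R y + b *\<^sub>R y')) \<longlonglongrightarrow> qlim t (a *\<^sub>R y + b *\<^sub>R y')"
        using convexD[OF conv y ab] by (rule qlim_tendsto[OF t])
      show "(\<lambda>k. a * qk (Suc k) t y + b * qk (Suc k) t y') \<longlonglongrightarrow> a * qlim t y + b * qlim t y'"
        by (intro tendsto_intros qlim_tendsto t y)
      show "\<exists>N. \<forall>k\<ge>N. qk (Suc k) t (a *\<^sub>R y + b *\<^sub>R y') \<le> a * qk (Suc k) t y + b * qk (Suc k) t y'"
        using qk_convex[OF _ t ab] by auto
    qed
  qed
qed

lemma fwd_minimizes:
  assumes k: "2 \<le> k" and t: "t \<in> {1..horizon P}" and n: "n \<in> nodes P (t - 1)" and z: "z \<in> supp P t"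
  shows "fwd R k (n @ [z]) \<in> feas P t (fwd R k n) z"
    and "x \<in> feas P t (fwd R k n) z \<Longrightarrow>
      cost P t (fwd R k (n @ [z])) (fwd R k n) z + qk (k - 1) (Suc t) (fwd R k (n @ [z]))
        \<le> cost P t x (fwd R k n) z + qk (k - 1) (Suc t) x"
  using fwd_opt[OF _ t n z, of k] approx_Suc_eq[OF _ t, of "k - 1"] k
  by (auto simp: stage_opt_def stage_obj_def)

definition xlim :: "(real ^ 'k) list \<Rightarrow> real ^ 'n"
  where "xlim n = lim (\<lambda>k. fwd R k n)"

text \<open>
  One stage of the forward convergence. The minimization in iteration \<open>k + 2\<close> uses \<open>\<Q>\<^sup>k\<^sup>+\<^sup>1\<close>; the
  first iteration is left out since \<open>\<Q>\<^sup>0\<close> is \<open>-\<infinity>\<close> before the last stage.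
\<close>

lemma xlim_step:
  assumes t: "t \<in> {1..horizon P}" and n: "n \<in> nodes P (t - 1)" and z: "z \<in> supp P t"
    and conv: "(\<lambda>k. fwd R k n) \<longlonglongrightarrow> xlim n" and mem: "xlim n \<in> decset P (t - 1)"
  shows "(\<lambda>k. fwd R k (n @ [z])) \<longlonglongrightarrow> xlim (n @ [z])"
    and "xlim (n @ [z]) \<in> feas P t (xlim n) z"
    and "\<And>x. x \<in> feas P t (xlim n) z \<Longrightarrow>
      cost P t (xlim (n @ [z])) (xlim n) z + qlim (Suc t) (xlim (n @ [z]))
        \<le> cost P t x (xlim n) z + qlim (Suc t) x"
proof -
  have t2: "Suc t \<in> {2..horizon P + 1}" using t by simp
  let ?y = "\<lambda>k. fwd R (k + 2) n" and ?x = "xlim n"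
  have y: "?y k \<in> decset P (t - 1)" for k
    by (rule fwd_in_decset) (use t n in auto)
  have ylim: "?y \<longlonglongrightarrow> ?x" using conv by (rule LIMSEQ_ignore_initial_segment)
  have ysub: "(\<lambda>j. ?y (\<sigma> j)) \<longlonglongrightarrow> ?x" if "strict_mono \<sigma>" for \<sigma>
    using LIMSEQ_subseq_LIMSEQ[OF ylim that] by (simp add: o_def)
  have cX: "compact (decset P t)" using t by (intro decset_props(2)) auto
  obtain L where L: "L \<ge> 0" "\<And>z y y' x. z \<in> supp P t \<Longrightarrow> y \<in> decset P (t - 1) \<Longrightarrow>
    y' \<in> decset P (t - 1) \<Longrightarrow> x \<in> feas P t y z \<Longrightarrow> \<exists>x'\<in>feas P t y' z. norm (x' - x) \<le> L * norm (y' - y)"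
    by (rule feas_lipschitz[OF t]) (rule that; assumption)
  obtain a where a: "(\<lambda>k. fwd R (k + 2) (n @ [z])) \<longlonglongrightarrow> a" "a \<in> feas P t ?x z"
    "\<And>x. x \<in> feas P t ?x z \<Longrightarrow> cost P t a ?x z + qlim (Suc t) a \<le> cost P t x ?x z + qlim (Suc t) x"
  proof (rule argmin_tendsto[where X = "decset P t" and \<Phi> = "\<lambda>k. feas P t (?y k) z"
        and \<Phi>' = "feas P t ?x z" and u = "\<lambda>k. fwd R (k + 2) (n @ [z])"
        and F = "\<lambda>k x. cost P t x (?y k) z + qk (Suc k) (Suc t) x"
        and F' = "\<lambda>x. cost P t x ?x z + qlim (Suc t) x"])
    show "fwd R (k + 2) (n @ [z]) \<in> feas P t (?y k) z" for k
      using fwd_minimizes(1)[OF _ t n z, of "k + 2"] by simp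
    show "cost P t (fwd R (k + 2) (n @ [z])) (?y k) z + qk (Suc k) (Suc t) (fwd R (k + 2) (n @ [z]))
      \<le> cost P t x (?y k) z + qk (Suc k) (Suc t) x" if "x \<in> feas P t (?y k) z" for k x
      using fwd_minimizes(2)[OF _ t n z, of "k + 2" x] that by simp
    show "l \<in> feas P t ?x z"
      if "strict_mono \<sigma>" "\<And>j. w j \<in> feas P t (?y (\<sigma> j)) z" "w \<longlonglongrightarrow> l" for \<sigma> w l
      by (rule feas_closed[OF t z that(2) y that(3) ysub[OF that(1)]])
    show "\<exists>w. (\<forall>k. w k \<in> feas P t (?y k) z) \<and> w \<longlonglongrightarrow> x" if "x \<in> feas P t ?x z" for x
    proof -
      have "\<forall>k. \<exists>x'\<in>feas P t (?y k) z. norm (x' - x) \<le> L * norm (?y k - ?x)"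
        using L(2)[OF z mem y that] by blast
      then obtain w where w: "\<And>k. w k \<in> feas P t (?y k) z" "\<And>k. norm (w k - x) \<le> L * norm (?y k - ?x)"
        by metis
      have "(\<lambda>k. L * norm (?y k - ?x)) \<longlonglongrightarrow> L * norm (?x - ?x)"
        by (intro tendsto_intros ylim)
      then have lim: "(\<lambda>k. L * norm (?y k - ?x)) \<longlonglongrightarrow> 0" by simp
      have "\<forall>k. norm (w k - x) \<le> L * norm (?y k - ?x)" using w(2) by simp
      from Lim_null_comparison[OF always_eventually[OF this] lim] have "(\<lambda>k. w k - x) \<longlonglongrightarrow> 0" .
      then show ?thesis using w(1) by (intro exI[of _ w]) (simp add: LIM_zero_iff)
    qed
    show "(\<lambda>j. cost P t (w j) (?y (\<sigma> j)) z + qk (Suc (\<sigma> j)) (Suc t) (w j))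
        \<longlonglongrightarrow> cost P t l ?x z + qlim (Suc t) l"
      if "strict_mono \<sigma>" "\<And>j. w j \<in> decset P t" "w \<longlonglongrightarrow> l" "l \<in> decset P t" for \<sigma> w l
      using that mem
      by (intro tendsto_add tendsto_cost[OF t z] y ysub qk_tendsto_moving[OF t2]) auto
    show "x = x'" if x: "x \<in> feas P t ?x z" "x' \<in> feas P t ?x z"
      "\<And>w. w \<in> feas P t ?x z \<Longrightarrow> cost P t x ?x z + qlim (Suc t) x \<le> cost P t w ?x z + qlim (Suc t) w"
      "\<And>w. w \<in> feas P t ?x z \<Longrightarrow> cost P t x' ?x z + qlim (Suc t) x' \<le> cost P t w ?x z + qlim (Suc t) w"
      for x x'
    proof (rule minimizer_unique_if_strongly_convex[where F = "\<lambda>x. cost P t x ?x z"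
          and q = "qlim (Suc t)" and S = "decset P t" and a = "sconst P t z" and C = "feas P t ?x z"])
      show "strongly_convex_on (decset P t) (\<lambda>x. cost P t x ?x z) (sconst P t z)"
        unfolding strongly_convex_on_def
      proof (intro ballI)
        fix u v and s :: real assume uv: "u \<in> decset P t" "v \<in> decset P t" "s \<in> {0..1}"
        have "s *\<^sub>R ?x + (1 - s) *\<^sub>R ?x = ?x" by (simp flip: scaleR_add_left)
        then show "cost P t (s *\<^sub>R u + (1 - s) *\<^sub>R v) ?x z \<le> s * cost P t u ?x z + (1 - s) * cost P t v ?x z
            - sconst P t z * s * (1 - s) / 2 * (norm (v - u))\<^sup>2"
          using strongly_convex_cost(2)[OF t z, unfolded strongly_convex_on_def, rule_format,
              of "(u, ?x)" "(v, ?x)" s] uv mem by (simp add: norm_Pair)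
      qed
      show "convex_on (decset P t) (qlim (Suc t))" using qlim_convex[OF t2] by simp
    qed (use x strongly_convex_cost(1)[OF t z] convex_feas[OF t z mem] in \<open>auto intro: feas_in_decset\<close>)
  qed (use cX that in \<open>auto intro: feas_in_decset\<close>)
  have conv': "(\<lambda>k. fwd R k (n @ [z])) \<longlonglongrightarrow> a" using a(1) by (rule LIMSEQ_offset)
  then have "xlim (n @ [z]) = a" unfolding xlim_def by (rule limI)
  then show "(\<lambda>k. fwd R k (n @ [z])) \<longlonglongrightarrow> xlim (n @ [z])" "xlim (n @ [z]) \<in> feas P t ?x z"
    "\<And>x. x \<in> feas P t (xlim n) z \<Longrightarrow>
      cost P t (xlim (n @ [z])) (xlim n) z + qlim (Suc t) (xlim (n @ [z]))
        \<le> cost P t x (xlim n) z + qlim (Suc t) x"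
    using conv' a(2,3) by auto
qed

lemma fwd_tendsto:
  assumes "t \<le> horizon P" "n \<in> nodes P t"
  shows "(\<lambda>k. fwd R k n) \<longlonglongrightarrow> xlim n \<and> xlim n \<in> decset P t"
  using assms
proof (induction t arbitrary: n)
  case 0
  have "eventually (\<lambda>k. fwd R k [] = init P) sequentially"
    using fwd_root by (auto simp: eventually_sequentially)
  then have "(\<lambda>k. fwd R k []) \<longlonglongrightarrow> init P" by (rule tendsto_eventually)
  moreover from this have "xlim [] = init P" unfolding xlim_def by (rule limI)
  ultimately show ?case using 0 by (simp add: decset_def)
next
  case (Suc t)
  then obtain m z where n: "n = m @ [z]" and m: "m \<in> nodes P t" and z: "z \<in> supp P (Suc t)"
    using node_cases by blast
  have IH: "(\<lambda>k. fwd R k m) \<longlonglongrightarrow> xlim m" "xlim m \<in> decset P t"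
    using Suc.IH[OF _ m] Suc.prems(1) by auto
  show ?case
    using xlim_step(1,2)[of "Suc t" m z] feas_in_decset Suc.prems(1) m z IH by (auto simp: n)
qed

lemma xlim_root: "xlim [] = init P"
  using fwd_tendsto[of 0 "[]"] by (simp add: decset_def)

lemma xlim_minimizes:
  assumes t: "t \<in> {1..horizon P}" and n: "n \<in> nodes P (t - 1)" and z: "z \<in> supp P t"
  shows "xlim (n @ [z]) \<in> feas P t (xlim n) z"
    and "x \<in> feas P t (xlim n) z \<Longrightarrow>
      cost P t (xlim (n @ [z])) (xlim n) z + qlim (Suc t) (xlim (n @ [z]))
        \<le> cost P t x (xlim n) z + qlim (Suc t) x"
proof -
  have "(\<lambda>k. fwd R k n) \<longlonglongrightarrow> xlim n" "xlim n \<in> decset P (t - 1)"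
    using fwd_tendsto[of "t - 1" n] t n by auto
  from xlim_step[OF t n z this] show "xlim (n @ [z]) \<in> feas P t (xlim n) z"
    "x \<in> feas P t (xlim n) z \<Longrightarrow>
      cost P t (xlim (n @ [z])) (xlim n) z + qlim (Suc t) (xlim (n @ [z]))
        \<le> cost P t x (xlim n) z + qlim (Suc t) x" by auto
qed

end

section \<open>Exactness of the limit at the limit decisions\<close>

lemma ereal_real_diff_tendsto_0:
  assumes "(\<lambda>k. a k - b k) \<longlonglongrightarrow> (0::real)"
    and "eventually (\<lambda>k. A k = ereal (a k) \<and> B k = ereal (b k)) sequentially"
  shows "(\<lambda>k. A k - B k) \<longlonglongrightarrow> 0"
proof -
  have "(\<lambda>k. ereal (a k - b k)) \<longlonglongrightarrow> ereal 0" using assms(1) by simp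
  moreover have "eventually (\<lambda>k. ereal (a k - b k) = A k - B k) sequentially"
    using assms(2) by eventually_elim simp
  ultimately show ?thesis unfolding zero_ereal_def by (rule Lim_transform_eventually)
qed

locale dasc_exhaustive = dasc_execution P r \<omega> R
  for P :: "('w, 'n::finite, 'k::finite, 'q::finite, 'p::finite) msp" and r :: real
    and \<omega> :: "nat \<Rightarrow> nat \<Rightarrow> real ^ 'k" and R :: "('n, 'k, 'q, 'p) dasc_run" +
  assumes exhaustive: "\<And>t n. t \<in> {1..horizon P} \<Longrightarrow> n \<in> nodes P t \<Longrightarrow>
    infinite {k. sampled_node P \<omega> k t = n}"
begin

text \<open>
  Let \<open>k\<close> run through the iterations sampling \<open>n\<close>. There
  \<open>\<Q>\<^sub>t\<^sup>k(x\<^sub>n\<^sup>k) \<ge> \<Sum>\<^sub>z p\<^sub>z (f\<^sub>t(x\<^sub>m\<^sup>k, x\<^sub>n\<^sup>k, z) + \<Q>\<^sub>t\<^sub>+\<^sub>1\<^bsup>k-1\<^esup>(x\<^sub>m\<^sup>k))\<close>, as the cut is exact at its own trial point, the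
  approximations increase and the forward decisions \<open>x\<^sub>m\<^sup>k\<close> are optimal for \<open>\<Q>\<^sub>t\<^sub>+\<^sub>1\<^bsup>k-1\<^esup>\<close>. In the limit the
  right-hand side becomes, by the induction hypothesis, the cost of feasible decisions with the
  exact continuation, hence is at least \<open>\<Q>\<^sub>t(x\<^sub>n\<^sup>\<infinity>)\<close>.
\<close>

lemma qlim_exact:
  assumes "2 \<le> t" "t \<le> horizon P + 1" "n \<in> nodes P (t - 1)"
  shows "qlim t (xlim n) = rec t (xlim n)"
  using assms
proof (induction "horizon P + 1 - t" arbitrary: t n)
  case 0
  then have "t = Suc (horizon P)" by simp
  then show ?case by (simp add: qlim_def approx_final rec_final)
next
  case (Suc d)
  then have t: "t \<in> {2..horizon P}" and t1: "t \<in> {1..horizon P}" and t2: "t \<in> {2..horizon P + 1}"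
    and t2': "Suc t \<in> {2..horizon P + 1}" by simp_all
  note n = Suc.prems(3)
  have IH: "qlim (Suc t) (xlim m) = rec (Suc t) (xlim m)" if "m \<in> nodes P t" for m
    using Suc.hyps(1)[of "Suc t" m] Suc.hyps(2) t that by simp
  have child: "n @ [z] \<in> nodes P t" if "z \<in> supp P t" for z
    using node_snoc[of n z P "t - 1"] n that t by simp
  have xn: "(\<lambda>k. fwd R k n) \<longlonglongrightarrow> xlim n" "xlim n \<in> decset P (t - 1)"
    using fwd_tendsto[of "t - 1" n] t n by auto
  have xc: "(\<lambda>k. fwd R k (n @ [z])) \<longlonglongrightarrow> xlim (n @ [z])" "xlim (n @ [z]) \<in> decset P t"
    if "z \<in> supp P t" for z
    using fwd_tendsto[of t "n @ [z]"] t child[OF that] by auto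
  \<comment> \<open>Enumerate these iterations, from the second on, as \<open>\<rho> j + 2\<close>, so that the approximation used in their forward pass has index \<open>\<rho> j + 1 \<ge> 1\<close>.\<close>
  have "infinite {k. sampled_node P \<omega> k (t - 1) = n}"
    by (rule exhaustive) (use t n in auto)
  then have "infinite ((\<lambda>k. k + 2) -` {k. sampled_node P \<omega> k (t - 1) = n})"
    unfolding infinite_nat_iff_unbounded_le
  proof (intro allI)
    fix N assume "\<forall>m. \<exists>k\<ge>m. k \<in> {k. sampled_node P \<omega> k (t - 1) = n}"
    then obtain k where k: "k \<ge> N + 2" "sampled_node P \<omega> k (t - 1) = n" by blast
    then have "k - 2 + 2 = k" "N \<le> k - 2" by simp_all
    then show "\<exists>k\<ge>N. k \<in> (\<lambda>k. k + 2) -` {k. sampled_node P \<omega> k (t - 1) = n}"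
      unfolding vimage_def mem_Collect_eq using k(2) by metis
  qed
  from infinite_enumerate[OF this]
  obtain \<rho> :: "nat \<Rightarrow> nat" where \<rho>: "strict_mono \<rho>" "\<And>j. sampled_node P \<omega> (\<rho> j + 2) (t - 1) = n"
    by auto
  have \<rho>2: "strict_mono (\<lambda>j. \<rho> j + 2)" "strict_mono (\<lambda>j. \<rho> j + 1)"
    using \<rho>(1) by (auto simp: strict_mono_def)
  have sub: "(\<lambda>j. fwd R (\<rho> j + 2) m) \<longlonglongrightarrow> xlim m" if "(\<lambda>k. fwd R k m) \<longlonglongrightarrow> xlim m" for m
    using LIMSEQ_subseq_LIMSEQ[OF that \<rho>2(1)] by (simp add: o_def)
  have mem: "fwd R (\<rho> j + 2) n \<in> decset P (t - 1)" for j
    by (rule fwd_in_decset) (use t n in auto)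
  have memc: "fwd R (\<rho> j + 2) (n @ [z]) \<in> decset P t" if "z \<in> supp P t" for j z
    by (rule fwd_in_decset) (use t child[OF that] in auto)
  let ?S = "\<lambda>j. \<Sum>z\<in>supp P t. pr P t z * (cost P t (fwd R (\<rho> j + 2) (n @ [z])) (fwd R (\<rho> j + 2) n) z
      + qk (Suc (\<rho> j)) (Suc t) (fwd R (\<rho> j + 2) (n @ [z])))"
  have le: "?S j \<le> qk (Suc (\<rho> j + 1)) t (fwd R (\<rho> j + 2) n)" for j
  proof -
    let ?k = "\<rho> j + 2"
    have tr: "trial ?k t = fwd R ?k n" using \<rho>(2)[of j] unfolding trial_def by (rule arg_cong)
    have tr': "trial (Suc (Suc (\<rho> j))) t = fwd R (Suc (Suc (\<rho> j))) n" using tr by simp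
    have "?S j \<le> (\<Sum>z\<in>supp P t. pr P t z * (cost P t (bdec ?k t z) (trial ?k t) z
        + qk ?k (Suc t) (bdec ?k t z)))"
    proof (intro sum_mono mult_left_mono)
      fix z assume z: "z \<in> supp P t"
      obtain l u where "stage_opt P t (approx P \<omega> R ?k (Suc t)) (trial ?k t) z (bdec ?k t z)"
        using backward_step[OF _ t z, of ?k] by auto
      then have "bdec ?k t z \<in> feas P t (fwd R ?k n) z" by (simp add: stage_opt_def tr')
      from fwd_minimizes(2)[OF _ t1 n z this]
      have "cost P t (fwd R ?k (n @ [z])) (fwd R ?k n) z + qk (Suc (\<rho> j)) (Suc t) (fwd R ?k (n @ [z]))
        \<le> cost P t (bdec ?k t z) (fwd R ?k n) z + qk (Suc (\<rho> j)) (Suc t) (bdec ?k t z)" by simp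
      also have "\<dots> \<le> cost P t (bdec ?k t z) (trial ?k t) z + qk ?k (Suc t) (bdec ?k t z)"
        using qk_mono[OF _ _ t2', of "Suc (\<rho> j)" ?k] by (simp add: tr')
      finally show "cost P t (fwd R ?k (n @ [z])) (fwd R ?k n) z + qk (Suc (\<rho> j)) (Suc t) (fwd R ?k (n @ [z]))
        \<le> cost P t (bdec ?k t z) (trial ?k t) z + qk ?k (Suc t) (bdec ?k t z)" .
    qed (auto simp: supp_def)
    also have "\<dots> = cutr ?k t (fwd R ?k n)" by (simp add: cutr_def tr')
    also have "\<dots> \<le> qk ?k t (fwd R ?k n)" by (rule cutr_le_qk) (use t in auto)
    finally show ?thesis by simp
  qed
  have "rec t (xlim n) = (\<Sum>z\<in>supp P t. pr P t z * val t (xlim n) z)"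
    by (rule rec_eq_sum_val[OF t1 xn(2)])
  also have "\<dots> \<le> (\<Sum>z\<in>supp P t. pr P t z *
      (cost P t (xlim (n @ [z])) (xlim n) z + qlim (Suc t) (xlim (n @ [z]))))"
    using IH child val_le[OF t1 _ xn(2) xlim_minimizes(1)[OF t1 n]]
    by (intro sum_mono mult_left_mono) (auto simp: supp_def)
  also have "\<dots> \<le> qlim t (xlim n)"
  proof (rule LIMSEQ_le)
    show "?S \<longlonglongrightarrow> (\<Sum>z\<in>supp P t. pr P t z *
        (cost P t (xlim (n @ [z])) (xlim n) z + qlim (Suc t) (xlim (n @ [z]))))"
    proof (intro tendsto_sum tendsto_mult tendsto_const tendsto_add)
      fix z assume z: "z \<in> supp P t"
      show "(\<lambda>j. cost P t (fwd R (\<rho> j + 2) (n @ [z])) (fwd R (\<rho> j + 2) n) z)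
          \<longlonglongrightarrow> cost P t (xlim (n @ [z])) (xlim n) z"
        by (rule tendsto_cost[OF t1 z memc[OF z] mem sub[OF xc(1)[OF z]] sub[OF xn(1)] xc(2)[OF z] xn(2)])
      show "(\<lambda>j. qk (Suc (\<rho> j)) (Suc t) (fwd R (\<rho> j + 2) (n @ [z]))) \<longlonglongrightarrow> qlim (Suc t) (xlim (n @ [z]))"
        by (rule qk_tendsto_moving[OF t2' \<rho>(1)]) (use memc[OF z] sub[OF xc(1)[OF z]] xc(2)[OF z] in auto)
    qed
    show "(\<lambda>j. qk (Suc (\<rho> j + 1)) t (fwd R (\<rho> j + 2) n)) \<longlonglongrightarrow> qlim t (xlim n)"
      by (rule qk_tendsto_moving[OF t2 \<rho>2(2) mem sub[OF xn(1)] xn(2)])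
    show "\<exists>N. \<forall>j\<ge>N. ?S j \<le> qk (Suc (\<rho> j + 1)) t (fwd R (\<rho> j + 2) n)" using le by blast
  qed
  finally show ?case using qlim_le_rec[OF t2 xn(2)] by simp
qed

text \<open>
  A minimizer of a lower bound at which the bound is tight is a minimizer.
\<close>

lemma xlim_stage_opt:
  assumes t: "t \<in> {1..horizon P}" and n: "n \<in> nodes P (t - 1)" and z: "z \<in> supp P t"
  shows "stage_opt P t (recourse P (Suc t)) (xlim n) z (xlim (n @ [z]))"
proof -
  have child: "n @ [z] \<in> nodes P t" using node_snoc[of n z P "t - 1"] n z t by simp
  have feas: "xlim (n @ [z]) \<in> feas P t (xlim n) z" by (rule xlim_minimizes(1)[OF t n z])
  have exact: "qlim (Suc t) (xlim (n @ [z])) = rec (Suc t) (xlim (n @ [z]))"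
    using qlim_exact[of "Suc t" "n @ [z]"] t child by simp
  have "cost P t (xlim (n @ [z])) (xlim n) z + rec (Suc t) (xlim (n @ [z]))
      \<le> cost P t x (xlim n) z + rec (Suc t) x" if x: "x \<in> feas P t (xlim n) z" for x
    using xlim_minimizes(2)[OF t n z x] qlim_le_rec[of "Suc t" x] feas_in_decset[OF x] t exact by simp
  then show ?thesis
    using feas t by (auto simp: stage_opt_def stage_obj_def recourse_Suc_eq[OF _ feas_in_decset])
qed

theorem recourse_gap_tendsto_0:
  assumes t: "t \<in> {2..horizon P + 1}" and n: "n \<in> nodes P (t - 1)"
  shows "(\<lambda>k. recourse P t (fwd R k n) - approx P \<omega> R k t (fwd R k n)) \<longlonglongrightarrow> 0"
proof (rule ereal_real_diff_tendsto_0)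
  have t1: "t \<in> {1..horizon P + 1}" using t by simp
  have mem: "fwd R k n \<in> decset P (t - 1)" if "1 \<le> k" for k
    by (rule fwd_in_decset[OF that]) (use t n in auto)
  have xn: "(\<lambda>k. fwd R k n) \<longlonglongrightarrow> xlim n" "xlim n \<in> decset P (t - 1)"
    using fwd_tendsto[of "t - 1" n] t n by auto
  show "eventually (\<lambda>k. recourse P t (fwd R k n) = ereal (rec t (fwd R k n)) \<and>
      approx P \<omega> R k t (fwd R k n) = ereal (qk k t (fwd R k n))) sequentially"
    using eventually_ge_at_top[of 1]
    by eventually_elim (use recourse_eq[OF t1 mem] approx_eq[OF _ t] in auto)
  have S: "(\<lambda>k. fwd R (Suc k) n) \<longlonglongrightarrow> xlim n" using LIMSEQ_Suc[OF xn(1)] .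
  have mem_Suc: "fwd R (Suc k) n \<in> decset P (t - 1)" for k by (rule mem) simp
  have "(\<lambda>k. rec t (fwd R (Suc k) n)) \<longlonglongrightarrow> rec t (xlim n)"
    using mem_Suc by (intro continuous_on_tendsto_compose[OF continuous_rec[OF t1] S xn(2)]) simp
  moreover have "(\<lambda>k. qk (Suc k) t (fwd R (Suc k) n)) \<longlonglongrightarrow> qlim t (xlim n)"
    using qk_tendsto_moving[OF t strict_mono_id mem_Suc S xn(2)] by simp
  ultimately have "(\<lambda>k. rec t (fwd R (Suc k) n) - qk (Suc k) t (fwd R (Suc k) n)) \<longlonglongrightarrow>
      rec t (xlim n) - qlim t (xlim n)"
    by (rule tendsto_diff)
  then have "(\<lambda>k. rec t (fwd R (Suc k) n) - qk (Suc k) t (fwd R (Suc k) n)) \<longlonglongrightarrow> 0"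
    using qlim_exact t n by simp
  then show "(\<lambda>k. rec t (fwd R k n) - qk k t (fwd R k n)) \<longlonglongrightarrow> 0"
    by (rule LIMSEQ_imp_Suc)
qed

lemma first_stage:
  "xi1 P \<in> supp P 1" "[xi1 P] \<in> nodes P 1" "recourse P 1 (init P) = ereal (val 1 (init P) (xi1 P))"
proof -
  show z: "xi1 P \<in> supp P 1" by (simp only: supp_1 singletonI)
  then show "[xi1 P] \<in> nodes P 1" by (simp add: nodes_def)
  have "init P \<in> decset P (1 - 1)" by (simp add: decset_def)
  from rec_eq_sum_val[OF _ this] recourse_eq[OF _ this] horizon_pos
  show "recourse P 1 (init P) = ereal (val 1 (init P) (xi1 P))"
    by (simp only: supp_1 pr_1) simp
qed

theorem first_stage_value_tendsto:
  "(\<lambda>k. stage_obj P 1 (approx P \<omega> R (k - 1) 2) (fwd R k [xi1 P]) (init P) (xi1 P))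
     \<longlonglongrightarrow> recourse P 1 (init P)" (is "?f \<longlonglongrightarrow> _")
  "(\<lambda>k. stage_val P 1 (approx P \<omega> R k 2) (init P) (xi1 P)) \<longlonglongrightarrow> recourse P 1 (init P)"
proof -
  note z = first_stage(1)
  have 1: "1 \<in> {1..horizon P}" using horizon_pos by simp
  have 2: "Suc 1 \<in> {2..horizon P + 1}" using horizon_pos by simp
  let ?n = "[xi1 P]"
  have root: "[] \<in> nodes P (1 - 1)" by simp
  have xn: "(\<lambda>k. fwd R k ?n) \<longlonglongrightarrow> xlim ?n" "xlim ?n \<in> decset P 1"
    using fwd_tendsto[OF horizon_pos first_stage(2)] by auto
  have S: "(\<lambda>k. fwd R (k + 2) ?n) \<longlonglongrightarrow> xlim ?n" using xn(1) by (rule LIMSEQ_ignore_initial_segment)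
  have mem: "fwd R (k + 2) ?n \<in> decset P 1" for k
    by (rule fwd_in_decset[OF _ horizon_pos first_stage(2)]) simp
  have val: "val 1 (init P) (xi1 P) = cost P 1 (xlim ?n) (init P) (xi1 P) + qlim (Suc 1) (xlim ?n)"
    using val_eq(2)[OF 1 xlim_stage_opt[OF 1 root z, unfolded xlim_root append_Nil]]
      qlim_exact[of "Suc 1" ?n] horizon_pos first_stage(2) by simp
  have "(\<lambda>k. cost P 1 (fwd R (k + 2) ?n) (init P) (xi1 P) + qk (Suc k) (Suc 1) (fwd R (k + 2) ?n))
      \<longlonglongrightarrow> cost P 1 (xlim ?n) (init P) (xi1 P) + qlim (Suc 1) (xlim ?n)"
  proof (rule tendsto_add)
    show "(\<lambda>k. cost P 1 (fwd R (k + 2) ?n) (init P) (xi1 P)) \<longlonglongrightarrow> cost P 1 (xlim ?n) (init P) (xi1 P)"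
      by (rule tendsto_cost[OF 1 z mem _ S tendsto_const xn(2)]) (simp_all add: decset_def)
    show "(\<lambda>k. qk (Suc k) (Suc 1) (fwd R (k + 2) ?n)) \<longlonglongrightarrow> qlim (Suc 1) (xlim ?n)"
      using qk_tendsto_moving[OF 2 strict_mono_id, of "\<lambda>k. fwd R (k + 2) ?n" "xlim ?n"] mem S xn(2)
      by simp
  qed
  then have "(\<lambda>k. ereal (cost P 1 (fwd R (k + 2) ?n) (init P) (xi1 P) + qk (Suc k) (Suc 1) (fwd R (k + 2) ?n)))
      \<longlonglongrightarrow> recourse P 1 (init P)"
    unfolding first_stage(3) val by simp
  moreover have "?f (k + 2) = ereal (cost P 1 (fwd R (k + 2) ?n) (init P) (xi1 P) + qk (Suc k) (Suc 1) (fwd R (k + 2) ?n))" for k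
    using approx_Suc_eq[OF _ 1, of "Suc k"] by (simp add: stage_obj_def numeral_2_eq_2)
  ultimately have "(\<lambda>k. ?f (k + 2)) \<longlonglongrightarrow> recourse P 1 (init P)" by (simp only:)
  then show lim: "?f \<longlonglongrightarrow> recourse P 1 (init P)" by (rule LIMSEQ_offset)
  have "stage_val P 1 (approx P \<omega> R k 2) (init P) (xi1 P) = ?f (Suc k)" for k
    using stage_val_eq[OF fwd_opt[OF _ 1 root z, of "Suc k"]] fwd_root[of "Suc k"]
    by (simp add: numeral_2_eq_2)
  then show "(\<lambda>k. stage_val P 1 (approx P \<omega> R k 2) (init P) (xi1 P)) \<longlonglongrightarrow> recourse P 1 (init P)"
    using LIMSEQ_Suc[OF lim] by (simp only:)
qed

lemma accumulation_point_eq_xlim: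
  assumes "accumulation_point P R xs" "t \<le> horizon P" "n \<in> nodes P t"
  shows "xs n = xlim n"
proof -
  obtain \<sigma> :: "nat \<Rightarrow> nat" where \<sigma>: "strict_mono \<sigma>" "(\<lambda>j. fwd R (\<sigma> j) n) \<longlonglongrightarrow> xs n"
    using assms unfolding accumulation_point_def by blast
  have "(\<lambda>j. fwd R (\<sigma> j) n) \<longlonglongrightarrow> xlim n"
    using LIMSEQ_subseq_LIMSEQ[OF conjunct1[OF fwd_tendsto[OF assms(2,3)]] \<sigma>(1)] by (simp add: o_def)
  then show ?thesis using \<sigma>(2) LIMSEQ_unique by blast
qed

end

section \<open>Sampling every node infinitely often\<close>

text \<open>
  The event of missing \<open>E\<close> during \<open>K\<close> consecutive iterations has probability \<open>(1 - p)\<^sup>K\<close>, where \<open>p\<close> is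
  the probability of \<open>E\<close>; so missing it from some iteration on has probability \<open>0\<close>.
\<close>

lemma AE_iid_infinitely_often:
  assumes M: "prob_space M" and E: "E \<in> sets M" and pos: "measure M E > 0"
  shows "AE \<omega> in (\<Pi>\<^sub>M k\<in>{1::nat..}. M). infinite {k. 1 \<le> k \<and> \<omega> k \<in> E}"
proof -
  let ?S = "\<Pi>\<^sub>M k\<in>{1::nat..}. M"
  interpret M: prob_space M by fact
  interpret product_prob_space "\<lambda>_. M" "{1::nat..}" by unfold_locales
  define q where "q = measure M (space M - E)"
  have q: "0 \<le> q" "q < 1"
    using M.prob_compl[OF E] pos by (auto simp: q_def)
  define C where "C N K = {\<omega> \<in> space ?S. \<forall>k\<in>{N..<N + K}. \<omega> k \<in> space M - E}" for N K
  have C_sets: "C N K \<in> sets ?S" if "1 \<le> N" for N K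
  proof -
    have "(\<lambda>\<omega>. \<omega> k) -` (space M - E) \<inter> space ?S \<in> sets ?S"
      if "k \<in> {N..<N + K}" for k
    proof -
      have "k \<in> {1..}" using that \<open>1 \<le> N\<close> by simp
      then show ?thesis by (rule measurable_sets[OF measurable_component_singleton]) (use E in auto)
    qed
    then have "{\<omega> \<in> space ?S. \<omega> k \<in> space M - E} \<in> sets ?S"
      if "k \<in> {N..<N + K}" for k
      using that by (simp add: vimage_def Int_def conj_commute)
    then show ?thesis unfolding C_def by (intro sets.sets_Collect_finite_All) auto
  qed
  have C: "measure ?S (C N K) = q ^ K" if "1 \<le> N" for N K
  proof -
    have "emeasure ?S (C N K) = (\<Prod>k\<in>{N..<N + K}. emeasure M (space M - E))"
      unfolding C_def using E that by (intro emeasure_PiM_Collect) auto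
    also have "\<dots> = ennreal (q ^ K)" using q by (simp add: M.emeasure_eq_measure q_def ennreal_power)
    finally show ?thesis using q by (simp add: measure_def)
  qed
  have "AE \<omega> in ?S. \<forall>N\<ge>1. \<omega> \<notin> (\<Inter>K. C N K)"
    unfolding AE_all_countable
  proof (intro allI)
    fix N :: nat
    show "AE \<omega> in ?S. 1 \<le> N \<longrightarrow> \<omega> \<notin> (\<Inter>K. C N K)"
    proof (cases "1 \<le> N")
      case True
      have meas: "(\<Inter>K. C N K) \<in> P.events" using C_sets[OF True] by (intro sets.countable_INT) auto
      have "P.prob (\<Inter>K. C N K) \<le> q ^ K" for K
        unfolding C[OF True, of K, symmetric] by (intro P.finite_measure_mono INT_lower C_sets True) simp
      moreover have "(\<lambda>K. q ^ K) \<longlonglongrightarrow> 0" using q by (intro LIMSEQ_power_zero) simp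
      ultimately have "P.prob (\<Inter>K. C N K) \<le> 0" by (intro LIMSEQ_le_const) auto
      then have "P.prob (\<Inter>K. C N K) = 0" using measure_nonneg order_antisym by blast
      then show ?thesis using P.prob_eq_0[OF meas] by simp
    qed simp
  qed
  then show ?thesis
    using AE_space
  proof eventually_elim
    case (elim \<omega>)
    show ?case
    proof
      assume "finite {k. 1 \<le> k \<and> \<omega> k \<in> E}"
      then obtain N where N: "\<And>k. 1 \<le> k \<Longrightarrow> \<omega> k \<in> E \<Longrightarrow> k < N"
        using finite_nat_bounded[of "{k. 1 \<le> k \<and> \<omega> k \<in> E}"] by auto
      have "\<omega> \<in> C (Suc N) K" for K
      proof -
        have "\<omega> k \<in> space M - E" if k: "k \<in> {Suc N..<Suc N + K}" for k
        proof -
          have "\<omega> k \<in> space M" using elim(2) k by (auto simp: space_PiM PiE_iff)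
          then show ?thesis using N[of k] k by auto
        qed
        then show ?thesis unfolding C_def using elim(2) by blast
      qed
      then show False using elim(1) by auto
    qed
  qed
qed

context regular_msp
begin

definition hist :: "nat \<Rightarrow> 'w \<Rightarrow> (real ^ 'k) list"
  where "hist t w = map (\<lambda>s. xi P s w) [1..<Suc t]"

definition path_pr :: "(real ^ 'k) list \<Rightarrow> real"
  where "path_pr n = (\<Prod>i<length n. pr P (Suc i) (n ! i))"

lemma hist_0 [simp]: "hist 0 w = []"
  by (simp add: hist_def)

lemma hist_Suc: "hist (Suc t) w = hist t w @ [xi P (Suc t) w]"
  by (simp add: hist_def)

lemma hist_pred: "1 \<le> t \<Longrightarrow> hist t w = hist (t - 1) w @ [xi P t w]"
  using hist_Suc[of "t - 1" w] by simp

lemma length_hist [simp]: "length (hist t w) = t"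
  by (simp add: hist_def)

lemma hist_nth: "i < t \<Longrightarrow> hist t w ! i = xi P (Suc i) w"
  by (simp add: hist_def del: upt_Suc)

lemma hist_in_nodes: "w \<in> space (prb P) \<Longrightarrow> t \<le> horizon P \<Longrightarrow> hist t w \<in> nodes P t"
  using xi_in_supp by (simp add: nodes_def hist_nth)

lemma hist_eq_iff: "length n = t \<Longrightarrow> hist t w = n \<longleftrightarrow> (\<forall>i<t. xi P (Suc i) w = n ! i)"
  by (auto simp: list_eq_iff_nth_eq hist_nth)

lemma path_pr_Nil [simp]: "path_pr [] = 1"
  by (simp add: path_pr_def)

lemma path_pr_snoc: "path_pr (n @ [z]) = path_pr n * pr P (Suc (length n)) z"
  by (simp add: path_pr_def nth_append)

lemma path_pr_pos: "n \<in> nodes P t \<Longrightarrow> path_pr n > 0"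
  unfolding path_pr_def by (intro prod_pos) (auto simp: nodes_def supp_def)

lemma nodes_Suc: "nodes P (Suc t) = (\<lambda>(n, z). n @ [z]) ` (nodes P t \<times> supp P (Suc t))"
proof
  show "nodes P (Suc t) \<subseteq> (\<lambda>(n, z). n @ [z]) ` (nodes P t \<times> supp P (Suc t))"
  proof
    fix m assume "m \<in> nodes P (Suc t)"
    then obtain n z where "m = n @ [z]" "n \<in> nodes P t" "z \<in> supp P (Suc t)" by (rule node_cases)
    then show "m \<in> (\<lambda>(n, z). n @ [z]) ` (nodes P t \<times> supp P (Suc t))"
      by (intro image_eqI[of _ _ "(n, z)"]) auto
  qed
qed (auto simp: node_snoc)

lemma finite_nodes: "t \<le> horizon P \<Longrightarrow> finite (nodes P t)"
  by (induction t) (auto simp: nodes_Suc finite_supp)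

lemma sum_nodes_Suc:
  "(\<Sum>m\<in>nodes P (Suc t). f m) = (\<Sum>n\<in>nodes P t. \<Sum>z\<in>supp P (Suc t). f (n @ [z]))"
  unfolding nodes_Suc by (subst sum.reindex) (auto simp: inj_on_def sum.cartesian_product case_prod_beta)

lemma xi_event:
  assumes "t \<in> {1..horizon P}" shows "{w \<in> space (prb P). xi P t w = z} \<in> events"
  using measurable_sets[OF rv_xi[OF assms], of "{z}"] by (simp add: vimage_def Int_def conj_commute)

lemma hist_event:
  assumes "t \<le> horizon P"
  shows "{w \<in> space (prb P). hist t w = n} \<in> events"
proof (cases "length n = t")
  case True
  have "{w \<in> space (prb P). xi P (Suc i) w = n ! i} \<in> events" if "i < t" for i
    using xi_event[of "Suc i"] that assms by simp
  then have "{w \<in> space (prb P). \<forall>i\<in>{..<t}. xi P (Suc i) w = n ! i} \<in> events"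
    by (intro sets.sets_Collect_finite_All) auto
  moreover have "{w \<in> space (prb P). hist t w = n} =
      {w \<in> space (prb P). \<forall>i\<in>{..<t}. xi P (Suc i) w = n ! i}"
    using hist_eq_iff[OF True] by auto
  ultimately show ?thesis by (simp only:)
next
  case False
  then have "{w \<in> space (prb P). hist t w = n} = {}" by auto
  then show ?thesis by (simp only: sets.empty_sets)
qed

lemma prob_hist:
  assumes t: "t \<le> horizon P" and n: "length n = t"
  shows "prob {w \<in> space (prb P). hist t w = n} = path_pr n"
proof (cases "t = 0")
  case True
  then show ?thesis using n by (simp add: prob_space)
next
  case False
  have indep: "indep_vars (\<lambda>_. borel) (xi P) {1..horizon P}" using H0 by (simp add: H0_def)
  have "{w \<in> space (prb P). hist t w = n} = (\<Inter>s\<in>{1..t}. xi P s -` {n ! (s - 1)} \<inter> space (prb P))"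
  proof (intro set_eqI iffI)
    fix w assume "w \<in> (\<Inter>s\<in>{1..t}. xi P s -` {n ! (s - 1)} \<inter> space (prb P))"
    then have w: "\<And>s. s \<in> {1..t} \<Longrightarrow> xi P s w = n ! (s - 1) \<and> w \<in> space (prb P)" by blast
    have "xi P (Suc i) w = n ! i" if "i < t" for i using w[of "Suc i"] that by simp
    moreover have "w \<in> space (prb P)" using w[of 1] False by simp
    ultimately show "w \<in> {w \<in> space (prb P). hist t w = n}" by (simp add: hist_eq_iff[OF n])
  next
    fix w assume "w \<in> {w \<in> space (prb P). hist t w = n}"
    then have w: "w \<in> space (prb P)" "\<And>i. i < t \<Longrightarrow> xi P (Suc i) w = n ! i"
      by (auto simp: hist_eq_iff[OF n])
    have "xi P s w = n ! (s - 1)" if "s \<in> {1..t}" for s using w(2)[of "s - 1"] that by (cases s) auto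
    then show "w \<in> (\<Inter>s\<in>{1..t}. xi P s -` {n ! (s - 1)} \<inter> space (prb P))" using w(1) by simp
  qed
  also have "prob \<dots> = (\<Prod>s\<in>{1..t}. prob (xi P s -` {n ! (s - 1)} \<inter> space (prb P)))"
    using False t by (intro indep_varsD[OF indep]) auto
  also have "\<dots> = (\<Prod>s\<in>{1..t}. pr P s (n ! (s - 1)))"
    by (simp add: pr_def vimage_def Int_def conj_commute)
  also have "\<dots> = path_pr n"
    unfolding path_pr_def n by (rule prod.reindex_bij_witness[of _ Suc "\<lambda>s. s - 1"]) auto
  finally show ?thesis .
qed

lemma expectation_hist:
  fixes \<phi> :: "(real ^ 'k) list \<Rightarrow> real"
  assumes t: "t \<le> horizon P"
  shows "integrable (prb P) (\<lambda>w. \<phi> (hist t w))"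
    and "(\<integral>w. \<phi> (hist t w) \<partial>prb P) = (\<Sum>n\<in>nodes P t. path_pr n * \<phi> n)"
proof -
  let ?A = "\<lambda>n. {w \<in> space (prb P). hist t w = n}"
  have eq: "\<phi> (hist t w) = (\<Sum>n\<in>nodes P t. \<phi> n * indicator (?A n) w)" if "w \<in> space (prb P)" for w
  proof -
    have "(\<Sum>n\<in>nodes P t. \<phi> n * indicator (?A n) w) = (\<Sum>n\<in>nodes P t. if n = hist t w then \<phi> n else 0)"
      using that by (intro sum.cong) (auto simp: indicator_def)
    then show ?thesis using hist_in_nodes[OF that t] finite_nodes[OF t] by simp
  qed
  have int: "integrable (prb P) (\<lambda>w. \<phi> n * indicator (?A n) w)" for n
    using hist_event[OF t, of n] by (intro integrable_mult_right integrable_indicator) (auto simp: emeasure_eq_measure)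
  have "integrable (prb P) (\<lambda>w. \<Sum>n\<in>nodes P t. \<phi> n * indicator (?A n) w)"
    using int by (intro Bochner_Integration.integrable_sum)
  then show "integrable (prb P) (\<lambda>w. \<phi> (hist t w))"
    using eq by (simp cong: Bochner_Integration.integrable_cong)
  have "(\<integral>w. \<phi> (hist t w) \<partial>prb P) = (\<integral>w. (\<Sum>n\<in>nodes P t. \<phi> n * indicator (?A n) w) \<partial>prb P)"
    using eq by (intro Bochner_Integration.integral_cong) auto
  also have "\<dots> = (\<Sum>n\<in>nodes P t. \<phi> n * prob (?A n))"
    using int hist_event[OF t] by (subst Bochner_Integration.integral_sum) (auto simp: emeasure_eq_measure)
  also have "\<dots> = (\<Sum>n\<in>nodes P t. path_pr n * \<phi> n)"
    using prob_hist[OF t] length_node[of _ P t] by (intro sum.cong) auto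
  finally show "(\<integral>w. \<phi> (hist t w) \<partial>prb P) = (\<Sum>n\<in>nodes P t. path_pr n * \<phi> n)" .
qed

lemma scenario_law_map:
  "(\<lambda>w. \<lambda>t\<in>{2..horizon P}. xi P t w) \<in> prb P \<rightarrow>\<^sub>M (\<Pi>\<^sub>M t\<in>{2..horizon P}. count_space (supp P t))"
proof (rule measurable_restrict)
  fix t assume t: "t \<in> {2..horizon P}"
  then have t1: "t \<in> {1..horizon P}" by simp
  show "xi P t \<in> prb P \<rightarrow>\<^sub>M count_space (supp P t)"
    unfolding measurable_count_space_eq2[OF finite_supp[OF t1]]
    using xi_in_supp[OF t1] measurable_sets[OF rv_xi[OF t1]] by auto
qed

lemma prob_space_scenario_law: "prob_space (scenario_law P)"
  unfolding scenario_law_def by (rule prob_space_distr[OF scenario_law_map])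

lemma space_scenario_law: "space (scenario_law P) = (\<Pi>\<^sub>E t\<in>{2..horizon P}. supp P t)"
  by (simp add: scenario_law_def space_PiM)

text \<open>
  A node is sampled as soon as the scenario of the iteration passes through it. The probability of
  this is that of the history of the node, positive by interstage independence.
\<close>

lemma AE_samples:
  "AE \<omega> in sample_space P.
    (\<forall>k\<ge>1. \<forall>s\<in>{2..horizon P}. \<omega> k s \<in> supp P s) \<and>
    (\<forall>t\<in>{1..horizon P}. \<forall>n\<in>nodes P t. infinite {k. sampled_node P \<omega> k t = n})"
proof -
  have one: "AE \<omega> in sample_space P. infinite {k. sampled_node P \<omega> k t = n}"
    if t: "t \<in> {1..horizon P}" and n: "n \<in> nodes P t" for t n
  proof -
    let ?E = "{\<sigma> \<in> space (scenario_law P). \<forall>s\<in>{2..t}. \<sigma> s = n ! (s - 1)}"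
    have len: "length n = t" using n by (rule length_node)
    have "n ! 0 \<in> supp P 1" using n t by (auto simp: nodes_def)
    then have n0: "n ! 0 = xi1 P" using supp_1 by simp
    have "{\<sigma> \<in> space (scenario_law P). \<sigma> s = n ! (s - 1)} \<in> sets (scenario_law P)" if s: "s \<in> {2..t}" for s
    proof -
      have "(\<lambda>\<sigma>. \<sigma> s) \<in> (\<Pi>\<^sub>M t\<in>{2..horizon P}. count_space (supp P t)) \<rightarrow>\<^sub>M count_space (supp P s)"
        using s t by (intro measurable_component_singleton) auto
      moreover have "s - 1 < t" "Suc (s - 1) = s" using s by auto
      then have "n ! (s - 1) \<in> supp P s" using n by (auto simp: nodes_def dest: spec[of _ "s - 1"])
      ultimately have "(\<lambda>\<sigma>. \<sigma> s) -` {n ! (s - 1)} \<inter> space (\<Pi>\<^sub>M t\<in>{2..horizon P}. count_space (supp P t))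
          \<in> sets (\<Pi>\<^sub>M t\<in>{2..horizon P}. count_space (supp P t))"
        by (intro measurable_sets) auto
      then show ?thesis by (simp add: scenario_law_def vimage_def Int_def conj_commute)
    qed
    then have E: "?E \<in> sets (scenario_law P)" by (intro sets.sets_Collect_finite_All) auto
    have "measure (scenario_law P) ?E = prob ((\<lambda>w. \<lambda>t\<in>{2..horizon P}. xi P t w) -` ?E \<inter> space (prb P))"
      unfolding scenario_law_def
      by (rule measure_distr[OF scenario_law_map]) (use E in \<open>simp add: scenario_law_def\<close>)
    also have "(\<lambda>w. \<lambda>t\<in>{2..horizon P}. xi P t w) -` ?E \<inter> space (prb P) = {w \<in> space (prb P). hist t w = n}"
    proof (intro set_eqI iffI)
      fix w assume w: "w \<in> {w \<in> space (prb P). hist t w = n}"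
      then have eq: "xi P (Suc i) w = n ! i" if "i < t" for i using that by (simp add: hist_eq_iff[OF len])
      have "xi P s w = n ! (s - 1)" if "s \<in> {2..t}" for s using eq[of "s - 1"] that by (cases s) auto
      then show "w \<in> (\<lambda>w. \<lambda>t\<in>{2..horizon P}. xi P t w) -` ?E \<inter> space (prb P)"
        using w t xi_in_supp by (auto simp: space_scenario_law)
    next
      fix w assume "w \<in> (\<lambda>w. \<lambda>t\<in>{2..horizon P}. xi P t w) -` ?E \<inter> space (prb P)"
      then have w: "w \<in> space (prb P)" and eq: "\<And>s. s \<in> {2..t} \<Longrightarrow> xi P s w = n ! (s - 1)"
        using t by auto
      have "xi P (Suc i) w = n ! i" if "i < t" for i
        using eq[of "Suc i"] xi_1[OF w] n0 that by (cases i) auto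
      then show "w \<in> {w \<in> space (prb P). hist t w = n}" using w by (simp add: hist_eq_iff[OF len])
    qed
    also have "prob \<dots> = path_pr n" using prob_hist[OF _ len] t by simp
    finally have pos: "measure (scenario_law P) ?E > 0" using path_pr_pos[OF n] by simp
    have "sampled_node P \<omega> k t = n" if "\<omega> k \<in> ?E" for \<omega> :: "nat \<Rightarrow> nat \<Rightarrow> real ^ 'k" and k
    proof (rule nth_equalityI)
      fix i assume "i < length (sampled_node P \<omega> k t)"
      then show "sampled_node P \<omega> k t ! i = n ! i"
        using that n0 by (auto simp: sampled_node_def simp del: upt_Suc)
    qed (simp add: len)
    then have sub: "{k. 1 \<le> k \<and> \<omega> k \<in> ?E} \<subseteq> {k. sampled_node P \<omega> k t = n}"
      for \<omega> :: "nat \<Rightarrow> nat \<Rightarrow> real ^ 'k" by blast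
    from AE_iid_infinitely_often[OF prob_space_scenario_law E pos]
    show ?thesis
      unfolding sample_space_def by (rule eventually_mono) (rule infinite_super[OF sub])
  qed
  have "AE \<omega> in sample_space P. \<forall>t\<in>{1..horizon P}. \<forall>n\<in>nodes P t. infinite {k. sampled_node P \<omega> k t = n}"
    using one finite_nodes by (intro AE_finite_allI) auto
  then show ?thesis
    using AE_space
  proof eventually_elim
    case (elim \<omega>)
    then have "\<omega> k \<in> space (scenario_law P)" if "1 \<le> k" for k
      using that by (auto simp: sample_space_def space_PiM)
    then show ?case using elim(1) by (auto simp: space_scenario_law PiE_iff)
  qed
qed

end

section \<open>Dynamic programming on the scenario tree\<close>

context regular_msp
begin

definition tree_feasible :: "((real ^ 'k) list \<Rightarrow> real ^ 'n) \<Rightarrow> bool"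
  where "tree_feasible xs \<longleftrightarrow> xs [] = init P \<and>
    (\<forall>t<horizon P. \<forall>n\<in>nodes P t. \<forall>z\<in>supp P (Suc t). xs (n @ [z]) \<in> feas P (Suc t) (xs n) z)"

definition tree_cost :: "((real ^ 'k) list \<Rightarrow> real ^ 'n) \<Rightarrow> nat \<Rightarrow> real"
  where "tree_cost xs T = (\<Sum>t<T. \<Sum>n\<in>nodes P t. \<Sum>z\<in>supp P (Suc t).
    path_pr (n @ [z]) * cost P (Suc t) (xs (n @ [z])) (xs n) z)"

lemma tree_feasible_in_decset:
  assumes "tree_feasible xs" "t \<le> horizon P" "n \<in> nodes P t"
  shows "xs n \<in> decset P t"
proof (cases t)
  case 0
  then show ?thesis using assms by (simp add: tree_feasible_def decset_def)
next
  case (Suc s)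
  then obtain m z where "n = m @ [z]" "m \<in> nodes P s" "z \<in> supp P (Suc s)"
    using assms(3) node_cases by blast
  then have "xs n \<in> feas P (Suc s) (xs m) z"
    using assms(1,2) Suc by (auto simp: tree_feasible_def)
  then show ?thesis using Suc feas_in_decset by blast
qed

lemma expected_rec:
  assumes xs: "tree_feasible xs" and t: "t < horizon P"
  shows "(\<Sum>n\<in>nodes P t. path_pr n * rec (Suc t) (xs n))
    = (\<Sum>n\<in>nodes P t. \<Sum>z\<in>supp P (Suc t). path_pr (n @ [z]) * val (Suc t) (xs n) z)"
proof (intro sum.cong refl)
  fix n assume n: "n \<in> nodes P t"
  have "rec (Suc t) (xs n) = (\<Sum>z\<in>supp P (Suc t). pr P (Suc t) z * val (Suc t) (xs n) z)"
    using rec_eq_sum_val[of "Suc t" "xs n"] tree_feasible_in_decset[OF xs _ n] t by simp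
  then show "path_pr n * rec (Suc t) (xs n)
      = (\<Sum>z\<in>supp P (Suc t). path_pr (n @ [z]) * val (Suc t) (xs n) z)"
    using length_node[OF n] by (simp add: path_pr_snoc sum_distrib_left mult.assoc)
qed

text \<open>
  The cost of the first stages plus the expected recourse from there on starts at
  \<open>\<Q>\<^sub>1(x\<^sub>0)\<close>, ends at the total cost, and in each step increases by the expected
  suboptimality of the stage decisions.
\<close>

lemma tree_cost_step:
  assumes xs: "tree_feasible xs" and t: "t < horizon P"
  shows "tree_cost xs (Suc t) + (\<Sum>n\<in>nodes P (Suc t). path_pr n * rec (Suc (Suc t)) (xs n))
    = tree_cost xs t + (\<Sum>n\<in>nodes P t. path_pr n * rec (Suc t) (xs n))
     + (\<Sum>n\<in>nodes P t. \<Sum>z\<in>supp P (Suc t). path_pr (n @ [z]) *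
         (cost P (Suc t) (xs (n @ [z])) (xs n) z + rec (Suc (Suc t)) (xs (n @ [z])) - val (Suc t) (xs n) z))"
  unfolding expected_rec[OF xs t] sum_nodes_Suc tree_cost_def lessThan_Suc
  by (simp add: distrib_left right_diff_distrib sum.distrib sum_subtractf)

lemma tree_cost_final:
  "(\<Sum>n\<in>nodes P (horizon P). path_pr n * rec (Suc (horizon P)) (xs n)) = 0"
  by (simp add: rec_final)

text \<open>
  The increments in \<open>tree_cost_step\<close> are nonnegative, as the stage value is an infimum.
\<close>

lemma rec_le_tree_cost:
  assumes xs: "tree_feasible xs"
  shows "rec 1 (init P) \<le> tree_cost xs (horizon P)"
proof -
  have "rec 1 (init P) \<le> tree_cost xs t + (\<Sum>n\<in>nodes P t. path_pr n * rec (Suc t) (xs n))"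
    if "t \<le> horizon P" for t
    using that
  proof (induction t)
    case 0
    show ?case using xs by (simp add: tree_cost_def tree_feasible_def)
  next
    case (Suc t)
    then have t: "t < horizon P" by simp
    have "0 \<le> (\<Sum>n\<in>nodes P t. \<Sum>z\<in>supp P (Suc t). path_pr (n @ [z]) *
      (cost P (Suc t) (xs (n @ [z])) (xs n) z + rec (Suc (Suc t)) (xs (n @ [z])) - val (Suc t) (xs n) z))"
    proof (intro sum_nonneg mult_nonneg_nonneg)
      fix n z assume n: "n \<in> nodes P t" and z: "z \<in> supp P (Suc t)"
      show "0 \<le> path_pr (n @ [z])" using path_pr_pos[of "n @ [z]" "Suc t"] n z by (simp add: node_snoc)
      have "xs n \<in> decset P t" by (rule tree_feasible_in_decset[OF xs _ n]) (use t in simp)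
      moreover have "xs (n @ [z]) \<in> feas P (Suc t) (xs n) z"
        using xs t n z by (simp add: tree_feasible_def)
      ultimately show "0 \<le> cost P (Suc t) (xs (n @ [z])) (xs n) z + rec (Suc (Suc t)) (xs (n @ [z]))
          - val (Suc t) (xs n) z"
        using val_le[of "Suc t" z "xs n" "xs (n @ [z])"] t z by simp
    qed
    then show ?case using Suc t tree_cost_step[OF xs t] by simp
  qed
  from this[of "horizon P"] show ?thesis by (simp add: tree_cost_final)
qed

definition tree_optimal :: "((real ^ 'k) list \<Rightarrow> real ^ 'n) \<Rightarrow> bool"
  where "tree_optimal xs \<longleftrightarrow> xs [] = init P \<and>
    (\<forall>t<horizon P. \<forall>n\<in>nodes P t. \<forall>z\<in>supp P (Suc t).
       stage_opt P (Suc t) (recourse P (Suc (Suc t))) (xs n) z (xs (n @ [z])))"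

lemma tree_optimal_imp_feasible: "tree_optimal xs \<Longrightarrow> tree_feasible xs"
  by (auto simp: tree_optimal_def tree_feasible_def stage_opt_def)

lemma tree_cost_optimal:
  assumes xs: "tree_optimal xs"
  shows "tree_cost xs (horizon P) = rec 1 (init P)"
proof -
  note feas = tree_optimal_imp_feasible[OF xs]
  have "tree_cost xs t + (\<Sum>n\<in>nodes P t. path_pr n * rec (Suc t) (xs n)) = rec 1 (init P)"
    if "t \<le> horizon P" for t
    using that
  proof (induction t)
    case 0
    show ?case using xs by (simp add: tree_cost_def tree_optimal_def)
  next
    case (Suc t)
    then have t: "t < horizon P" by simp
    have "val (Suc t) (xs n) z = cost P (Suc t) (xs (n @ [z])) (xs n) z + rec (Suc (Suc t)) (xs (n @ [z]))"
      if "n \<in> nodes P t" "z \<in> supp P (Suc t)" for n z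
      by (rule val_eq(2)) (use xs t that in \<open>auto simp: tree_optimal_def\<close>)
    then show ?case using Suc t tree_cost_step[OF feas t] by simp
  qed
  from this[of "horizon P"] show ?thesis by (simp add: tree_cost_final)
qed

text \<open>
  The recursion runs over the reversed history, whose head is the last realization.
\<close>

primrec greedy :: "(real ^ 'k) list \<Rightarrow> real ^ 'n"
  where
    "greedy [] = init P"
  | "greedy (z # l) = (SOME x. stage_opt P (Suc (length l)) (recourse P (Suc (Suc (length l)))) (greedy l) z x)"

lemma tree_optimal_exists: "tree_optimal (\<lambda>n. greedy (rev n))"
proof -
  have opt: "stage_opt P (Suc t) (recourse P (Suc (Suc t))) (greedy (rev n)) z (greedy (rev (n @ [z])))"
    if t: "t < horizon P" and n: "n \<in> nodes P t" and z: "z \<in> supp P (Suc t)"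
      and mem: "greedy (rev n) \<in> decset P t" for t n z
  proof -
    have "\<exists>x. stage_opt P (Suc t) (recourse P (Suc (Suc t))) (greedy (rev n)) z x"
      using stage_opt_recourse_exists[of "Suc t" z "greedy (rev n)"] t z mem by auto
    then show ?thesis using length_node[OF n] by (simp add: someI_ex)
  qed
  have mem: "greedy (rev n) \<in> decset P t" if "t \<le> horizon P" "n \<in> nodes P t" for t n
    using that
  proof (induction t arbitrary: n)
    case 0
    then show ?case by (simp add: decset_def)
  next
    case (Suc t)
    obtain m z where n: "n = m @ [z]" and m: "m \<in> nodes P t" and z: "z \<in> supp P (Suc t)"
      using node_cases[OF Suc.prems(2)] by blast
    show ?case
      unfolding n by (rule stage_opt_in_decset[OF opt[OF _ m z]]) (use Suc m in auto)
  qed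
  show ?thesis using opt mem by (auto simp: tree_optimal_def)
qed


section \<open>Policies and scenario trees\<close>

lemma space_filt: "space (filt P t) = space (prb P)"
  unfolding filt_def by (rule space_measure_of) auto

lemma sets_filt: "sets (filt P t) = sigma_sets (space (prb P))
    {xi P j -` S \<inter> space (prb P) | j S. j \<in> {1..t} \<and> S \<in> sets borel}"
  unfolding filt_def by (rule sets_measure_of) auto

text \<open>
  The sets that do not separate outcomes with the same history form a \<open>\<sigma>\<close>-algebra containing the
  generators of \<open>\<F>\<^sub>t\<close>.
\<close>

lemma filt_atom:
  assumes "A \<in> sets (filt P t)" and w: "w \<in> space (prb P)" "w' \<in> space (prb P)" "hist t w = hist t w'"
  shows "w \<in> A \<longleftrightarrow> w' \<in> A"
  using assms(1) unfolding sets_filt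
proof (induction rule: sigma_sets.induct)
  case (Basic A)
  then obtain j S where A: "A = xi P j -` S \<inter> space (prb P)" "j \<in> {1..t}" by blast
  then have "xi P j w = xi P j w'"
    using hist_nth[of "j - 1" t w] hist_nth[of "j - 1" t w'] w(3) by (cases j) auto
  then show ?case using A(1) w by simp
qed (use w in auto)

lemma filt_hist_event: "{w \<in> space (prb P). hist t w = n} \<in> sets (filt P t)"
proof (cases "length n = t")
  case True
  have "{w \<in> space (filt P t). xi P (Suc i) w = n ! i} \<in> sets (filt P t)" if "i < t" for i
  proof -
    have "xi P (Suc i) -` {n ! i} \<inter> space (prb P) \<in> sets (filt P t)"
      unfolding sets_filt using that by (intro sigma_sets.Basic CollectI exI[of _ "Suc i"] exI[of _ "{n ! i}"]) auto
    moreover have "xi P (Suc i) -` {n ! i} \<inter> space (prb P) = {w \<in> space (filt P t). xi P (Suc i) w = n ! i}"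
      by (auto simp: space_filt)
    ultimately show ?thesis by simp
  qed
  then have "{w \<in> space (filt P t). \<forall>i\<in>{..<t}. xi P (Suc i) w = n ! i} \<in> sets (filt P t)"
    by (intro sets.sets_Collect_finite_All) auto
  moreover have "{w \<in> space (prb P). hist t w = n} =
      {w \<in> space (filt P t). \<forall>i\<in>{..<t}. xi P (Suc i) w = n ! i}"
    using hist_eq_iff[OF True] by (auto simp: space_filt)
  ultimately show ?thesis by (simp only:)
next
  case False
  then have "{w \<in> space (prb P). hist t w = n} = {}" by auto
  then show ?thesis by (simp only: sets.empty_sets)
qed

lemma measurable_hist:
  assumes "t \<le> horizon P"
  shows "(\<lambda>w. xs (hist t w) :: real ^ 'n) \<in> borel_measurable (filt P t)"
proof (rule measurableI)
  fix S
  have "(\<lambda>w. xs (hist t w)) -` S \<inter> space (filt P t)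
      = (\<Union>n\<in>{n \<in> nodes P t. xs n \<in> S}. {w \<in> space (prb P). hist t w = n})"
    using hist_in_nodes[OF _ assms] by (auto simp: space_filt)
  also have "\<dots> \<in> sets (filt P t)"
    using finite_nodes[OF assms] filt_hist_event by (intro sets.finite_UN) auto
  finally show "(\<lambda>w. xs (hist t w)) -` S \<inter> space (filt P t) \<in> sets (filt P t)" .
qed simp

definition represents :: "((real ^ 'k) list \<Rightarrow> real ^ 'n) \<Rightarrow> (nat \<Rightarrow> 'w \<Rightarrow> real ^ 'n) \<Rightarrow> bool"
  where "represents xs y \<longleftrightarrow> xs [] = init P \<and>
    (\<forall>t\<in>{1..horizon P}. \<forall>w\<in>space (prb P). y t w = xs (hist t w))"

lemma represents_prev:
  assumes "represents xs y" "t \<in> {1..horizon P}" "w \<in> space (prb P)"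
  shows "prev P y t w = xs (hist (t - 1) w)"
proof (cases "t = 1")
  case False
  then have "t - 1 \<in> {1..horizon P}" using assms(2) by auto
  then show ?thesis using assms False by (simp add: prev_def represents_def)
qed (use assms in \<open>simp add: prev_def represents_def\<close>)

lemma objective_eq_tree_cost:
  assumes rep: "represents xs y"
  shows "objective P y = tree_cost xs (horizon P)"
proof -
  \<comment> \<open>The stage cost as a function of the history alone.\<close>
  define \<phi> where "\<phi> t m = cost P t (xs m) (xs (butlast m)) (last m)" for t m
  have eq: "cost P t (y t w) (prev P y t w) (xi P t w) = \<phi> t (hist t w)"
    if "t \<in> {1..horizon P}" "w \<in> space (prb P)" for t w
    using rep that represents_prev[OF rep that] hist_pred[of t w]
    by (simp add: represents_def \<phi>_def)
  have "objective P y = (\<integral>w. (\<Sum>t = 1..horizon P. \<phi> t (hist t w)) \<partial>prb P)"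
    unfolding objective_def using eq by (intro Bochner_Integration.integral_cong) auto
  also have "\<dots> = (\<Sum>t = 1..horizon P. \<integral>w. \<phi> t (hist t w) \<partial>prb P)"
    using expectation_hist(1) by (intro Bochner_Integration.integral_sum) auto
  also have "\<dots> = (\<Sum>t = 1..horizon P. \<Sum>m\<in>nodes P t. path_pr m * \<phi> t m)"
    using expectation_hist(2) by (intro sum.cong) auto
  also have "\<dots> = (\<Sum>t<horizon P. \<Sum>m\<in>nodes P (Suc t). path_pr m * \<phi> (Suc t) m)"
    by (rule sum.reindex_bij_witness[of _ Suc "\<lambda>t. t - 1"]) auto
  also have "\<dots> = tree_cost xs (horizon P)"
    unfolding tree_cost_def sum_nodes_Suc by (simp add: \<phi>_def)
  finally show ?thesis .
qed

lemma represents_tree_policy: "xs [] = init P \<Longrightarrow> represents xs (tree_policy P xs)"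
  by (simp add: represents_def tree_policy_def hist_def)

lemma feasible_tree_policy:
  assumes xs: "tree_feasible xs"
  shows "feasible_policy P (tree_policy P xs)"
  unfolding feasible_policy_def
proof (intro ballI conjI)
  fix t assume t: "t \<in> {1..horizon P}"
  have "tree_policy P xs t = (\<lambda>w. xs (hist t w))" by (auto simp: tree_policy_def hist_def)
  then show "tree_policy P xs t \<in> borel_measurable (filt P t)" using measurable_hist t by simp
  have rep: "represents xs (tree_policy P xs)"
    using xs by (intro represents_tree_policy) (simp add: tree_feasible_def)
  show "AE w in prb P. tree_policy P xs t w \<in> feas P t (prev P (tree_policy P xs) t w) (xi P t w)"
  proof (rule AE_I2)
    fix w assume w: "w \<in> space (prb P)"
    have "hist (t - 1) w \<in> nodes P (t - 1)" by (rule hist_in_nodes[OF w]) (use t in auto)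
    then have "xs (hist (t - 1) w @ [xi P t w]) \<in> feas P (Suc (t - 1)) (xs (hist (t - 1) w)) (xi P t w)"
      using xs xi_in_supp[OF t w] t unfolding tree_feasible_def by (cases t) auto
    then show "tree_policy P xs t w \<in> feas P t (prev P (tree_policy P xs) t w) (xi P t w)"
      using represents_prev[OF rep t w] rep t w hist_pred[of t w] by (simp add: represents_def)
  qed
qed

text \<open>
  Evaluating the policy at an arbitrary outcome with history \<open>n\<close> gives its value at the node \<open>n\<close>. A
  constraint that holds almost surely holds at every node, since no node has probability \<open>0\<close>.
\<close>

lemma feasible_policy_represented:
  assumes y: "feasible_policy P y"
  obtains xs where "represents xs y" "tree_feasible xs"
proof -
  define wit where "wit n = (SOME w. w \<in> space (prb P) \<and> hist (length n) w = n)" for n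
  define xs where "xs n = (if n = [] then init P else y (length n) (wit n))" for n
  have rep: "represents xs y"
    unfolding represents_def
  proof (intro conjI ballI)
    show "xs [] = init P" by (simp add: xs_def)
    fix t w assume t: "t \<in> {1..horizon P}" and w: "w \<in> space (prb P)"
    have "\<exists>w'. w' \<in> space (prb P) \<and> hist (length (hist t w)) w' = hist t w" using w by auto
    then have wit: "wit (hist t w) \<in> space (prb P)" "hist t (wit (hist t w)) = hist t w"
      unfolding wit_def by (metis (mono_tags, lifting) length_hist someI_ex)+
    have "y t -` {y t w} \<inter> space (filt P t) \<in> sets (filt P t)"
      using y t by (intro measurable_sets[of "y t" "filt P t" borel]) (auto simp: feasible_policy_def)
    from filt_atom[OF this wit(1) w wit(2)] have "y t (wit (hist t w)) = y t w"
      using wit(1) w by (simp add: space_filt)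
    moreover have "hist t w \<noteq> []" using t length_hist[of t w] by (auto simp del: length_hist)
    ultimately show "y t w = xs (hist t w)" by (simp add: xs_def)
  qed
  have "xs (n @ [z]) \<in> feas P (Suc t) (xs n) z"
    if t: "t < horizon P" and n: "n \<in> nodes P t" and z: "z \<in> supp P (Suc t)" for t n z
  proof (rule ccontr)
    assume infeas: "xs (n @ [z]) \<notin> feas P (Suc t) (xs n) z"
    have t1: "Suc t \<in> {1..horizon P}" using t by simp
    let ?A = "{w \<in> space (prb P). hist (Suc t) w = n @ [z]}"
    have len: "length (n @ [z]) = Suc t" using length_node[OF n] by simp
    have "AE w in prb P. y (Suc t) w \<in> feas P (Suc t) (prev P y (Suc t) w) (xi P (Suc t) w)"
      using y t1 by (simp add: feasible_policy_def)
    then have "AE w in prb P. w \<notin> ?A"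
      using AE_space
    proof eventually_elim
      case (elim w)
      show ?case
      proof
        assume w: "w \<in> ?A"
        then have "hist t w = n" "xi P (Suc t) w = z" by (auto simp: hist_Suc)
        then show False
          using elim infeas w represents_prev[OF rep t1] rep t1 by (simp add: represents_def)
      qed
    qed
    then have "prob ?A = 0" using prob_eq_0[OF hist_event[of "Suc t" "n @ [z]"]] t by simp
    moreover have "prob ?A = path_pr (n @ [z])" using prob_hist[OF _ len] t by simp
    moreover have "path_pr (n @ [z]) > 0" using path_pr_pos[of "n @ [z]" "Suc t"] n z by (simp add: node_snoc)
    ultimately show False by simp
  qed
  then have "tree_feasible xs" using rep by (simp add: tree_feasible_def represents_def)
  then show ?thesis using rep that by blast
qed

lemma rec_le_objective: "feasible_policy P y \<Longrightarrow> rec 1 (init P) \<le> objective P y"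
  using feasible_policy_represented objective_eq_tree_cost rec_le_tree_cost by metis

lemma tree_optimal_policy:
  assumes xs: "tree_optimal xs"
  shows "optimal_policy P (tree_policy P xs)" "objective P (tree_policy P xs) = rec 1 (init P)"
proof -
  have "xs [] = init P" using xs by (simp add: tree_optimal_def)
  then show obj: "objective P (tree_policy P xs) = rec 1 (init P)"
    using objective_eq_tree_cost[OF represents_tree_policy] tree_cost_optimal[OF xs] by simp
  show "optimal_policy P (tree_policy P xs)"
    unfolding optimal_policy_def obj
    using feasible_tree_policy[OF tree_optimal_imp_feasible[OF xs]] rec_le_objective by blast
qed

theorem recourse_eq_msp_value: "recourse P 1 (init P) = msp_value P"
proof -
  have "recourse P 1 (init P) = ereal (rec 1 (init P))"
    using recourse_eq[of 1 "init P"] by (simp add: decset_def)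
  also have "\<dots> = msp_value P"
    unfolding msp_value_def
  proof (rule antisym)
    show "ereal (rec 1 (init P)) \<le> (INF x\<in>{x. feasible_policy P x}. ereal (objective P x))"
      using rec_le_objective by (intro INF_greatest) simp
    let ?x = "tree_policy P (\<lambda>n. greedy (rev n))"
    have "feasible_policy P ?x"
      using tree_optimal_policy(1)[OF tree_optimal_exists] by (simp add: optimal_policy_def)
    then have "(INF x\<in>{x. feasible_policy P x}. ereal (objective P x)) \<le> ereal (objective P ?x)"
      by (intro INF_lower) simp
    then show "(INF x\<in>{x. feasible_policy P x}. ereal (objective P x)) \<le> ereal (rec 1 (init P))"
      using tree_optimal_policy(2)[OF tree_optimal_exists] by simp
  qed
  finally show ?thesis .
qed

end

lemma (in dasc_exhaustive) accumulation_point_optimal: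
  assumes "accumulation_point P R xs"
  shows "optimal_policy P (tree_policy P xs)"
proof (rule tree_optimal_policy(1))
  have eq: "xs n = xlim n" if "t \<le> horizon P" "n \<in> nodes P t" for t n
    by (rule accumulation_point_eq_xlim[OF assms that])
  show "tree_optimal xs"
    unfolding tree_optimal_def
  proof (intro conjI allI impI ballI)
    show "xs [] = init P" using eq[of 0 "[]"] xlim_root by simp
    fix t n z assume t: "t < horizon P" and n: "n \<in> nodes P t" and z: "z \<in> supp P (Suc t)"
    show "stage_opt P (Suc t) (recourse P (Suc (Suc t))) (xs n) z (xs (n @ [z]))"
      using xlim_stage_opt[of "Suc t" n z] eq[of t n] eq[of "Suc t" "n @ [z]"] t n z
      by (simp add: node_snoc)
  qed
qed


section \<open>Convergence of DASC\<close>

theorem theorem7p2: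
  fixes P :: "('w, 'n::finite, 'k::finite, 'q::finite, 'p::finite) msp"
    and r :: real
  assumes "horizon P \<ge> 1"
    and "H0 P"
    and "H1 P"
    and "r > 0" and "continuous_data P r"
  shows
    "(AE \<omega> in sample_space P. \<forall>R. dasc P r \<omega> R \<longrightarrow>
        (\<forall>t\<in>{2..horizon P + 1}. \<forall>n\<in>nodes P (t - 1).
           (\<lambda>k. recourse P t (fwd R k n) - approx P \<omega> R k t (fwd R k n)) \<longlonglongrightarrow> 0)) \<and>
     (AE \<omega> in sample_space P. \<forall>R. dasc P r \<omega> R \<longrightarrow>
        (\<lambda>k. stage_obj P 1 (approx P \<omega> R (k - 1) 2) (fwd R k [xi1 P]) (init P) (xi1 P))
          \<longlonglongrightarrow> recourse P 1 (init P) \<and>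
        (\<lambda>k. stage_val P 1 (approx P \<omega> R k 2) (init P) (xi1 P)) \<longlonglongrightarrow> recourse P 1 (init P)) \<and>
     recourse P 1 (init P) = msp_value P \<and>
     (AE \<omega> in sample_space P. \<forall>R. dasc P r \<omega> R \<longrightarrow>
        (\<forall>xs. accumulation_point P R xs \<longrightarrow> optimal_policy P (tree_policy P xs)))"
proof -
  interpret regular_msp P r using assms by unfold_locales
  have exec: "AE \<omega> in sample_space P. \<forall>R. dasc P r \<omega> R \<longrightarrow> dasc_exhaustive P r \<omega> R"
    using AE_samples
  proof eventually_elim
    case (elim \<omega>)
    then show ?case by (intro allI impI) (unfold_locales; blast)
  qed
  show ?thesis
  proof (intro conjI)
    show "AE \<omega> in sample_space P. \<forall>R. dasc P r \<omega> R \<longrightarrow>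
        (\<forall>t\<in>{2..horizon P + 1}. \<forall>n\<in>nodes P (t - 1).
           (\<lambda>k. recourse P t (fwd R k n) - approx P \<omega> R k t (fwd R k n)) \<longlonglongrightarrow> 0)"
      using exec by eventually_elim (use dasc_exhaustive.recourse_gap_tendsto_0 in blast)
    show "AE \<omega> in sample_space P. \<forall>R. dasc P r \<omega> R \<longrightarrow>
        (\<lambda>k. stage_obj P 1 (approx P \<omega> R (k - 1) 2) (fwd R k [xi1 P]) (init P) (xi1 P))
          \<longlonglongrightarrow> recourse P 1 (init P) \<and>
        (\<lambda>k. stage_val P 1 (approx P \<omega> R k 2) (init P) (xi1 P)) \<longlonglongrightarrow> recourse P 1 (init P)"
      using exec by eventually_elim (use dasc_exhaustive.first_stage_value_tendsto in blast)
    show "recourse P 1 (init P) = msp_value P" by (rule recourse_eq_msp_value)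
    show "AE \<omega> in sample_space P. \<forall>R. dasc P r \<omega> R \<longrightarrow>
        (\<forall>xs. accumulation_point P R xs \<longrightarrow> optimal_policy P (tree_policy P xs))"
      using exec by eventually_elim (use dasc_exhaustive.accumulation_point_optimal in blast)
  qed
qed

end
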